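(* Let $p$ be a prime. (i) Let $(R,\varphi)$ be a twisted ring of characteristic $p$. The base change $(R,\varphi)\otimes_{\mathbb F_{\sqrt p}}\mathbb T_p$ is the $\mathbb T_p$-algebra $\bigl(R\times R,\ (x,y)\mapsto(\varphi(y),\varphi(x))\bigr)$ with structure morphism the natural map $\mathbb F_p\times\mathbb F_p\to R\times R$, and it corresponds, under the equivalence between $\mathbb T_p$-algebras and mixed rings of characteristic $p$, to the mixed ring $(R,R,\varphi,\varphi)$. (ii) Let $(k,\sigma)$ be a twisted ring of characteristic $p$ and let $(R,\varphi)$ be a $(k,\sigma)$-algebra. The base change of $(R,\varphi)$ to the twisted ring $\bigl(k\times k,\ (x,y)\mapsto(\sigma(y),\sigma(x))\bigr)$ corresponds to the mixed $(k,k,\sigma,\sigma)$-algebra $(R,R,\varphi,\varphi)$. (iii) Let $(\mathsf X_n,p)\in\{(\mathsf B_2,2),(\mathsf G_2,3),(\mathsf F_4,2)\}$, let $k$ be a field of characteristic $p$ with a Tits endomorphism $\sigma$, and let $\tilde G={}^2\mathsf X_n$ be the twisted linear algebraic group of type ${}^2\mathsf X_n$ over $(k,\sigma)$. Then its base change to $\bigl(k\times k,\ (x,y)\mapsto(\sigma(y),\sigma(x))\bigr)$, viewed as a mixed linear algebraic group over $(k,k,\sigma,\sigma)$ and transported along the isomorphism of mixed rings $(k,k,\sigma,\sigma)\cong(k^\sigma,k)$ given by $(\sigma,\mathrm{id}_k)$, is the mixed linear algebraic group of type $\mathsf X_n$ over $(k^\sigma,k)$.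
   Context: **Twisted rings.** A twisted ring of characteristic $p$ is a pair $(R,\varphi)$ with $R$ a commutative ring of characteristic $p$ and $\varphi$ a ring endomorphism with $\varphi^2$ equal to the Frobenius $x\mapsto x^p$; morphisms are ring morphisms commuting with the given endomorphisms. A $\tilde k$-algebra over a twisted ring $\tilde k$ is a twisted ring with a morphism of twisted rings from $\tilde k$. The tensor product of $\tilde k$-algebras, $\tilde k=(k,\sigma)$, is $(R,\varphi_R)\otimes_{\tilde k}(S,\varphi_S)=(R\otimes_kS,\varphi_R\otimes\varphi_S)$; viewed as an $(S,\varphi_S)$-algebra it is the base change of $(R,\varphi_R)$ to $(S,\varphi_S)$. Here $\mathbb F_{\sqrt p}=(\mathbb F_p,\mathrm{id})$ (every twisted ring of characteristic $p$ is uniquely an $\mathbb F_{\sqrt p}$-algebra) and $\mathbb T_p=(\mathbb F_p\times\mathbb F_p,(x,y)\mapsto(y,x))$, which is $\mathbb F_p$ viewed as a twisted ring. The map $k\to k\times k$, $x\mapsto(x,x)$, is the morphism used for base change in (ii) and (iii). **Mixed rings.** A mixed ring of characteristic $p$ is a quadruple $(R_1,R_2,\varphi_1,\varphi_2)$ with $R_1,R_2$ commutative rings of characteristic $p$ and ring morphisms $\varphi_1\colon R_1\to R_2$, $\varphi_2\colon R_2\to R_1$ whose two composites are the Frobenius maps of $R_1$ and $R_2$. A morphism is a pair of ring morphisms $(f_1,f_2)$, $f_i\colon R_i\to S_i$, commuting with these maps. A mixed algebra over a mixed ring is a mixed ring with a morphism from that base. For fields $\ell^p\subseteq k_0\subseteq\ell$,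 $(k_0,\ell)$ denotes the mixed ring $(k_0,\ell,\mathrm{inc},x\mapsto x^p)$. **Equivalence.** The equivalence between mixed rings and $\mathbb T_p$-algebras sends $(R_1,R_2,\varphi_1,\varphi_2)$ to $R_1\times R_2$ with endomorphism $(r_1,r_2)\mapsto(\varphi_2(r_2),\varphi_1(r_1))$ and the obvious structure morphism $\mathbb F_p\times\mathbb F_p\to R_1\times R_2$. It induces the correspondence between algebras over $\bigl(k\times k,(x,y)\mapsto(\sigma(y),\sigma(x))\bigr)$ and mixed $(k,k,\sigma,\sigma)$-algebras. **Groups.** Twisted (mixed) linear algebraic groups over a twisted (mixed) ring are representable functors from twisted (mixed) algebras over that ring to groups, represented by a finitely generated algebra; they are dual to the corresponding commutative finitely generated Hopf algebras, and base change of groups means base change of Hopf algebras. A Tits endomorphism of a field $k$ of characteristic $p$ is an endomorphism $\sigma$ with $\sigma^2$ the Frobenius; $k^\sigma$ denotes its image. For $(\mathsf X_n,p)$ as in (iii), let $\mathbf G$ be the split adjoint connected semisimple group of type $\mathsf X_n$ over $\mathbb F_p$, $A=\mathbb F_p[\mathbf G]$, and $\varphi\colon A\to A$ the Hopf algebra endomorphism dual to the special isogeny $\alpha_\pi\colon\mathbf G\to\mathbf G$ given on root subgroups by $x_r(t)\mapsto x_{\overline r}(t^{\lambda(\overline r)})$, where $r\mapsto\overline r$ is the permutation of the roots induced by the non-trivial symmetry of the Dynkin diagram (disregarding the arrow), interchanging long and short roots, and $\lambda$ equals $1$ on short and $p$ on long roots; $\varphi^2$ is the Frobenius of $A$. The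 twisted linear algebraic group of type ${}^2\mathsf X_n$ over $(k,\sigma)$ corresponds to the twisted Hopf algebra $(A\otimes_{\mathbb F_p}k,\ \varphi\otimes\sigma)$. For fields $\ell^p\subseteq k_0\subseteq\ell$, the mixed linear algebraic group of type $\mathsf X_n$ over $(k_0,\ell)$ corresponds to the mixed Hopf algebra $(A\otimes_{\mathbb F_p}k_0,\ A\otimes_{\mathbb F_p}\ell,\ \varphi\otimes\mathrm{inc},\ \varphi\otimes\mathrm{fr})$, where $\mathrm{fr}\colon\ell\to k_0$, $x\mapsto x^p$. *)

theory Defs
  imports
    "HOL-Algebra.Algebraic_Closure" "HOL-Algebra.Chinese_Remainder" "HOL-Algebra.Generated_Rings"
    "HOL-Algebra.IntRing" "HOL-Algebra.Solvable_Groups" "HOL-Algebra.UnivPoly"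
    "HOL-Number_Theory.Residues" "HOL-Analysis.Function_Topology"
begin

section \<open>Monoid rings and tensor products\<close>

text \<open>\<open>monoid_ring C G\<close> is the monoid algebra \<open>C[G]\<close>, realised as finitely supported functions.\<close>

definition monoid_ring :: "('c, 'm) ring_scheme \<Rightarrow> ('g, 'n) monoid_scheme \<Rightarrow> ('g \<Rightarrow> 'c) ring" where
  "monoid_ring C G =
    \<lparr>carrier = {u. (\<forall>x. u x \<in> carrier C) \<and> finite {x. u x \<noteq> \<zero>\<^bsub>C\<^esub>} \<and> {x. u x \<noteq> \<zero>\<^bsub>C\<^esub>} \<subseteq> carrier G},
     monoid.mult = (\<lambda>u v z. \<Oplus>\<^bsub>C\<^esub>w \<in> {(x, y). u x \<noteq> \<zero>\<^bsub>C\<^esub> \<and> v y \<noteq> \<zero>\<^bsub>C\<^esub> \<and> x \<otimes>\<^bsub>G\<^esub> y = z}. u (fst w) \<otimes>\<^bsub>C\<^esub> v (snd w)),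
     one = (\<lambda>z. if z = \<one>\<^bsub>G\<^esub> then \<one>\<^bsub>C\<^esub> else \<zero>\<^bsub>C\<^esub>),
     ring.zero = (\<lambda>z. \<zero>\<^bsub>C\<^esub>),
     add = (\<lambda>u v z. u z \<oplus>\<^bsub>C\<^esub> v z)\<rparr>"

definition basis_elt :: "('c, 'm) ring_scheme \<Rightarrow> 'g \<Rightarrow> 'g \<Rightarrow> 'c" where
  "basis_elt C x = (\<lambda>z. if z = x then \<one>\<^bsub>C\<^esub> else \<zero>\<^bsub>C\<^esub>)"

text \<open>
  For commutative rings \<open>R\<close>, \<open>S\<close> with structure maps \<open>f\<close>, \<open>g\<close> from \<open>k\<close>, the ring \<open>R \<otimes>\<^sub>k S\<close> is the
  quotient of \<open>\<int>[R \<times> S]\<close>, the monoid ring of the multiplicative monoid \<open>R \<times> S\<close>, by the ideal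
  generated by the relations of bilinearity over \<open>k\<close>. The span of these relations is already stable
  under multiplication by the basis \<open>R \<times> S\<close>, so the additive group is the usual one.
\<close>

type_synonym ('a, 'b) tensor = "('a \<times> 'b \<Rightarrow> int) set"

definition pre_tensor :: "('a, 'm) ring_scheme \<Rightarrow> ('b, 'n) ring_scheme \<Rightarrow> ('a \<times> 'b \<Rightarrow> int) ring" where
  "pre_tensor R S = monoid_ring int_ring (R \<times>\<times> S)"

definition tensor_ideal ::
  "('c, 'l) ring_scheme \<Rightarrow> ('c \<Rightarrow> 'a) \<Rightarrow> ('a, 'm) ring_scheme \<Rightarrow> ('c \<Rightarrow> 'b) \<Rightarrow> ('b, 'n) ring_scheme
    \<Rightarrow> ('a \<times> 'b \<Rightarrow> int) set" where
  "tensor_ideal k f R g S =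
    (let F = pre_tensor R S; e = (\<lambda>a b. basis_elt int_ring (a, b)) in
     Idl\<^bsub>F\<^esub>
      ({e (a \<oplus>\<^bsub>R\<^esub> a') b \<ominus>\<^bsub>F\<^esub> (e a b \<oplus>\<^bsub>F\<^esub> e a' b) | a a' b. a \<in> carrier R \<and> a' \<in> carrier R \<and> b \<in> carrier S}
     \<union> {e a (b \<oplus>\<^bsub>S\<^esub> b') \<ominus>\<^bsub>F\<^esub> (e a b \<oplus>\<^bsub>F\<^esub> e a b') | a b b'. a \<in> carrier R \<and> b \<in> carrier S \<and> b' \<in> carrier S}
     \<union> {e (f c \<otimes>\<^bsub>R\<^esub> a) b \<ominus>\<^bsub>F\<^esub> e a (g c \<otimes>\<^bsub>S\<^esub> b) | c a b. c \<in> carrier k \<and> a \<in> carrier R \<and> b \<in> carrier S}))"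

definition tensor ::
  "('c, 'l) ring_scheme \<Rightarrow> ('c \<Rightarrow> 'a) \<Rightarrow> ('a, 'm) ring_scheme \<Rightarrow> ('c \<Rightarrow> 'b) \<Rightarrow> ('b, 'n) ring_scheme
    \<Rightarrow> ('a, 'b) tensor ring" where
  "tensor k f R g S = pre_tensor R S Quot tensor_ideal k f R g S"

definition pure ::
  "('c, 'l) ring_scheme \<Rightarrow> ('c \<Rightarrow> 'a) \<Rightarrow> ('a, 'm) ring_scheme \<Rightarrow> ('c \<Rightarrow> 'b) \<Rightarrow> ('b, 'n) ring_scheme
    \<Rightarrow> 'a \<Rightarrow> 'b \<Rightarrow> ('a, 'b) tensor" where
  "pure k f R g S a b = tensor_ideal k f R g S +>\<^bsub>pre_tensor R S\<^esub> basis_elt int_ring (a, b)"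

text \<open>
  \<open>tensor_lift T u v\<close> is the additive map \<open>a \<otimes> b \<mapsto> u a \<cdot> v b\<close> into the ring \<open>T\<close>. It is computed on
  representatives; \<open>the_elem\<close> is meaningful whenever \<open>(a, b) \<mapsto> u a \<cdot> v b\<close> respects the relations
  of the tensor product.
\<close>

definition tensor_lift ::
  "('d, 'm) ring_scheme \<Rightarrow> ('a \<Rightarrow> 'd) \<Rightarrow> ('b \<Rightarrow> 'd) \<Rightarrow> ('a, 'b) tensor \<Rightarrow> 'd" where
  "tensor_lift T u v Z =
    the_elem ((\<lambda>w. \<Oplus>\<^bsub>T\<^esub>z \<in> {z. w z \<noteq> 0}. [w z] \<cdot>\<^bsub>T\<^esub> (u (fst z) \<otimes>\<^bsub>T\<^esub> v (snd z))) ` Z)"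

text \<open>\<open>tensor_map k f R g S u v\<close> is \<open>u \<otimes> v\<close>, where \<open>R \<otimes>\<^sub>k S\<close> is the \<^emph>\<open>target\<close>; \<open>u\<close> and \<open>v\<close> need not
  preserve the unit.\<close>

definition tensor_map ::
  "('c, 'l) ring_scheme \<Rightarrow> ('c \<Rightarrow> 'a) \<Rightarrow> ('a, 'm) ring_scheme \<Rightarrow> ('c \<Rightarrow> 'b) \<Rightarrow> ('b, 'n) ring_scheme
    \<Rightarrow> ('r \<Rightarrow> 'a) \<Rightarrow> ('s \<Rightarrow> 'b) \<Rightarrow> ('r, 's) tensor \<Rightarrow> ('a, 'b) tensor" where
  "tensor_map k f R g S u v =
    tensor_lift (tensor k f R g S)
      (\<lambda>a. pure k f R g S (u a) \<one>\<^bsub>S\<^esub>) (\<lambda>b. pure k f R g S \<one>\<^bsub>R\<^esub> (v b))"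


section \<open>Twisted rings and mixed rings\<close>

text \<open>As usual when algebras are used functorially, ``of characteristic \<open>p\<close>'' means that \<open>p \<cdot> 1 = 0\<close>;
  for prime \<open>p\<close> this only adds the zero ring.\<close>

definition char_p_ring :: "nat \<Rightarrow> ('a, 'm) ring_scheme \<Rightarrow> bool" where
  "char_p_ring p R \<longleftrightarrow> cring R \<and> [p] \<cdot>\<^bsub>R\<^esub> \<one>\<^bsub>R\<^esub> = \<zero>\<^bsub>R\<^esub>"

record 'a twisted_ring =
  base :: "'a ring"
  endo :: "'a \<Rightarrow> 'a"

record ('a, 'b) mixed_ring =
  ring1 :: "'a ring"
  ring2 :: "'b ring"
  map12 :: "'a \<Rightarrow> 'b"
  map21 :: "'b \<Rightarrow> 'a"

definition is_twisted_ring :: "nat \<Rightarrow> 'a twisted_ring \<Rightarrow> bool" where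
  "is_twisted_ring p Z \<longleftrightarrow> char_p_ring p (base Z) \<and> endo Z \<in> ring_hom (base Z) (base Z) \<and>
    (\<forall>x \<in> carrier (base Z). endo Z (endo Z x) = x [^]\<^bsub>base Z\<^esub> p)"

definition twisted_hom :: "'a twisted_ring \<Rightarrow> 'b twisted_ring \<Rightarrow> ('a \<Rightarrow> 'b) set" where
  "twisted_hom Z Y = {f \<in> ring_hom (base Z) (base Y). \<forall>x \<in> carrier (base Z). f (endo Z x) = endo Y (f x)}"

definition is_twisted_algebra ::
  "nat \<Rightarrow> 'c twisted_ring \<Rightarrow> 'a twisted_ring \<Rightarrow> ('c \<Rightarrow> 'a) \<Rightarrow> bool" where
  "is_twisted_algebra p K Z s \<longleftrightarrow> is_twisted_ring p K \<and> is_twisted_ring p Z \<and> s \<in> twisted_hom K Z"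

definition twisted_algebra_isomorphic ::
  "nat \<Rightarrow> 'c twisted_ring \<Rightarrow> 'a twisted_ring \<Rightarrow> ('c \<Rightarrow> 'a) \<Rightarrow> 'b twisted_ring \<Rightarrow> ('c \<Rightarrow> 'b) \<Rightarrow> bool" where
  "twisted_algebra_isomorphic p K Z s Y t \<longleftrightarrow>
    is_twisted_algebra p K Z s \<and> is_twisted_algebra p K Y t \<and>
    (\<exists>f \<in> twisted_hom Z Y. bij_betw f (carrier (base Z)) (carrier (base Y)) \<and>
      (\<forall>c \<in> carrier (base K). f (s c) = t c))"

text \<open>The base change of the \<open>K\<close>-algebra \<open>(Z, s)\<close> along \<open>j: K \<rightarrow> L\<close>, as an \<open>L\<close>-algebra.\<close>

definition twisted_base_change ::
  "'c twisted_ring \<Rightarrow> 'a twisted_ring \<Rightarrow> ('c \<Rightarrow> 'a) \<Rightarrow> 'd twisted_ring \<Rightarrow> ('c \<Rightarrow> 'd) \<Rightarrow> ('a, 'd) tensor twisted_ring" where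
  "twisted_base_change K Z s L j =
    \<lparr>base = tensor (base K) s (base Z) j (base L),
     endo = tensor_map (base K) s (base Z) j (base L) (endo Z) (endo L)\<rparr>"

definition twisted_base_change_unit ::
  "'c twisted_ring \<Rightarrow> 'a twisted_ring \<Rightarrow> ('c \<Rightarrow> 'a) \<Rightarrow> 'd twisted_ring \<Rightarrow> ('c \<Rightarrow> 'd) \<Rightarrow> 'd \<Rightarrow> ('a, 'd) tensor" where
  "twisted_base_change_unit K Z s L j = (\<lambda>d. pure (base K) s (base Z) j (base L) \<one>\<^bsub>base Z\<^esub> d)"

definition is_mixed_ring :: "nat \<Rightarrow> ('a, 'b) mixed_ring \<Rightarrow> bool" where
  "is_mixed_ring p M \<longleftrightarrow> char_p_ring p (ring1 M) \<and> char_p_ring p (ring2 M) \<and>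
    map12 M \<in> ring_hom (ring1 M) (ring2 M) \<and> map21 M \<in> ring_hom (ring2 M) (ring1 M) \<and>
    (\<forall>x \<in> carrier (ring1 M). map21 M (map12 M x) = x [^]\<^bsub>ring1 M\<^esub> p) \<and>
    (\<forall>y \<in> carrier (ring2 M). map12 M (map21 M y) = y [^]\<^bsub>ring2 M\<^esub> p)"

definition mixed_hom ::
  "('a, 'b) mixed_ring \<Rightarrow> ('c, 'd) mixed_ring \<Rightarrow> (('a \<Rightarrow> 'c) \<times> ('b \<Rightarrow> 'd)) set" where
  "mixed_hom M N = {(f, g). f \<in> ring_hom (ring1 M) (ring1 N) \<and> g \<in> ring_hom (ring2 M) (ring2 N) \<and>
    (\<forall>x \<in> carrier (ring1 M). g (map12 M x) = map12 N (f x)) \<and>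
    (\<forall>y \<in> carrier (ring2 M). f (map21 M y) = map21 N (g y))}"

definition is_mixed_algebra ::
  "nat \<Rightarrow> ('c, 'd) mixed_ring \<Rightarrow> ('a, 'b) mixed_ring \<Rightarrow> ('c \<Rightarrow> 'a) \<Rightarrow> ('d \<Rightarrow> 'b) \<Rightarrow> bool" where
  "is_mixed_algebra p K M s t \<longleftrightarrow> is_mixed_ring p K \<and> is_mixed_ring p M \<and> (s, t) \<in> mixed_hom K M"

definition is_mixed_ring_iso ::
  "nat \<Rightarrow> ('a, 'b) mixed_ring \<Rightarrow> ('c, 'd) mixed_ring \<Rightarrow> ('a \<Rightarrow> 'c) \<Rightarrow> ('b \<Rightarrow> 'd) \<Rightarrow> bool" where
  "is_mixed_ring_iso p M N f g \<longleftrightarrow> is_mixed_ring p M \<and> is_mixed_ring p N \<and> (f, g) \<in> mixed_hom M N \<and>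
    bij_betw f (carrier (ring1 M)) (carrier (ring1 N)) \<and> bij_betw g (carrier (ring2 M)) (carrier (ring2 N))"


section \<open>The equivalence between mixed rings and twisted algebras over \<open>\<T>\<^sub>p\<close>\<close>

abbreviation Fp :: "nat \<Rightarrow> int ring" where
  "Fp p \<equiv> residue_ring (int p)"

text \<open>The unique morphism from \<open>\<int>\<close>, and hence from \<open>Fp p\<close> if the ring has characteristic \<open>p\<close>.\<close>

definition int_map :: "('a, 'm) ring_scheme \<Rightarrow> int \<Rightarrow> 'a" where
  "int_map R n = [n] \<cdot>\<^bsub>R\<^esub> \<one>\<^bsub>R\<^esub>"

definition F_sqrt :: "nat \<Rightarrow> int twisted_ring" where
  "F_sqrt p = \<lparr>base = Fp p, endo = id\<rparr>"

definition T_ring :: "nat \<Rightarrow> (int \<times> int) twisted_ring" where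
  "T_ring p = \<lparr>base = RDirProd (Fp p) (Fp p), endo = (\<lambda>(x, y). (y, x))\<rparr>"

definition twisted_of_mixed :: "('a, 'b) mixed_ring \<Rightarrow> ('a \<times> 'b) twisted_ring" where
  "twisted_of_mixed M =
    \<lparr>base = RDirProd (ring1 M) (ring2 M), endo = (\<lambda>(x, y). (map21 M y, map12 M x))\<rparr>"

text \<open>The \<open>\<T>\<^sub>p\<close>-algebra \<open>(Z, s)\<close> corresponds to the mixed ring \<open>M\<close>.\<close>

definition corresponds_mixed_ring ::
  "nat \<Rightarrow> 'x twisted_ring \<Rightarrow> (int \<times> int \<Rightarrow> 'x) \<Rightarrow> ('a, 'b) mixed_ring \<Rightarrow> bool" where
  "corresponds_mixed_ring p Z s M \<longleftrightarrow> is_mixed_ring p M \<and>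
    twisted_algebra_isomorphic p (T_ring p) Z s
      (twisted_of_mixed M) (map_prod (int_map (ring1 M)) (int_map (ring2 M)))"

text \<open>The \<open>twisted_of_mixed K\<close>-algebra \<open>(Z, s)\<close> corresponds to the mixed \<open>K\<close>-algebra \<open>(M, t1, t2)\<close>.\<close>

definition corresponds_mixed_algebra ::
  "nat \<Rightarrow> ('c, 'd) mixed_ring \<Rightarrow> 'x twisted_ring \<Rightarrow> ('c \<times> 'd \<Rightarrow> 'x)
    \<Rightarrow> ('a, 'b) mixed_ring \<Rightarrow> ('c \<Rightarrow> 'a) \<Rightarrow> ('d \<Rightarrow> 'b) \<Rightarrow> bool" where
  "corresponds_mixed_algebra p K Z s M t1 t2 \<longleftrightarrow> is_mixed_algebra p K M t1 t2 \<and>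
    twisted_algebra_isomorphic p (twisted_of_mixed K) Z s (twisted_of_mixed M) (map_prod t1 t2)"


section \<open>Commutative Hopf algebras\<close>

record ('c, 'a) hopf =
  hring :: "'a ring"
  hunit :: "'c \<Rightarrow> 'a"
  comul :: "'a \<Rightarrow> ('a, 'a) tensor"
  counit :: "'a \<Rightarrow> 'c"
  antipode :: "'a \<Rightarrow> 'a"

abbreviation hopf_sq :: "('c, 'l) ring_scheme \<Rightarrow> ('c, 'a) hopf \<Rightarrow> ('a, 'a) tensor ring" where
  "hopf_sq k H \<equiv> tensor k (hunit H) (hring H) (hunit H) (hring H)"

abbreviation hopf_pure :: "('c, 'l) ring_scheme \<Rightarrow> ('c, 'a) hopf \<Rightarrow> 'a \<Rightarrow> 'a \<Rightarrow> ('a, 'a) tensor" where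
  "hopf_pure k H \<equiv> pure k (hunit H) (hring H) (hunit H) (hring H)"

abbreviation hopf_sq_map ::
  "('c, 'l) ring_scheme \<Rightarrow> ('c, 'a) hopf \<Rightarrow> ('b \<Rightarrow> 'a) \<Rightarrow> ('b, 'b) tensor \<Rightarrow> ('a, 'a) tensor" where
  "hopf_sq_map k H f \<equiv> tensor_map k (hunit H) (hring H) (hunit H) (hring H) f f"

abbreviation hopf_sq_unit :: "('c, 'l) ring_scheme \<Rightarrow> ('c, 'a) hopf \<Rightarrow> 'c \<Rightarrow> ('a, 'a) tensor" where
  "hopf_sq_unit k H \<equiv> (\<lambda>c. hopf_pure k H (hunit H c) \<one>\<^bsub>hring H\<^esub>)"

text \<open>Coassociativity is expressed inside \<open>H \<otimes> (H \<otimes> H)\<close>: \<open>i1\<close>, \<open>i2\<close>, \<open>i3\<close> are the three embeddings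
  of \<open>H\<close>, and \<open>(H \<otimes> H) \<otimes> H\<close> is mapped there by the associativity isomorphism.\<close>

definition coassociative :: "('c, 'l) ring_scheme \<Rightarrow> ('c, 'a) hopf \<Rightarrow> bool" where
  "coassociative k H \<longleftrightarrow>
    (let A = hring H; B = hopf_sq k H;
         T = tensor k (hunit H) A (hopf_sq_unit k H) B;
         t = pure k (hunit H) A (hopf_sq_unit k H) B;
         i1 = (\<lambda>a. t a \<one>\<^bsub>B\<^esub>);
         i2 = (\<lambda>a. t \<one>\<^bsub>A\<^esub> (hopf_pure k H a \<one>\<^bsub>A\<^esub>));
         i3 = (\<lambda>a. t \<one>\<^bsub>A\<^esub> (hopf_pure k H \<one>\<^bsub>A\<^esub> a))
     in \<forall>a \<in> carrier A.
          tensor_lift T (\<lambda>b. tensor_lift T i1 i2 (comul H b)) i3 (comul H a) =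
          tensor_lift T i1 (\<lambda>b. tensor_lift T i2 i3 (comul H b)) (comul H a))"

definition is_hopf :: "('c, 'l) ring_scheme \<Rightarrow> ('c, 'a) hopf \<Rightarrow> bool" where
  "is_hopf k H \<longleftrightarrow>
    (let A = hring H in
      cring k \<and> cring A \<and> hunit H \<in> ring_hom k A \<and>
      comul H \<in> ring_hom A (hopf_sq k H) \<and> counit H \<in> ring_hom A k \<and> antipode H \<in> ring_hom A A \<and>
      (\<forall>c \<in> carrier k. comul H (hunit H c) = hopf_sq_unit k H c \<and>
        counit H (hunit H c) = c \<and> antipode H (hunit H c) = hunit H c) \<and>
      coassociative k H \<and>
      (\<forall>a \<in> carrier A.
        tensor_lift A (\<lambda>b. hunit H (counit H b)) id (comul H a) = a \<and>
        tensor_lift A id (\<lambda>b. hunit H (counit H b)) (comul H a) = a \<and>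
        tensor_lift A (antipode H) id (comul H a) = hunit H (counit H a) \<and>
        tensor_lift A id (antipode H) (comul H a) = hunit H (counit H a)))"

definition finitely_generated_hopf :: "('c, 'l) ring_scheme \<Rightarrow> ('c, 'a) hopf \<Rightarrow> bool" where
  "finitely_generated_hopf k H \<longleftrightarrow>
    (\<exists>F. finite F \<and> F \<subseteq> carrier (hring H) \<and>
      generate_ring (hring H) (hunit H ` carrier k \<union> F) = carrier (hring H))"

text \<open>Morphisms of Hopf algebras, semilinear over \<open>\<tau>: k \<rightarrow> l\<close>.\<close>

definition hopf_hom ::
  "('c, 'l) ring_scheme \<Rightarrow> ('d, 'm) ring_scheme \<Rightarrow> ('c \<Rightarrow> 'd) \<Rightarrow> ('c, 'a) hopf \<Rightarrow> ('d, 'b) hopf \<Rightarrow> ('a \<Rightarrow> 'b) set" where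
  "hopf_hom k l \<tau> H H' = {f \<in> ring_hom (hring H) (hring H').
    (\<forall>c \<in> carrier k. f (hunit H c) = hunit H' (\<tau> c)) \<and>
    (\<forall>a \<in> carrier (hring H).
      comul H' (f a) = hopf_sq_map l H' f (comul H a) \<and>
      counit H' (f a) = \<tau> (counit H a) \<and> antipode H' (f a) = f (antipode H a))}"

text \<open>The base change \<open>H \<otimes>\<^sub>k S\<close> along \<open>j: k \<rightarrow> S\<close>; its comultiplication is
  \<open>h \<otimes> s \<mapsto> (\<Sum> (h\<^sub>1 \<otimes> 1) \<otimes> (h\<^sub>2 \<otimes> 1)) \<cdot> s\<close>.\<close>

definition hopf_base_change ::
  "('c, 'l) ring_scheme \<Rightarrow> ('c, 'a) hopf \<Rightarrow> ('d, 'm) ring_scheme \<Rightarrow> ('c \<Rightarrow> 'd) \<Rightarrow> ('d, ('a, 'd) tensor) hopf" where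
  "hopf_base_change k H S j =
    (let B = tensor k (hunit H) (hring H) j S;
         t = pure k (hunit H) (hring H) j S;
         u = (\<lambda>s. t \<one>\<^bsub>hring H\<^esub> s)
     in \<lparr>hring = B,
         hunit = u,
         comul = tensor_lift (tensor S u B u B)
           (\<lambda>h. tensor_map S u B u B (\<lambda>a. t a \<one>\<^bsub>S\<^esub>) (\<lambda>a. t a \<one>\<^bsub>S\<^esub>) (comul H h))
           (\<lambda>s. pure S u B u B (u s) \<one>\<^bsub>B\<^esub>),
         counit = tensor_lift S (\<lambda>h. j (counit H h)) id,
         antipode = tensor_map k (hunit H) (hring H) j S (antipode H) id\<rparr>)"


section \<open>Twisted and mixed linear algebraic groups\<close>

text \<open>Groups are represented by their Hopf algebras. Since the square of the endomorphism is the
  Frobenius, being finitely generated as a twisted (mixed) algebra is the same as being finitely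
  generated as an algebra.\<close>

record ('c, 'a) twisted_group =
  thopf :: "('c, 'a) hopf"
  tendo :: "'a \<Rightarrow> 'a"

record ('c, 'a, 'd, 'b) mixed_group =
  hopf1 :: "('c, 'a) hopf"
  hopf2 :: "('d, 'b) hopf"
  mmap12 :: "'a \<Rightarrow> 'b"
  mmap21 :: "'b \<Rightarrow> 'a"

definition group_twisted_ring :: "('c, 'a) twisted_group \<Rightarrow> 'a twisted_ring" where
  "group_twisted_ring Z = \<lparr>base = hring (thopf Z), endo = tendo Z\<rparr>"

definition group_mixed_ring :: "('c, 'a, 'd, 'b) mixed_group \<Rightarrow> ('a, 'b) mixed_ring" where
  "group_mixed_ring M = \<lparr>ring1 = hring (hopf1 M), ring2 = hring (hopf2 M), map12 = mmap12 M, map21 = mmap21 M\<rparr>"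

definition is_twisted_group :: "nat \<Rightarrow> 'c twisted_ring \<Rightarrow> ('c, 'a) twisted_group \<Rightarrow> bool" where
  "is_twisted_group p K Z \<longleftrightarrow>
    is_twisted_algebra p K (group_twisted_ring Z) (hunit (thopf Z)) \<and>
    is_hopf (base K) (thopf Z) \<and> finitely_generated_hopf (base K) (thopf Z) \<and>
    tendo Z \<in> hopf_hom (base K) (base K) (endo K) (thopf Z) (thopf Z)"

definition is_mixed_group :: "nat \<Rightarrow> ('c, 'd) mixed_ring \<Rightarrow> ('c, 'a, 'd, 'b) mixed_group \<Rightarrow> bool" where
  "is_mixed_group p K M \<longleftrightarrow>
    is_mixed_algebra p K (group_mixed_ring M) (hunit (hopf1 M)) (hunit (hopf2 M)) \<and>
    is_hopf (ring1 K) (hopf1 M) \<and> finitely_generated_hopf (ring1 K) (hopf1 M) \<and>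
    is_hopf (ring2 K) (hopf2 M) \<and> finitely_generated_hopf (ring2 K) (hopf2 M) \<and>
    mmap12 M \<in> hopf_hom (ring1 K) (ring2 K) (map12 K) (hopf1 M) (hopf2 M) \<and>
    mmap21 M \<in> hopf_hom (ring2 K) (ring1 K) (map21 K) (hopf2 M) (hopf1 M)"

definition twisted_group_isomorphic ::
  "nat \<Rightarrow> 'c twisted_ring \<Rightarrow> ('c, 'a) twisted_group \<Rightarrow> ('c, 'b) twisted_group \<Rightarrow> bool" where
  "twisted_group_isomorphic p K Z Y \<longleftrightarrow> is_twisted_group p K Z \<and> is_twisted_group p K Y \<and>
    (\<exists>f \<in> hopf_hom (base K) (base K) id (thopf Z) (thopf Y) \<inter> twisted_hom (group_twisted_ring Z) (group_twisted_ring Y).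
      bij_betw f (carrier (hring (thopf Z))) (carrier (hring (thopf Y))))"

definition mixed_group_isomorphic ::
  "nat \<Rightarrow> ('c, 'd) mixed_ring \<Rightarrow> ('c, 'a, 'd, 'b) mixed_group \<Rightarrow> ('c, 'e, 'd, 'f) mixed_group \<Rightarrow> bool" where
  "mixed_group_isomorphic p K M N \<longleftrightarrow> is_mixed_group p K M \<and> is_mixed_group p K N \<and>
    (\<exists>(f, g) \<in> mixed_hom (group_mixed_ring M) (group_mixed_ring N).
      f \<in> hopf_hom (ring1 K) (ring1 K) id (hopf1 M) (hopf1 N) \<and>
      g \<in> hopf_hom (ring2 K) (ring2 K) id (hopf2 M) (hopf2 N) \<and>
      bij_betw f (carrier (hring (hopf1 M))) (carrier (hring (hopf1 N))) \<and>
      bij_betw g (carrier (hring (hopf2 M))) (carrier (hring (hopf2 N))))"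

definition twisted_group_base_change ::
  "'c twisted_ring \<Rightarrow> ('c, 'a) twisted_group \<Rightarrow> 'd twisted_ring \<Rightarrow> ('c \<Rightarrow> 'd) \<Rightarrow> ('d, ('a, 'd) tensor) twisted_group" where
  "twisted_group_base_change K Z L j =
    \<lparr>thopf = hopf_base_change (base K) (thopf Z) (base L) j,
     tendo = tensor_map (base K) (hunit (thopf Z)) (hring (thopf Z)) j (base L) (tendo Z) (endo L)\<rparr>"

text \<open>
  The equivalence on Hopf algebras. The product \<open>A\<^sub>1 \<times> A\<^sub>2\<close> is a Hopf algebra over \<open>k\<^sub>1 \<times> k\<^sub>2\<close> via the
  identification of \<open>(A\<^sub>1 \<times> A\<^sub>2) \<otimes> (A\<^sub>1 \<times> A\<^sub>2)\<close> with \<open>(A\<^sub>1 \<otimes> A\<^sub>1) \<times> (A\<^sub>2 \<otimes> A\<^sub>2)\<close>, under which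
  \<open>a \<otimes> b \<in> A\<^sub>1 \<otimes> A\<^sub>1\<close> becomes \<open>(a, 0) \<otimes> (b, 0)\<close>, and similarly for \<open>A\<^sub>2\<close>.
\<close>

definition hopf_prod ::
  "('c, 'l) ring_scheme \<Rightarrow> ('d, 'm) ring_scheme \<Rightarrow> ('c, 'a) hopf \<Rightarrow> ('d, 'b) hopf \<Rightarrow> ('c \<times> 'd, 'a \<times> 'b) hopf" where
  "hopf_prod k1 k2 H1 H2 =
    (let A = RDirProd (hring H1) (hring H2);
         u = map_prod (hunit H1) (hunit H2);
         k = RDirProd k1 k2;
         i1 = (\<lambda>a. (a, \<zero>\<^bsub>hring H2\<^esub>));
         i2 = (\<lambda>b. (\<zero>\<^bsub>hring H1\<^esub>, b))
     in \<lparr>hring = A,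
         hunit = u,
         comul = (\<lambda>(a, b). tensor_map k u A u A i1 i1 (comul H1 a)
           \<oplus>\<^bsub>tensor k u A u A\<^esub> tensor_map k u A u A i2 i2 (comul H2 b)),
         counit = map_prod (counit H1) (counit H2),
         antipode = map_prod (antipode H1) (antipode H2)\<rparr>)"

definition twisted_of_mixed_group ::
  "('c, 'd) mixed_ring \<Rightarrow> ('c, 'a, 'd, 'b) mixed_group \<Rightarrow> ('c \<times> 'd, 'a \<times> 'b) twisted_group" where
  "twisted_of_mixed_group K M =
    \<lparr>thopf = hopf_prod (ring1 K) (ring2 K) (hopf1 M) (hopf2 M),
     tendo = (\<lambda>(x, y). (mmap21 M y, mmap12 M x))\<rparr>"

text \<open>The twisted group \<open>Z\<close> over \<open>twisted_of_mixed K\<close>, viewed as a mixed group over \<open>K\<close>, is \<open>M\<close>.\<close>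

definition corresponds_mixed_group ::
  "nat \<Rightarrow> ('c, 'd) mixed_ring \<Rightarrow> ('c \<times> 'd, 'x) twisted_group \<Rightarrow> ('c, 'a, 'd, 'b) mixed_group \<Rightarrow> bool" where
  "corresponds_mixed_group p K Z M \<longleftrightarrow> is_mixed_group p K M \<and>
    twisted_group_isomorphic p (twisted_of_mixed K) Z (twisted_of_mixed_group K M)"

text \<open>Transport of a mixed group along an isomorphism \<open>(f, g)\<close> of the base mixed ring \<open>K\<close>. The
  comultiplication is unchanged, because the tensor product only depends on the image of the base ring.\<close>

definition hopf_transport ::
  "('c, 'l) ring_scheme \<Rightarrow> ('c \<Rightarrow> 'd) \<Rightarrow> ('c, 'a) hopf \<Rightarrow> ('d, 'a) hopf" where
  "hopf_transport k f H =
    \<lparr>hring = hring H,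
     hunit = (\<lambda>d. hunit H (inv_into (carrier k) f d)),
     comul = comul H,
     counit = (\<lambda>a. f (counit H a)),
     antipode = antipode H\<rparr>"

definition mixed_group_transport ::
  "('c, 'd) mixed_ring \<Rightarrow> ('c \<Rightarrow> 'e) \<Rightarrow> ('d \<Rightarrow> 'f) \<Rightarrow> ('c, 'a, 'd, 'b) mixed_group \<Rightarrow> ('e, 'a, 'f, 'b) mixed_group" where
  "mixed_group_transport K f g M =
    \<lparr>hopf1 = hopf_transport (ring1 K) f (hopf1 M),
     hopf2 = hopf_transport (ring2 K) g (hopf2 M),
     mmap12 = mmap12 M,
     mmap21 = mmap21 M\<rparr>"


section \<open>Root systems of type \<open>B\<^sub>2\<close>, \<open>G\<^sub>2\<close>, \<open>F\<^sub>4\<close>\<close>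

datatype dynkin = B2 | G2 | F4

fun rank :: "dynkin \<Rightarrow> nat" where
  "rank B2 = 2"
| "rank G2 = 2"
| "rank F4 = 4"

text \<open>Bourbaki's numbering and conventions (indices start at \<open>0\<close>): \<open>cartan Xn i j = \<langle>\<alpha>\<^sub>i, \<alpha>\<^sub>j\<^sup>\<or>\<rangle>\<close>.\<close>

fun cartan_matrix :: "dynkin \<Rightarrow> int list list" where
  "cartan_matrix B2 = [[2, -2], [-1, 2]]"
| "cartan_matrix G2 = [[2, -1], [-3, 2]]"
| "cartan_matrix F4 = [[2, -1, 0, 0], [-1, 2, -2, 0], [0, -1, 2, -1], [0, 0, -1, 2]]"

fun simple_long :: "dynkin \<Rightarrow> nat \<Rightarrow> bool" where
  "simple_long B2 i \<longleftrightarrow> i = 0"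
| "simple_long G2 i \<longleftrightarrow> i = 1"
| "simple_long F4 i \<longleftrightarrow> i = 0 \<or> i = 1"

abbreviation cartan :: "dynkin \<Rightarrow> nat \<Rightarrow> nat \<Rightarrow> int" where
  "cartan Xn i j \<equiv> cartan_matrix Xn ! i ! j"

text \<open>Elements of the root lattice are coordinate vectors with respect to the simple roots.\<close>

definition simple_root :: "nat \<Rightarrow> nat \<Rightarrow> int" where
  "simple_root i = (\<lambda>j. if j = i then 1 else 0)"

definition reflect :: "dynkin \<Rightarrow> nat \<Rightarrow> (nat \<Rightarrow> int) \<Rightarrow> nat \<Rightarrow> int" where
  "reflect Xn i v = v(i := v i - (\<Sum>j<rank Xn. v j * cartan Xn j i))"

inductive_set root_system :: "dynkin \<Rightarrow> (nat \<Rightarrow> int) set" for Xn where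
  simple: "i < rank Xn \<Longrightarrow> simple_root i \<in> root_system Xn"
| reflect: "r \<in> root_system Xn \<Longrightarrow> i < rank Xn \<Longrightarrow> reflect Xn i r \<in> root_system Xn"

inductive_set long_roots :: "dynkin \<Rightarrow> (nat \<Rightarrow> int) set" for Xn where
  simple: "i < rank Xn \<Longrightarrow> simple_long Xn i \<Longrightarrow> simple_root i \<in> long_roots Xn"
| reflect: "r \<in> long_roots Xn \<Longrightarrow> i < rank Xn \<Longrightarrow> reflect Xn i r \<in> long_roots Xn"

text \<open>
  \<open>diagram_perm Xn r r'\<close> is the graph of the permutation of the roots induced by the symmetry
  \<open>i \<mapsto> rank Xn - 1 - i\<close> of the Dynkin diagram without its arrow: \<open>w \<alpha>\<^sub>i\<close> is sent to \<open>w' \<alpha>\<^sub>i\<^sub>'\<close>, where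
  \<open>w'\<close> is the image of \<open>w\<close> under the induced automorphism of the Weyl group.
\<close>

inductive diagram_perm :: "dynkin \<Rightarrow> (nat \<Rightarrow> int) \<Rightarrow> (nat \<Rightarrow> int) \<Rightarrow> bool" for Xn where
  simple: "i < rank Xn \<Longrightarrow> diagram_perm Xn (simple_root i) (simple_root (rank Xn - 1 - i))"
| reflect: "diagram_perm Xn r r' \<Longrightarrow> i < rank Xn \<Longrightarrow>
    diagram_perm Xn (reflect Xn i r) (reflect Xn (rank Xn - 1 - i) r')"

definition root_weight :: "nat \<Rightarrow> dynkin \<Rightarrow> (nat \<Rightarrow> int) \<Rightarrow> nat" where
  "root_weight p Xn r = (if r \<in> long_roots Xn then p else 1)"


section \<open>Split adjoint semisimple groups over the prime field\<close>

text \<open>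
  Throughout, \<open>A\<close> is a finitely generated commutative Hopf algebra over \<open>Fp p\<close> and \<open>G\<close> is the
  corresponding affine algebraic group. Geometric notions are expressed through the group of
  points over an algebraic closure, which is denoted by \<open>\<Omega> p\<close>. A ring morphism from \<open>A\<close> to \<open>\<Omega> p\<close> is
  automatically linear over \<open>Fp p\<close>.
\<close>

abbreviation \<Omega> :: "nat \<Rightarrow> ((int list \<times> nat) multiset \<Rightarrow> int) ring" where
  "\<Omega> p \<equiv> field.alg_closure (Fp p)"

type_synonym closure_elt = "(int list \<times> nat) multiset \<Rightarrow> int"

text \<open>Convolution of additive maps from \<open>A\<close> to \<open>\<Omega> p\<close>; on points it is the group law.\<close>

definition convolution ::
  "nat \<Rightarrow> (int, 'a) hopf \<Rightarrow> ('a \<Rightarrow> closure_elt) \<Rightarrow> ('a \<Rightarrow> closure_elt) \<Rightarrow> 'a \<Rightarrow> closure_elt" where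
  "convolution p A u v = (\<lambda>a \<in> carrier (hring A). tensor_lift (\<Omega> p) u v (comul A a))"

definition points :: "nat \<Rightarrow> (int, 'a) hopf \<Rightarrow> ('a \<Rightarrow> closure_elt) monoid" where
  "points p A =
    \<lparr>carrier = ring_hom (hring A) (\<Omega> p) \<inter> extensional (carrier (hring A)),
     monoid.mult = convolution p A,
     one = (\<lambda>a \<in> carrier (hring A). int_map (\<Omega> p) (counit A a))\<rparr>"

abbreviation geometric_ring :: "nat \<Rightarrow> (int, 'a) hopf \<Rightarrow> ('a, closure_elt) tensor ring" where
  "geometric_ring p A \<equiv> tensor (Fp p) (hunit A) (hring A) (int_map (\<Omega> p)) (\<Omega> p)"

definition zariski :: "nat \<Rightarrow> (int, 'a) hopf \<Rightarrow> ('a \<Rightarrow> closure_elt) topology" where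
  "zariski p A = topology_generated_by
    {{g \<in> carrier (points p A). tensor_lift (\<Omega> p) g id f \<noteq> \<zero>\<^bsub>\<Omega> p\<^esub>} | f. f \<in> carrier (geometric_ring p A)}"

definition smooth_group :: "nat \<Rightarrow> (int, 'a) hopf \<Rightarrow> bool" where
  "smooth_group p A \<longleftrightarrow>
    (\<forall>f \<in> carrier (geometric_ring p A). \<forall>n::nat.
      f [^]\<^bsub>geometric_ring p A\<^esub> n = \<zero>\<^bsub>geometric_ring p A\<^esub> \<longrightarrow> f = \<zero>\<^bsub>geometric_ring p A\<^esub>)"

text \<open>The radical over the algebraic closure is trivial.\<close>

definition semisimple_group :: "nat \<Rightarrow> (int, 'a) hopf \<Rightarrow> bool" where
  "semisimple_group p A \<longleftrightarrow>
    (\<forall>H. H \<lhd> points p A \<and> closedin (zariski p A) H \<and> connectedin (zariski p A) H \<and>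
      solvable (points p A \<lparr>carrier := H\<rparr>) \<longrightarrow> H = {\<one>\<^bsub>points p A\<^esub>})"

definition connected_semisimple_group :: "nat \<Rightarrow> (int, 'a) hopf \<Rightarrow> bool" where
  "connected_semisimple_group p A \<longleftrightarrow>
    is_hopf (Fp p) A \<and> finitely_generated_hopf (Fp p) A \<and> smooth_group p A \<and>
    connected_space (zariski p A) \<and> semisimple_group p A"

text \<open>The free abelian group of rank \<open>m\<close>, written multiplicatively as a monoid record.\<close>

definition lattice_group :: "nat \<Rightarrow> (nat \<Rightarrow> int) monoid" where
  "lattice_group m = \<lparr>carrier = {v. \<forall>i\<ge>m. v i = 0}, monoid.mult = (\<lambda>u v i. u i + v i), one = (\<lambda>i. 0)\<rparr>"

text \<open>
  A torus in \<open>G\<close> over \<open>\<Omega> p\<close> with character group \<open>lattice_group m\<close> is given by its comorphism \<open>\<pi>\<close>,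
  from \<open>A\<close> to the group algebra of the character group: \<open>\<pi>\<close> must be a closed immersion, that is,
  surjective after extension of scalars to \<open>\<Omega> p\<close>, and a group morphism on points. The points of
  the torus are the morphisms \<open>\<chi>\<close> from the character group to the units of \<open>\<Omega> p\<close>, so \<open>\<chi> l\<close> is the
  value of the character \<open>l\<close> at the point \<open>\<chi>\<close>.
\<close>

definition torus_params :: "nat \<Rightarrow> nat \<Rightarrow> ((nat \<Rightarrow> int) \<Rightarrow> closure_elt) set" where
  "torus_params p m = hom (lattice_group m) (units_of (\<Omega> p))"

definition torus_point ::
  "nat \<Rightarrow> (int, 'a) hopf \<Rightarrow> ('a \<Rightarrow> (nat \<Rightarrow> int) \<Rightarrow> closure_elt) \<Rightarrow> ((nat \<Rightarrow> int) \<Rightarrow> closure_elt) \<Rightarrow> 'a \<Rightarrow> closure_elt" where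
  "torus_point p A \<pi> \<chi> =
    (\<lambda>a \<in> carrier (hring A). \<Oplus>\<^bsub>\<Omega> p\<^esub>l \<in> {l. \<pi> a l \<noteq> \<zero>\<^bsub>\<Omega> p\<^esub>}. \<pi> a l \<otimes>\<^bsub>\<Omega> p\<^esub> \<chi> l)"

definition is_torus :: "nat \<Rightarrow> (int, 'a) hopf \<Rightarrow> nat \<Rightarrow> ('a \<Rightarrow> (nat \<Rightarrow> int) \<Rightarrow> closure_elt) \<Rightarrow> bool" where
  "is_torus p A m \<pi> \<longleftrightarrow>
    (let L = monoid_ring (\<Omega> p) (lattice_group m) in
      \<pi> \<in> ring_hom (hring A) L \<and>
      tensor_lift L \<pi> (\<lambda>c l. if l = \<one>\<^bsub>lattice_group m\<^esub> then c else \<zero>\<^bsub>\<Omega> p\<^esub>) ` carrier (geometric_ring p A) = carrier L \<and>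
      (\<forall>\<chi> \<in> torus_params p m. \<forall>\<chi>' \<in> torus_params p m.
        torus_point p A \<pi> \<chi> \<otimes>\<^bsub>points p A\<^esub> torus_point p A \<pi> \<chi>' =
        torus_point p A \<pi> (\<lambda>l. \<chi> l \<otimes>\<^bsub>\<Omega> p\<^esub> \<chi>' l)))"

text \<open>A torus is split over \<open>Fp p\<close> if \<open>\<pi>\<close> takes its values in the group algebra over \<open>Fp p\<close>.\<close>

definition is_split_maximal_torus ::
  "nat \<Rightarrow> (int, 'a) hopf \<Rightarrow> nat \<Rightarrow> ('a \<Rightarrow> (nat \<Rightarrow> int) \<Rightarrow> closure_elt) \<Rightarrow> bool" where
  "is_split_maximal_torus p A m \<pi> \<longleftrightarrow>
    is_torus p A m \<pi> \<and>
    (\<forall>a \<in> carrier (hring A). \<forall>l. \<pi> a l \<in> range (int_map (\<Omega> p))) \<and>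
    (\<forall>m' \<pi>'. is_torus p A m' \<pi>' \<and>
      torus_point p A \<pi> ` torus_params p m \<subseteq> torus_point p A \<pi>' ` torus_params p m' \<longrightarrow>
      torus_point p A \<pi> ` torus_params p m = torus_point p A \<pi>' ` torus_params p m')"

text \<open>The Lie algebra over \<open>\<Omega> p\<close>, as point derivations at the identity.\<close>

definition lie_algebra :: "nat \<Rightarrow> (int, 'a) hopf \<Rightarrow> ('a \<Rightarrow> closure_elt) set" where
  "lie_algebra p A = {D \<in> carrier (hring A) \<rightarrow>\<^sub>E carrier (\<Omega> p).
    \<forall>a \<in> carrier (hring A). \<forall>b \<in> carrier (hring A).
      D (a \<oplus>\<^bsub>hring A\<^esub> b) = D a \<oplus>\<^bsub>\<Omega> p\<^esub> D b \<and>
      D (a \<otimes>\<^bsub>hring A\<^esub> b) =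
        int_map (\<Omega> p) (counit A a) \<otimes>\<^bsub>\<Omega> p\<^esub> D b \<oplus>\<^bsub>\<Omega> p\<^esub> D a \<otimes>\<^bsub>\<Omega> p\<^esub> int_map (\<Omega> p) (counit A b)}"

text \<open>The roots are the non-zero weights of the torus in the adjoint representation.\<close>

definition torus_roots ::
  "nat \<Rightarrow> (int, 'a) hopf \<Rightarrow> nat \<Rightarrow> ('a \<Rightarrow> (nat \<Rightarrow> int) \<Rightarrow> closure_elt) \<Rightarrow> (nat \<Rightarrow> int) set" where
  "torus_roots p A m \<pi> = {l \<in> carrier (lattice_group m). l \<noteq> \<one>\<^bsub>lattice_group m\<^esub> \<and>
    (\<exists>D \<in> lie_algebra p A. (\<exists>a \<in> carrier (hring A). D a \<noteq> \<zero>\<^bsub>\<Omega> p\<^esub>) \<and>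
      (\<forall>\<chi> \<in> torus_params p m.
        convolution p A (convolution p A (torus_point p A \<pi> \<chi>) D) (inv\<^bsub>points p A\<^esub> torus_point p A \<pi> \<chi>) =
        (\<lambda>a \<in> carrier (hring A). \<chi> l \<otimes>\<^bsub>\<Omega> p\<^esub> D a)))}"

definition adjoint_torus :: "nat \<Rightarrow> (int, 'a) hopf \<Rightarrow> nat \<Rightarrow> ('a \<Rightarrow> (nat \<Rightarrow> int) \<Rightarrow> closure_elt) \<Rightarrow> bool" where
  "adjoint_torus p A m \<pi> \<longleftrightarrow> generate (lattice_group m) (torus_roots p A m \<pi>) = carrier (lattice_group m)"

text \<open>\<open>\<iota>\<close> identifies the root system of type \<open>Xn\<close> with that of the torus.\<close>

definition root_labelling ::
  "nat \<Rightarrow> (int, 'a) hopf \<Rightarrow> nat \<Rightarrow> ('a \<Rightarrow> (nat \<Rightarrow> int) \<Rightarrow> closure_elt) \<Rightarrow> dynkin \<Rightarrow> ((nat \<Rightarrow> int) \<Rightarrow> (nat \<Rightarrow> int)) \<Rightarrow> bool" where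
  "root_labelling p A m \<pi> Xn \<iota> \<longleftrightarrow>
    \<iota> \<in> hom (lattice_group (rank Xn)) (lattice_group m) \<and>
    inj_on \<iota> (carrier (lattice_group (rank Xn))) \<and>
    \<iota> ` root_system Xn = torus_roots p A m \<pi>"

definition is_split_adjoint_group :: "nat \<Rightarrow> dynkin \<Rightarrow> (int, 'a) hopf \<Rightarrow> bool" where
  "is_split_adjoint_group p Xn A \<longleftrightarrow> connected_semisimple_group p A \<and>
    (\<exists>m \<pi> \<iota>. is_split_maximal_torus p A m \<pi> \<and> adjoint_torus p A m \<pi> \<and> root_labelling p A m \<pi> Xn \<iota>)"

text \<open>
  A parametrisation of the root subgroup of \<open>l\<close>, defined over \<open>Fp p\<close> and given by its comorphism
  \<open>x\<close> to the polynomial ring over \<open>\<Omega> p\<close>. The last condition is \<open>t x(c) t\<^sup>-\<^sup>1 = x(l(t) c)\<close> for \<open>t\<close> in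
  the torus.
\<close>

definition root_point ::
  "nat \<Rightarrow> (int, 'a) hopf \<Rightarrow> ('a \<Rightarrow> nat \<Rightarrow> closure_elt) \<Rightarrow> closure_elt \<Rightarrow> 'a \<Rightarrow> closure_elt" where
  "root_point p A x c = (\<lambda>a \<in> carrier (hring A). eval (\<Omega> p) (\<Omega> p) id c (x a))"

definition is_root_subgroup ::
  "nat \<Rightarrow> (int, 'a) hopf \<Rightarrow> nat \<Rightarrow> ('a \<Rightarrow> (nat \<Rightarrow> int) \<Rightarrow> closure_elt) \<Rightarrow> (nat \<Rightarrow> int) \<Rightarrow> ('a \<Rightarrow> nat \<Rightarrow> closure_elt) \<Rightarrow> bool" where
  "is_root_subgroup p A m \<pi> l x \<longleftrightarrow>
    x \<in> ring_hom (hring A) (UP (\<Omega> p)) \<and>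
    (\<forall>a \<in> carrier (hring A). \<forall>i. coeff (UP (\<Omega> p)) (x a) i \<in> range (int_map (\<Omega> p))) \<and>
    tensor_lift (UP (\<Omega> p)) x (\<lambda>c. monom (UP (\<Omega> p)) c 0) ` carrier (geometric_ring p A) = carrier (UP (\<Omega> p)) \<and>
    (\<forall>c \<in> carrier (\<Omega> p). \<forall>d \<in> carrier (\<Omega> p).
      root_point p A x c \<otimes>\<^bsub>points p A\<^esub> root_point p A x d = root_point p A x (c \<oplus>\<^bsub>\<Omega> p\<^esub> d)) \<and>
    (\<forall>\<chi> \<in> torus_params p m. \<forall>c \<in> carrier (\<Omega> p).
      torus_point p A \<pi> \<chi> \<otimes>\<^bsub>points p A\<^esub> root_point p A x c \<otimes>\<^bsub>points p A\<^esub> inv\<^bsub>points p A\<^esub> torus_point p A \<pi> \<chi> =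
      root_point p A x (\<chi> l \<otimes>\<^bsub>\<Omega> p\<^esub> c))"

text \<open>
  \<open>\<phi>\<close> is the endomorphism of \<open>A\<close> dual to the special isogeny, for some choice of a split maximal
  torus, a base of its roots and parametrisations of the root subgroups. The isogeny sends the
  point \<open>g\<close> of \<open>G\<close> to \<open>g \<circ> \<phi>\<close>. The requirement that \<open>\<phi>\<^sup>2\<close> is the Frobenius is a consequence of the
  other conditions, since \<open>G\<close> is generated by its root subgroups.
\<close>

definition is_special_isogeny :: "nat \<Rightarrow> dynkin \<Rightarrow> (int, 'a) hopf \<Rightarrow> ('a \<Rightarrow> 'a) \<Rightarrow> bool" where
  "is_special_isogeny p Xn A \<phi> \<longleftrightarrow>
    \<phi> \<in> hopf_hom (Fp p) (Fp p) id A A \<and>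
    (\<forall>a \<in> carrier (hring A). \<phi> (\<phi> a) = a [^]\<^bsub>hring A\<^esub> p) \<and>
    (\<exists>m \<pi> \<iota> x. is_split_maximal_torus p A m \<pi> \<and> root_labelling p A m \<pi> Xn \<iota> \<and>
      (\<forall>r \<in> root_system Xn. is_root_subgroup p A m \<pi> (\<iota> r) (x r)) \<and>
      (\<forall>r r'. diagram_perm Xn r r' \<longrightarrow>
        (\<forall>c \<in> carrier (\<Omega> p).
          (\<lambda>a \<in> carrier (hring A). root_point p A (x r) c (\<phi> a)) =
          root_point p A (x r') (c [^]\<^bsub>\<Omega> p\<^esub> root_weight p Xn r'))))"


section \<open>The groups of type \<open>\<^sup>2X\<^sub>n\<close> and \<open>X\<^sub>n\<close>\<close>

definition is_tits_endomorphism :: "nat \<Rightarrow> ('k, 'm) ring_scheme \<Rightarrow> ('k \<Rightarrow> 'k) \<Rightarrow> bool" where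
  "is_tits_endomorphism p k \<sigma> \<longleftrightarrow> \<sigma> \<in> ring_hom k k \<and> (\<forall>x \<in> carrier k. \<sigma> (\<sigma> x) = x [^]\<^bsub>k\<^esub> p)"

text \<open>The mixed ring \<open>(k\<^sub>0, l)\<close> of a subfield \<open>k\<^sub>0\<close> of \<open>l\<close> containing all \<open>p\<close>-th powers.\<close>

definition mixed_field :: "nat \<Rightarrow> 'k set \<Rightarrow> 'k ring \<Rightarrow> ('k, 'k) mixed_ring" where
  "mixed_field p k0 l = \<lparr>ring1 = l\<lparr>carrier := k0\<rparr>, ring2 = l, map12 = id, map21 = (\<lambda>x. x [^]\<^bsub>l\<^esub> p)\<rparr>"

text \<open>In the next two definitions \<open>A\<close> and \<open>\<phi>\<close> are the split adjoint group of the given type and its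
  special isogeny.\<close>

definition twisted_type_group ::
  "nat \<Rightarrow> (int, 'a) hopf \<Rightarrow> ('a \<Rightarrow> 'a) \<Rightarrow> 'k ring \<Rightarrow> ('k \<Rightarrow> 'k) \<Rightarrow> ('k, ('a, 'k) tensor) twisted_group" where
  "twisted_type_group p A \<phi> k \<sigma> =
    \<lparr>thopf = hopf_base_change (Fp p) A k (int_map k),
     tendo = tensor_map (Fp p) (hunit A) (hring A) (int_map k) k \<phi> \<sigma>\<rparr>"

definition mixed_type_group ::
  "nat \<Rightarrow> (int, 'a) hopf \<Rightarrow> ('a \<Rightarrow> 'a) \<Rightarrow> 'k set \<Rightarrow> 'k ring
    \<Rightarrow> ('k, ('a, 'k) tensor, 'k, ('a, 'k) tensor) mixed_group" where
  "mixed_type_group p A \<phi> k0 l =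
    (let K = l\<lparr>carrier := k0\<rparr> in
      \<lparr>hopf1 = hopf_base_change (Fp p) A K (int_map K),
       hopf2 = hopf_base_change (Fp p) A l (int_map l),
       mmap12 = tensor_map (Fp p) (hunit A) (hring A) (int_map l) l \<phi> id,
       mmap21 = tensor_map (Fp p) (hunit A) (hring A) (int_map K) K \<phi> (\<lambda>x. x [^]\<^bsub>l\<^esub> p)\<rparr>)"

end

(*
  Every identity is checked on generators. A ring morphism out of R \<otimes>\<^sub>k S is determined by its values
  on the pure tensors. More generally, let \<iota>: H \<rightarrow> B be a semilinear morphism of (pre-)Hopf algebras
  such that B is generated by \<iota>(H) and the scalars. Then B inherits from H the Hopf algebra axioms and
  finite generation, and a ring morphism f out of B is a morphism of Hopf algebras as soon as f \<circ> \<iota> is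
  one and f is semilinear on the scalars. This applies to h \<mapsto> h \<otimes> 1 for base change, to the diagonal
  H \<rightarrow> H \<times> H, and to the identity for transport along an isomorphism of the base.

  The isomorphism R \<otimes>\<^sub>k (k \<times> k) \<rightarrow> R \<times> R is a \<otimes> (c, d) \<mapsto> (a s(c), a s(d)). In (iii), the mixed group is
  (G, G) with both maps equal to \<phi> \<otimes> \<sigma>, and the isomorphism with the group of type X\<^sub>n over (k\<^sup>\<sigma>, k) is
  (id \<otimes> \<sigma>, id).
*)
theory Submission
  imports Defs
begin

section \<open>Integral monoid rings\<close>

text \<open>Since the rings are commutative, the convolution of two ring morphisms is again a ring
  morphism. Each remaining Hopf axiom, and compatibility with comultiplication, therefore says that
  two ring morphisms agree, and this is why generators suffice. Such a comparison makes sense once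
  the structure maps are ring morphisms with the right values on scalars; that much is the pre-Hopf
  structure, and morphisms are taken between pre-Hopf algebras so that the axioms can be transferred
  along them.

  \<open>tensor_lift\<close> selects its value on a coset with \<open>the_elem\<close>, so it says
  nothing until evaluation on the integral monoid ring is known to vanish on the ideal of relations.
  The maps lifted in this way cannot all be unital: the comultiplication of a product is glued from
  the embeddings \<open>a \<mapsto> (a, 0)\<close> and \<open>b \<mapsto> (0, b)\<close>. The
  idempotents \<open>(1, 0)\<close> and \<open>(0, 1)\<close> of \<open>k \<times> k\<close>
  annihilate the mixed tensors \<open>(a, 0) \<otimes> (0, b)\<close>, so the two pieces add up to
  the unit and are compatible with the diagonal. The same idempotents give the inverse of the map to
  \<open>R \<times> R\<close>.\<close>

context
  fixes G :: "('g, 'n) monoid_scheme" (structure)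
  assumes G: "comm_monoid G"
begin

interpretation comm_monoid G by (rule G)

abbreviation (input) ZG :: "('g \<Rightarrow> int) ring" where "ZG \<equiv> monoid_ring int_ring G"

lemma monoid_ring_carrier:
  "u \<in> carrier ZG \<longleftrightarrow> finite {x. u x \<noteq> 0} \<and> {x. u x \<noteq> 0} \<subseteq> carrier G"
  by (simp add: monoid_ring_def)

lemma monoid_ring_add: "u \<oplus>\<^bsub>ZG\<^esub> v = (\<lambda>z. u z + v z)"
  and monoid_ring_zero: "\<zero>\<^bsub>ZG\<^esub> = (\<lambda>z. 0)"
  and monoid_ring_one: "\<one>\<^bsub>ZG\<^esub> = basis_elt int_ring \<one>"
  by (simp_all add: monoid_ring_def basis_elt_def)

lemma basis_elt_int: "basis_elt int_ring x = (\<lambda>z. if z = x then 1 else 0)"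
  by (simp add: basis_elt_def cong: if_cong)

text \<open>The index set in \<open>monoid_ring\<close> depends on the supports. Enlarging it to a
  fixed rectangle \<open>A \<times> B\<close> adds only zero terms and leaves a double sum whose
  order can be changed.\<close>

lemma monoid_ring_mult_eq_sum:
  assumes "finite A" "finite B" "{x. u x \<noteq> 0} \<subseteq> A" "{x. v x \<noteq> 0} \<subseteq> B"
  shows "(u \<otimes>\<^bsub>ZG\<^esub> v) z = (\<Sum>a\<in>A. \<Sum>b\<in>B. if a \<otimes> b = z then u a * v b else 0)"
proof -
  let ?W = "{(x, y). u x \<noteq> 0 \<and> v y \<noteq> 0 \<and> x \<otimes> y = z}"
  have "(u \<otimes>\<^bsub>ZG\<^esub> v) z = (\<Sum>w\<in>?W. u (fst w) * v (snd w))"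
    by (simp add: monoid_ring_def int_finsum_eq)
  also have "\<dots> = (\<Sum>w\<in>A \<times> B. if fst w \<otimes> snd w = z then u (fst w) * v (snd w) else 0)"
    using assms by (intro sum.mono_neutral_cong_left) auto
  finally show ?thesis by (simp add: sum.cartesian_product case_prod_beta)
qed

text \<open>Besides closure, this bound provides the finite range of the intermediate product in the
  associativity proof.\<close>

lemma monoid_ring_mult_supp:
  assumes "u \<in> carrier ZG" "v \<in> carrier ZG"
  shows "{z. (u \<otimes>\<^bsub>ZG\<^esub> v) z \<noteq> 0} \<subseteq> (\<lambda>(a, b). a \<otimes> b) ` ({x. u x \<noteq> 0} \<times> {x. v x \<noteq> 0})"
proof
  fix z assume "z \<in> {z. (u \<otimes>\<^bsub>ZG\<^esub> v) z \<noteq> 0}"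
  moreover have "(u \<otimes>\<^bsub>ZG\<^esub> v) z =
      (\<Sum>a\<in>{x. u x \<noteq> 0}. \<Sum>b\<in>{x. v x \<noteq> 0}. if a \<otimes> b = z then u a * v b else 0)"
    using assms by (intro monoid_ring_mult_eq_sum) (auto simp: monoid_ring_carrier)
  ultimately have "(\<Sum>a\<in>{x. u x \<noteq> 0}. \<Sum>b\<in>{x. v x \<noteq> 0}.
      if a \<otimes> b = z then u a * v b else 0) \<noteq> 0" by simp
  then obtain a where a: "a \<in> {x. u x \<noteq> 0}"
      "(\<Sum>b\<in>{x. v x \<noteq> 0}. if a \<otimes> b = z then u a * v b else 0) \<noteq> 0"
    by (rule sum.not_neutral_contains_not_neutral)
  from a(2) obtain b where "b \<in> {x. v x \<noteq> 0}" "(if a \<otimes> b = z then u a * v b else 0) \<noteq> 0"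
    by (rule sum.not_neutral_contains_not_neutral)
  with a(1) show "z \<in> (\<lambda>(a, b). a \<otimes> b) ` ({x. u x \<noteq> 0} \<times> {x. v x \<noteq> 0})"
    by (auto split: if_splits)
qed

lemma monoid_ring_mult_closed:
  assumes "u \<in> carrier ZG" "v \<in> carrier ZG"
  shows "u \<otimes>\<^bsub>ZG\<^esub> v \<in> carrier ZG"
proof -
  let ?I = "(\<lambda>(a, b). a \<otimes> b) ` ({x. u x \<noteq> 0} \<times> {x. v x \<noteq> 0})"
  have "finite ?I" "?I \<subseteq> carrier G"
    using assms by (auto simp: monoid_ring_carrier subset_iff)
  then show ?thesis
    using monoid_ring_mult_supp[OF assms] unfolding monoid_ring_carrier
    by (meson finite_subset subset_trans)
qed

lemma basis_elt_closed [simp, intro]: "x \<in> carrier G \<Longrightarrow> basis_elt int_ring x \<in> carrier ZG"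
  by (auto simp: monoid_ring_carrier basis_elt_int)

lemma monoid_ring_mult_comm:
  assumes "u \<in> carrier ZG" "v \<in> carrier ZG"
  shows "u \<otimes>\<^bsub>ZG\<^esub> v = v \<otimes>\<^bsub>ZG\<^esub> u"
proof
  fix z
  let ?A = "{x. u x \<noteq> 0}" and ?B = "{x. v x \<noteq> 0}"
  have fin: "finite ?A" "finite ?B" and sub: "?A \<subseteq> carrier G" "?B \<subseteq> carrier G"
    using assms by (auto simp: monoid_ring_carrier)
  have "(u \<otimes>\<^bsub>ZG\<^esub> v) z = (\<Sum>a\<in>?A. \<Sum>b\<in>?B. if a \<otimes> b = z then u a * v b else 0)"
    using fin by (intro monoid_ring_mult_eq_sum) auto
  also have "\<dots> = (\<Sum>b\<in>?B. \<Sum>a\<in>?A. if b \<otimes> a = z then v b * u a else 0)"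
    by (subst sum.swap, intro sum.cong refl) (use sub m_comm in \<open>simp add: mult.commute subset_iff\<close>)
  also have "\<dots> = (v \<otimes>\<^bsub>ZG\<^esub> u) z"
    using fin by (intro monoid_ring_mult_eq_sum[symmetric]) auto
  finally show "(u \<otimes>\<^bsub>ZG\<^esub> v) z = (v \<otimes>\<^bsub>ZG\<^esub> u) z" .
qed

text \<open>Both sides are brought to the triple sum of \<open>u a * v b * w c\<close> over the
  triples with product \<open>z\<close>.\<close>

lemma monoid_ring_mult_assoc:
  assumes "u \<in> carrier ZG" "v \<in> carrier ZG" "w \<in> carrier ZG"
  shows "(u \<otimes>\<^bsub>ZG\<^esub> v) \<otimes>\<^bsub>ZG\<^esub> w = u \<otimes>\<^bsub>ZG\<^esub> (v \<otimes>\<^bsub>ZG\<^esub> w)"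
proof
  fix z
  let ?A = "{x. u x \<noteq> 0}" and ?B = "{x. v x \<noteq> 0}" and ?C = "{x. w x \<noteq> 0}"
  let ?AB = "(\<lambda>(a, b). a \<otimes> b) ` (?A \<times> ?B)" and ?BC = "(\<lambda>(a, b). a \<otimes> b) ` (?B \<times> ?C)"
  have fin: "finite ?A" "finite ?B" "finite ?C"
    and sub: "?A \<subseteq> carrier G" "?B \<subseteq> carrier G" "?C \<subseteq> carrier G"
    using assms by (auto simp: monoid_ring_carrier)
  have fin2: "finite ?AB" "finite ?BC" using fin by auto
  \<comment> \<open>A sum over \<open>t\<close> that contains the indicator of \<open>x = t\<close>
    has one term. This removes the intermediate product on the left and reintroduces it on the
    right.\<close>
  have delta: "(\<Sum>t\<in>T. if x = t then c else 0) = c" if "finite T" "x \<in> T" for T x and c :: int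
    using that by (simp add: sum.delta')
  have uv: "(u \<otimes>\<^bsub>ZG\<^esub> v) t = (\<Sum>a\<in>?A. \<Sum>b\<in>?B. if a \<otimes> b = t then u a * v b else 0)" for t
    using fin by (intro monoid_ring_mult_eq_sum) auto
  have vw: "(v \<otimes>\<^bsub>ZG\<^esub> w) t = (\<Sum>a\<in>?B. \<Sum>b\<in>?C. if a \<otimes> b = t then v a * w b else 0)" for t
    using fin by (intro monoid_ring_mult_eq_sum) auto
  have "((u \<otimes>\<^bsub>ZG\<^esub> v) \<otimes>\<^bsub>ZG\<^esub> w) z =
      (\<Sum>t\<in>?AB. \<Sum>c\<in>?C. if t \<otimes> c = z then (u \<otimes>\<^bsub>ZG\<^esub> v) t * w c else 0)"
    using fin fin2 monoid_ring_mult_supp[OF assms(1,2)] by (intro monoid_ring_mult_eq_sum) auto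
  \<comment> \<open>When \<open>a \<otimes> b = t\<close>, the condition
    \<open>t \<otimes> c = z\<close> becomes a condition on
    \<open>(a \<otimes> b) \<otimes> c\<close>, so that \<open>t\<close> survives only in the
    indicator.\<close>
  also have "\<dots> = (\<Sum>c\<in>?C. \<Sum>t\<in>?AB. \<Sum>a\<in>?A. \<Sum>b\<in>?B.
      if a \<otimes> b = t then (if (a \<otimes> b) \<otimes> c = z then u a * v b * w c else 0) else 0)"
    by (subst sum.swap, intro sum.cong refl)
      (auto simp: uv sum_distrib_right intro!: sum.cong sum.neutral)
  also have "\<dots> = (\<Sum>c\<in>?C. \<Sum>a\<in>?A. \<Sum>b\<in>?B. \<Sum>t\<in>?AB.
      if a \<otimes> b = t then (if (a \<otimes> b) \<otimes> c = z then u a * v b * w c else 0) else 0)"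
    by (rule sum.cong[OF refl], rule trans[OF sum.swap], rule sum.cong[OF refl], rule sum.swap)
  also have "\<dots> = (\<Sum>c\<in>?C. \<Sum>a\<in>?A. \<Sum>b\<in>?B. if (a \<otimes> b) \<otimes> c = z then u a * v b * w c else 0)"
    by (intro sum.cong refl, rule delta) (use fin2 in auto)
  also have "\<dots> = (\<Sum>a\<in>?A. \<Sum>c\<in>?C. \<Sum>b\<in>?B. if (a \<otimes> b) \<otimes> c = z then u a * v b * w c else 0)"
    by (rule sum.swap)
  also have "\<dots> = (\<Sum>a\<in>?A. \<Sum>b\<in>?B. \<Sum>c\<in>?C. if (a \<otimes> b) \<otimes> c = z then u a * v b * w c else 0)"
    by (rule sum.cong[OF refl], rule sum.swap)
  also have "\<dots> = (\<Sum>a\<in>?A. \<Sum>b\<in>?B. \<Sum>c\<in>?C. if a \<otimes> (b \<otimes> c) = z then u a * v b * w c else 0)"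
    by (intro sum.cong refl) (use sub m_assoc in \<open>simp add: subset_iff\<close>)
  also have "\<dots> = (\<Sum>a\<in>?A. \<Sum>b\<in>?B. \<Sum>c\<in>?C. \<Sum>t\<in>?BC.
      if b \<otimes> c = t then (if a \<otimes> (b \<otimes> c) = z then u a * v b * w c else 0) else 0)"
    by (intro sum.cong refl, rule delta[symmetric]) (use fin2 in auto)
  also have "\<dots> = (\<Sum>a\<in>?A. \<Sum>b\<in>?B. \<Sum>t\<in>?BC. \<Sum>c\<in>?C.
      if b \<otimes> c = t then (if a \<otimes> (b \<otimes> c) = z then u a * v b * w c else 0) else 0)"
    by (rule sum.cong[OF refl], rule sum.cong[OF refl], rule sum.swap)
  also have "\<dots> = (\<Sum>a\<in>?A. \<Sum>t\<in>?BC. \<Sum>b\<in>?B. \<Sum>c\<in>?C.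
      if b \<otimes> c = t then (if a \<otimes> (b \<otimes> c) = z then u a * v b * w c else 0) else 0)"
    by (rule sum.cong[OF refl], rule sum.swap)
  also have "\<dots> = (\<Sum>a\<in>?A. \<Sum>t\<in>?BC. if a \<otimes> t = z then u a * (v \<otimes>\<^bsub>ZG\<^esub> w) t else 0)"
    by (intro sum.cong refl) (auto simp: vw sum_distrib_left mult.assoc intro!: sum.cong sum.neutral)
  also have "\<dots> = (u \<otimes>\<^bsub>ZG\<^esub> (v \<otimes>\<^bsub>ZG\<^esub> w)) z"
    using fin fin2 monoid_ring_mult_supp[OF assms(2,3)]
    by (intro monoid_ring_mult_eq_sum[symmetric]) auto
  finally show "((u \<otimes>\<^bsub>ZG\<^esub> v) \<otimes>\<^bsub>ZG\<^esub> w) z = (u \<otimes>\<^bsub>ZG\<^esub> (v \<otimes>\<^bsub>ZG\<^esub> w)) z" .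
qed

lemma basis_elt_mult:
  assumes "x \<in> carrier G" "y \<in> carrier G"
  shows "basis_elt int_ring x \<otimes>\<^bsub>ZG\<^esub> basis_elt int_ring y = basis_elt int_ring (x \<otimes> y)"
proof
  fix z
  have "(basis_elt int_ring x \<otimes>\<^bsub>ZG\<^esub> basis_elt int_ring y) z =
    (\<Sum>a\<in>{x}. \<Sum>b\<in>{y}. if a \<otimes> b = z then basis_elt int_ring x a * basis_elt int_ring y b else 0)"
    by (rule monoid_ring_mult_eq_sum) (auto simp: basis_elt_int)
  then show "(basis_elt int_ring x \<otimes>\<^bsub>ZG\<^esub> basis_elt int_ring y) z = basis_elt int_ring (x \<otimes> y) z"
    by (auto simp: basis_elt_int)
qed

lemma monoid_ring_one_mult:
  assumes "u \<in> carrier ZG"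
  shows "\<one>\<^bsub>ZG\<^esub> \<otimes>\<^bsub>ZG\<^esub> u = u"
proof
  fix z
  let ?A = "{x. u x \<noteq> 0}"
  have fin: "finite ?A" and sub: "?A \<subseteq> carrier G"
    using assms by (auto simp: monoid_ring_carrier)
  have "(\<one>\<^bsub>ZG\<^esub> \<otimes>\<^bsub>ZG\<^esub> u) z =
    (\<Sum>a\<in>{\<one>}. \<Sum>b\<in>?A. if a \<otimes> b = z then basis_elt int_ring \<one> a * u b else 0)"
    using fin unfolding monoid_ring_one by (intro monoid_ring_mult_eq_sum) (auto simp: basis_elt_int)
  also have "\<dots> = (\<Sum>b\<in>?A. if b = z then u b else 0)"
    using sub by (auto simp: basis_elt_int intro!: sum.cong)
  also have "\<dots> = u z" using fin by (subst sum.delta) auto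
  finally show "(\<one>\<^bsub>ZG\<^esub> \<otimes>\<^bsub>ZG\<^esub> u) z = u z" .
qed

lemma monoid_ring_add_closed:
  assumes "u \<in> carrier ZG" "v \<in> carrier ZG"
  shows "u \<oplus>\<^bsub>ZG\<^esub> v \<in> carrier ZG"
proof -
  have "{x. u x + v x \<noteq> 0} \<subseteq> {x. u x \<noteq> 0} \<union> {x. v x \<noteq> 0}" by auto
  then show ?thesis
    using assms unfolding monoid_ring_carrier monoid_ring_add
    by (meson Un_least finite_Un finite_subset subset_trans)
qed

text \<open>All three products are expanded over the union of the supports of \<open>u\<close> and
  \<open>v\<close>, so that the sums can be compared term by term.\<close>

lemma monoid_ring_distrib:
  assumes "u \<in> carrier ZG" "v \<in> carrier ZG" "w \<in> carrier ZG"
  shows "(u \<oplus>\<^bsub>ZG\<^esub> v) \<otimes>\<^bsub>ZG\<^esub> w = u \<otimes>\<^bsub>ZG\<^esub> w \<oplus>\<^bsub>ZG\<^esub> v \<otimes>\<^bsub>ZG\<^esub> w"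
proof
  fix z
  let ?A = "{x. u x \<noteq> 0} \<union> {x. v x \<noteq> 0}" and ?C = "{x. w x \<noteq> 0}"
  have fin: "finite ?A" "finite ?C" using assms by (auto simp: monoid_ring_carrier)
  have eq: "(y \<otimes>\<^bsub>ZG\<^esub> w) z = (\<Sum>a\<in>?A. \<Sum>b\<in>?C. if a \<otimes> b = z then y a * w b else 0)"
    if "{x. y x \<noteq> 0} \<subseteq> ?A" for y
    using fin that by (intro monoid_ring_mult_eq_sum) auto
  have "{x. (u \<oplus>\<^bsub>ZG\<^esub> v) x \<noteq> 0} \<subseteq> ?A" by (auto simp: monoid_ring_add)
  then have "((u \<oplus>\<^bsub>ZG\<^esub> v) \<otimes>\<^bsub>ZG\<^esub> w) z =
      (\<Sum>a\<in>?A. \<Sum>b\<in>?C. if a \<otimes> b = z then (u a + v a) * w b else 0)"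
    by (subst eq) (simp_all add: monoid_ring_add cong: if_cong)
  also have "\<dots> = (\<Sum>a\<in>?A. \<Sum>b\<in>?C. (if a \<otimes> b = z then u a * w b else 0) +
      (if a \<otimes> b = z then v a * w b else 0))"
    by (intro sum.cong refl) (simp add: distrib_right)
  also have "\<dots> = (u \<otimes>\<^bsub>ZG\<^esub> w) z + (v \<otimes>\<^bsub>ZG\<^esub> w) z"
    by (simp only: sum.distrib eq[OF Un_upper1] eq[OF Un_upper2])
  finally have "((u \<oplus>\<^bsub>ZG\<^esub> v) \<otimes>\<^bsub>ZG\<^esub> w) z = (u \<otimes>\<^bsub>ZG\<^esub> w) z + (v \<otimes>\<^bsub>ZG\<^esub> w) z" .
  then show "((u \<oplus>\<^bsub>ZG\<^esub> v) \<otimes>\<^bsub>ZG\<^esub> w) z = (u \<otimes>\<^bsub>ZG\<^esub> w \<oplus>\<^bsub>ZG\<^esub> v \<otimes>\<^bsub>ZG\<^esub> w) z"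
    by (simp add: monoid_ring_add)
qed

lemma monoid_ring_cring: "cring ZG"
proof (rule cringI)
  show "abelian_group ZG"
  proof (rule abelian_groupI)
    fix u assume u: "u \<in> carrier ZG"
    then have "(\<lambda>z. - u z) \<in> carrier ZG" by (simp add: monoid_ring_carrier)
    then show "\<exists>y\<in>carrier ZG. y \<oplus>\<^bsub>ZG\<^esub> u = \<zero>\<^bsub>ZG\<^esub>"
      by (intro bexI[of _ "\<lambda>z. - u z"]) (simp_all add: monoid_ring_add monoid_ring_zero)
  next
    show "\<zero>\<^bsub>ZG\<^esub> \<in> carrier ZG" by (simp add: monoid_ring_carrier monoid_ring_zero)
  qed (simp_all add: monoid_ring_add_closed, simp_all add: monoid_ring_add monoid_ring_zero add_ac)
  show "Group.comm_monoid ZG"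
  proof (rule comm_monoidI)
    show "\<one>\<^bsub>ZG\<^esub> \<in> carrier ZG" by (simp add: monoid_ring_one basis_elt_closed)
  next
    fix u v assume "u \<in> carrier ZG" "v \<in> carrier ZG"
    then show "u \<otimes>\<^bsub>ZG\<^esub> v = v \<otimes>\<^bsub>ZG\<^esub> u" by (rule monoid_ring_mult_comm)
  qed (simp_all add: monoid_ring_mult_closed monoid_ring_mult_assoc monoid_ring_one_mult)
qed (rule monoid_ring_distrib)

lemma monoid_ring_neg: "u \<in> carrier ZG \<Longrightarrow> \<ominus>\<^bsub>ZG\<^esub> u = (\<lambda>z. - u z)"
proof -
  assume u: "u \<in> carrier ZG"
  interpret ZG: cring ZG by (rule monoid_ring_cring)
  have "(\<lambda>z. - u z) \<in> carrier ZG" using u by (simp add: monoid_ring_carrier)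
  then show ?thesis
    using u by (intro ZG.minus_equality) (simp_all add: monoid_ring_add monoid_ring_zero)
qed

text \<open>The basis generates \<open>ZG\<close> as an additive group: multiples of one basis
  element are reached by repeated addition and subtraction, and a general element is the sum of its
  one-point parts.\<close>

lemma monoid_ring_induct [consumes 1, case_names zero basis add neg]:
  assumes w: "w \<in> carrier ZG"
    and zero: "P \<zero>\<^bsub>ZG\<^esub>"
    and basis: "\<And>x. x \<in> carrier G \<Longrightarrow> P (basis_elt int_ring x)"
    and add: "\<And>u v. u \<in> carrier ZG \<Longrightarrow> v \<in> carrier ZG \<Longrightarrow> P u \<Longrightarrow> P v \<Longrightarrow> P (u \<oplus>\<^bsub>ZG\<^esub> v)"
    and neg: "\<And>u. u \<in> carrier ZG \<Longrightarrow> P u \<Longrightarrow> P (\<ominus>\<^bsub>ZG\<^esub> u)"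
  shows "P w"
proof -
  have single_closed: "(\<lambda>z. if z = x then c else 0) \<in> carrier ZG" if "x \<in> carrier G" for x and c :: int
    using that by (auto simp: monoid_ring_carrier)
  have single: "P (\<lambda>z. if z = x then c else 0)" if x: "x \<in> carrier G" for x and c :: int
  proof (induction c rule: int_induct[where k = 0])
    case base
    then show ?case using zero by (simp add: monoid_ring_zero)
  next
    case (step1 i)
    have "P ((\<lambda>z. if z = x then i else 0) \<oplus>\<^bsub>ZG\<^esub> basis_elt int_ring x)"
      using x step1 basis single_closed by (intro add) auto
    then show ?case by (simp add: monoid_ring_add basis_elt_int if_distrib cong: if_cong)
  next
    case (step2 i)
    have "P ((\<lambda>z. if z = x then i else 0) \<oplus>\<^bsub>ZG\<^esub> \<ominus>\<^bsub>ZG\<^esub> basis_elt int_ring x)"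
      using x step2 basis single_closed cring.cring_simprules(3)[OF monoid_ring_cring]
      by (intro add neg) auto
    moreover have "(\<lambda>z. if z = x then i else 0) \<oplus>\<^bsub>ZG\<^esub> \<ominus>\<^bsub>ZG\<^esub> basis_elt int_ring x =
        (\<lambda>z. if z = x then i - 1 else 0)"
      using x unfolding monoid_ring_neg[OF basis_elt_closed[OF x]] monoid_ring_add
      by (auto simp: basis_elt_int)
    ultimately show ?case by simp
  qed
  \<comment> \<open>The induction runs over a finite set containing the support rather than over the
    support itself, so that a point with zero coefficient may be removed as well.\<close>
  have "P w" if "finite A" "A \<subseteq> carrier G" "{x. w x \<noteq> 0} \<subseteq> A" for A w
    using that
  proof (induction A arbitrary: w rule: finite_induct)
    case empty
    then have "w = \<zero>\<^bsub>ZG\<^esub>" by (auto simp: monoid_ring_zero)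
    then show ?case using zero by simp
  next
    case (insert x A)
    let ?w = "w(x := 0)"
    have sub: "{y. ?w y \<noteq> 0} \<subseteq> A" using insert.prems by auto
    have P: "P ?w" using insert sub by blast
    have "?w \<in> carrier ZG"
      using sub insert unfolding monoid_ring_carrier by (meson finite_subset insert_subset subset_trans)
    then have "P (?w \<oplus>\<^bsub>ZG\<^esub> (\<lambda>z. if z = x then w x else 0))"
      using P single single_closed insert.prems by (intro add) auto
    moreover have "?w \<oplus>\<^bsub>ZG\<^esub> (\<lambda>z. if z = x then w x else 0) = w"
      by (auto simp: monoid_ring_add)
    ultimately show ?case by simp
  qed
  then show ?thesis using w by (auto simp: monoid_ring_carrier)
qed

end


section \<open>Additive and multiplicative maps\<close>

text \<open>The embeddings \<open>a \<mapsto> (a, 0)\<close> that build the comultiplication of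
  \<open>hopf_prod\<close> are multiplicative without preserving the unit, so
  \<open>ring_hom\<close> is too narrow a class for the universal property of the tensor
  product.\<close>

definition nonunital_hom :: "('a, 'm) ring_scheme \<Rightarrow> ('b, 'n) ring_scheme \<Rightarrow> ('a \<Rightarrow> 'b) set" where
  "nonunital_hom R S = {h \<in> carrier R \<rightarrow> carrier S. \<forall>x \<in> carrier R. \<forall>y \<in> carrier R.
     h (x \<otimes>\<^bsub>R\<^esub> y) = h x \<otimes>\<^bsub>S\<^esub> h y \<and> h (x \<oplus>\<^bsub>R\<^esub> y) = h x \<oplus>\<^bsub>S\<^esub> h y}"

lemma nonunital_homI:
  assumes "\<And>x. x \<in> carrier R \<Longrightarrow> h x \<in> carrier S"
    and "\<And>x y. x \<in> carrier R \<Longrightarrow> y \<in> carrier R \<Longrightarrow> h (x \<otimes>\<^bsub>R\<^esub> y) = h x \<otimes>\<^bsub>S\<^esub> h y"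
    and "\<And>x y. x \<in> carrier R \<Longrightarrow> y \<in> carrier R \<Longrightarrow> h (x \<oplus>\<^bsub>R\<^esub> y) = h x \<oplus>\<^bsub>S\<^esub> h y"
  shows "h \<in> nonunital_hom R S"
  using assms by (auto simp: nonunital_hom_def)

lemma nonunital_hom_closed: "h \<in> nonunital_hom R S \<Longrightarrow> x \<in> carrier R \<Longrightarrow> h x \<in> carrier S"
  and nonunital_hom_mult: "h \<in> nonunital_hom R S \<Longrightarrow> x \<in> carrier R \<Longrightarrow> y \<in> carrier R \<Longrightarrow>
    h (x \<otimes>\<^bsub>R\<^esub> y) = h x \<otimes>\<^bsub>S\<^esub> h y"
  and nonunital_hom_add: "h \<in> nonunital_hom R S \<Longrightarrow> x \<in> carrier R \<Longrightarrow> y \<in> carrier R \<Longrightarrow>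
    h (x \<oplus>\<^bsub>R\<^esub> y) = h x \<oplus>\<^bsub>S\<^esub> h y"
  by (auto simp: nonunital_hom_def)

lemma ring_hom_nonunital: "h \<in> ring_hom R S \<Longrightarrow> h \<in> nonunital_hom R S"
  by (auto simp: nonunital_hom_def ring_hom_def)

lemma nonunital_hom_ring_hom: "h \<in> nonunital_hom R S \<Longrightarrow> h \<one>\<^bsub>R\<^esub> = \<one>\<^bsub>S\<^esub> \<Longrightarrow> h \<in> ring_hom R S"
  by (auto simp: nonunital_hom_def ring_hom_def)

lemma nonunital_hom_comp:
  "h \<in> nonunital_hom R S \<Longrightarrow> h' \<in> nonunital_hom S T \<Longrightarrow> (\<lambda>x. h' (h x)) \<in> nonunital_hom R T"
  by (auto simp: nonunital_hom_def Pi_iff)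

lemma ring_hom_comp': "h \<in> ring_hom R S \<Longrightarrow> h' \<in> ring_hom S T \<Longrightarrow> (\<lambda>x. h' (h x)) \<in> ring_hom R T"
  by (auto simp: ring_hom_def Pi_iff)

lemma nonunital_hom_zero:
  assumes "ring R" "ring S" "h \<in> nonunital_hom R S"
  shows "h \<zero>\<^bsub>R\<^esub> = \<zero>\<^bsub>S\<^esub>"
proof -
  interpret R: ring R by fact
  interpret S: ring S by fact
  have "h \<zero>\<^bsub>R\<^esub> \<oplus>\<^bsub>S\<^esub> h \<zero>\<^bsub>R\<^esub> = h \<zero>\<^bsub>R\<^esub>"
    using nonunital_hom_add[OF assms(3), of "\<zero>\<^bsub>R\<^esub>" "\<zero>\<^bsub>R\<^esub>"] by simp
  then show ?thesis
    using nonunital_hom_closed[OF assms(3), of "\<zero>\<^bsub>R\<^esub>"] by simp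
qed

lemma nonunital_hom_neg:
  assumes "ring R" "ring S" "h \<in> nonunital_hom R S" "x \<in> carrier R"
  shows "h (\<ominus>\<^bsub>R\<^esub> x) = \<ominus>\<^bsub>S\<^esub> h x"
proof -
  interpret R: ring R by fact
  interpret S: ring S by fact
  have "h (\<ominus>\<^bsub>R\<^esub> x) \<oplus>\<^bsub>S\<^esub> h x = \<zero>\<^bsub>S\<^esub>"
    using nonunital_hom_add[OF assms(3), of "\<ominus>\<^bsub>R\<^esub> x" x] assms nonunital_hom_zero[OF assms(1-3)]
    by (simp add: R.l_neg)
  then show ?thesis
    using nonunital_hom_closed[OF assms(3)] assms(4) by (metis R.a_inv_closed S.minus_equality)
qed


section \<open>Evaluation of elements of the monoid ring\<close>

text \<open>The additive extension of \<open>m\<close> to the integral monoid ring. With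
  \<open>m (a, b) = u a \<cdot> v b\<close> it is the function that \<open>tensor_lift\<close>
  applies to the representatives of a coset.\<close>

definition monoid_ring_eval :: "('d, 'm) ring_scheme \<Rightarrow> ('g \<Rightarrow> 'd) \<Rightarrow> ('g \<Rightarrow> int) \<Rightarrow> 'd" where
  "monoid_ring_eval D m w = (\<Oplus>\<^bsub>D\<^esub>z \<in> {z. w z \<noteq> 0}. [w z] \<cdot>\<^bsub>D\<^esub> m z)"

context
  fixes G :: "('g, 'n) monoid_scheme" (structure) and D :: "('d, 'm) ring_scheme" and m
  assumes G: "comm_monoid G" and D: "cring D"
    and m_Pi: "m \<in> carrier G \<rightarrow> carrier D"
begin

lemma monoid_map_closed: "x \<in> carrier G \<Longrightarrow> m x \<in> carrier D"
  using m_Pi by blast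

interpretation comm_monoid G by (rule G)
interpretation D: cring D by (rule D)
interpretation ZG: cring "monoid_ring int_ring G" by (rule monoid_ring_cring[OF G])

lemma int_pow_closed: "x \<in> carrier D \<Longrightarrow> [(n::int)] \<cdot>\<^bsub>D\<^esub> x \<in> carrier D"
  by (rule D.add.int_pow_closed)

lemma int_pow_zero: "[(0::int)] \<cdot>\<^bsub>D\<^esub> x = \<zero>\<^bsub>D\<^esub>"
  by (simp add: add_pow_int_ge)

text \<open>A zero multiple contributes nothing, so the index set may be enlarged; adding two
  elements calls for a common one.\<close>

lemma monoid_ring_eval_superset:
  assumes "finite A" "{z. w z \<noteq> 0} \<subseteq> A" "A \<subseteq> carrier G"
  shows "monoid_ring_eval D m w = (\<Oplus>\<^bsub>D\<^esub>z \<in> A. [w z] \<cdot>\<^bsub>D\<^esub> m z)"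
  unfolding monoid_ring_eval_def using assms monoid_map_closed int_pow_closed
  by (intro D.add.finprod_mono_neutral_cong_left) (auto simp: int_pow_zero)

lemma monoid_ring_eval_closed:
  assumes "w \<in> carrier (monoid_ring int_ring G)"
  shows "monoid_ring_eval D m w \<in> carrier D"
  using assms monoid_map_closed int_pow_closed unfolding monoid_ring_eval_def
  by (auto simp: monoid_ring_carrier[OF G] intro!: D.finsum_closed)

lemma monoid_ring_eval_add:
  assumes "u \<in> carrier (monoid_ring int_ring G)" "v \<in> carrier (monoid_ring int_ring G)"
  shows "monoid_ring_eval D m (u \<oplus>\<^bsub>monoid_ring int_ring G\<^esub> v) =
    monoid_ring_eval D m u \<oplus>\<^bsub>D\<^esub> monoid_ring_eval D m v"
proof -
  let ?A = "{z. u z \<noteq> 0} \<union> {z. v z \<noteq> 0}"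
  have A: "finite ?A" "?A \<subseteq> carrier G" using assms by (auto simp: monoid_ring_carrier[OF G])
  have *: "monoid_ring_eval D m w = (\<Oplus>\<^bsub>D\<^esub>z \<in> ?A. [w z] \<cdot>\<^bsub>D\<^esub> m z)" if "{z. w z \<noteq> 0} \<subseteq> ?A" for w
    using A that by (intro monoid_ring_eval_superset) auto
  have mA: "m z \<in> carrier D" if "z \<in> ?A" for z using that A(2) monoid_map_closed by blast
  have "monoid_ring_eval D m (u \<oplus>\<^bsub>monoid_ring int_ring G\<^esub> v) = (\<Oplus>\<^bsub>D\<^esub>z \<in> ?A. [(u z + v z)] \<cdot>\<^bsub>D\<^esub> m z)"
    by (subst *) (auto simp: monoid_ring_add[OF G])
  also have "\<dots> = (\<Oplus>\<^bsub>D\<^esub>z \<in> ?A. [u z] \<cdot>\<^bsub>D\<^esub> m z \<oplus>\<^bsub>D\<^esub> [v z] \<cdot>\<^bsub>D\<^esub> m z)"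
    using mA int_pow_closed by (intro D.finsum_cong') (auto simp: D.add.int_pow_mult)
  also have "\<dots> = (\<Oplus>\<^bsub>D\<^esub>z \<in> ?A. [u z] \<cdot>\<^bsub>D\<^esub> m z) \<oplus>\<^bsub>D\<^esub> (\<Oplus>\<^bsub>D\<^esub>z \<in> ?A. [v z] \<cdot>\<^bsub>D\<^esub> m z)"
    using mA int_pow_closed by (intro D.finsum_addf) auto
  finally show ?thesis by (simp add: *)
qed

lemma monoid_ring_eval_zero: "monoid_ring_eval D m \<zero>\<^bsub>monoid_ring int_ring G\<^esub> = \<zero>\<^bsub>D\<^esub>"
  by (simp add: monoid_ring_eval_def monoid_ring_zero[OF G])

lemma monoid_ring_eval_neg:
  assumes "u \<in> carrier (monoid_ring int_ring G)"
  shows "monoid_ring_eval D m (\<ominus>\<^bsub>monoid_ring int_ring G\<^esub> u) = \<ominus>\<^bsub>D\<^esub> monoid_ring_eval D m u"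
proof -
  have "monoid_ring_eval D m (\<ominus>\<^bsub>monoid_ring int_ring G\<^esub> u) \<oplus>\<^bsub>D\<^esub> monoid_ring_eval D m u = \<zero>\<^bsub>D\<^esub>"
    using assms by (simp add: monoid_ring_eval_add[symmetric] ZG.l_neg monoid_ring_eval_zero)
  then show ?thesis
    using assms monoid_ring_eval_closed by (metis ZG.a_inv_closed D.minus_equality)
qed

lemma monoid_ring_eval_minus:
  assumes "u \<in> carrier (monoid_ring int_ring G)" "v \<in> carrier (monoid_ring int_ring G)"
  shows "monoid_ring_eval D m (u \<ominus>\<^bsub>monoid_ring int_ring G\<^esub> v) =
    monoid_ring_eval D m u \<ominus>\<^bsub>D\<^esub> monoid_ring_eval D m v"
  using assms by (simp add: a_minus_def monoid_ring_eval_add monoid_ring_eval_neg)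

lemma monoid_ring_eval_basis:
  assumes "x \<in> carrier G"
  shows "monoid_ring_eval D m (basis_elt int_ring x) = m x"
proof -
  have "{z. basis_elt int_ring x z \<noteq> 0} = {x}" by (auto simp: basis_elt_int[OF G])
  then show ?thesis
    using monoid_map_closed[OF assms] by (simp add: monoid_ring_eval_def basis_elt_int[OF G] D.add.int_pow_1)
qed

text \<open>Both sides are biadditive in \<open>u\<close> and \<open>v\<close>, so multiplicativity
  of \<open>m\<close> decides the matter on pairs of basis elements. The induction is nested: over
  \<open>v\<close> for a fixed basis element, then over \<open>u\<close>.\<close>

lemma monoid_ring_eval_mult:
  assumes mult: "\<And>x y. x \<in> carrier G \<Longrightarrow> y \<in> carrier G \<Longrightarrow> m (x \<otimes> y) = m x \<otimes>\<^bsub>D\<^esub> m y"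
    and u: "u \<in> carrier (monoid_ring int_ring G)" and v: "v \<in> carrier (monoid_ring int_ring G)"
  shows "monoid_ring_eval D m (u \<otimes>\<^bsub>monoid_ring int_ring G\<^esub> v) =
    monoid_ring_eval D m u \<otimes>\<^bsub>D\<^esub> monoid_ring_eval D m v"
proof -
  note ev = monoid_ring_eval_add monoid_ring_eval_neg monoid_ring_eval_zero monoid_ring_eval_closed
    monoid_ring_eval_basis
  have basis_mult: "monoid_ring_eval D m (basis_elt int_ring x \<otimes>\<^bsub>monoid_ring int_ring G\<^esub> v) =
      monoid_ring_eval D m (basis_elt int_ring x) \<otimes>\<^bsub>D\<^esub> monoid_ring_eval D m v"
    if x: "x \<in> carrier G" for x
    using v
  proof (induction v rule: monoid_ring_induct[OF G, consumes 1, case_names zero basis add neg])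
    case (basis y)
    then show ?case using x by (simp add: basis_elt_mult[OF G] ev mult)
  next
    case zero
    then show ?case using x basis_elt_closed[OF G x] by (simp add: ev monoid_map_closed)
  next
    case (add u v)
    then show ?case using x monoid_map_closed basis_elt_closed[OF G x] by (simp add: ev ZG.r_distr D.r_distr)
  next
    case (neg u)
    then show ?case using x monoid_map_closed basis_elt_closed[OF G x] by (simp add: ev ZG.r_minus D.r_minus)
  qed
  show ?thesis
    using u
  proof (induction u rule: monoid_ring_induct[OF G, consumes 1, case_names zero basis add neg])
    case (basis y)
    then show ?case by (rule basis_mult)
  next
    case zero
    then show ?case using v by (simp add: ev)
  next
    case (add u w)
    then show ?case using v by (simp add: ev ZG.l_distr D.l_distr)
  next
    case (neg u)
    then show ?case using v by (simp add: ev ZG.l_minus D.l_minus)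
  qed
qed

end


section \<open>Tensor products\<close>

locale tensor_product =
  fixes k :: "('c, 'l) ring_scheme" and f :: "'c \<Rightarrow> 'a" and R :: "('a, 'm) ring_scheme"
    and g :: "'c \<Rightarrow> 'b" and S :: "('b, 'n) ring_scheme"
  assumes k_cring: "cring k" and R_cring: "cring R" and S_cring: "cring S"
    and f: "f \<in> ring_hom k R" and g: "g \<in> ring_hom k S"
begin

interpretation k: cring k by (rule k_cring)
interpretation R: cring R by (rule R_cring)
interpretation S: cring S by (rule S_cring)

abbreviation "F \<equiv> pre_tensor R S"
abbreviation "I \<equiv> tensor_ideal k f R g S"
abbreviation "T \<equiv> tensor k f R g S"
abbreviation "t \<equiv> pure k f R g S"
abbreviation e where "e a b \<equiv> basis_elt int_ring (a, b)"

lemma f_closed [simp]: "c \<in> carrier k \<Longrightarrow> f c \<in> carrier R"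
  and g_closed [simp]: "c \<in> carrier k \<Longrightarrow> g c \<in> carrier S"
  using f g by (simp_all add: ring_hom_closed)

lemma comm_monoid_prod: "comm_monoid (R \<times>\<times> S)"
proof -
  interpret RS: monoid "R \<times>\<times> S"
    by (intro DirProd_monoid R.monoid_axioms S.monoid_axioms)
  show ?thesis
    by (intro RS.monoid_comm_monoidI) (auto simp: R.m_comm S.m_comm)
qed

lemma F_cring: "cring F"
  unfolding pre_tensor_def by (rule monoid_ring_cring[OF comm_monoid_prod])

interpretation F: cring F by (rule F_cring)

lemma e_closed [simp]: "a \<in> carrier R \<Longrightarrow> b \<in> carrier S \<Longrightarrow> e a b \<in> carrier F"
  unfolding pre_tensor_def by (intro basis_elt_closed[OF comm_monoid_prod]) simp

lemma e_mult:
  assumes "a \<in> carrier R" "b \<in> carrier S" "a' \<in> carrier R" "b' \<in> carrier S"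
  shows "e a b \<otimes>\<^bsub>F\<^esub> e a' b' = e (a \<otimes>\<^bsub>R\<^esub> a') (b \<otimes>\<^bsub>S\<^esub> b')"
  using basis_elt_mult[OF comm_monoid_prod, of "(a, b)" "(a', b')"] assms
  by (simp add: pre_tensor_def)

lemma e_one: "\<one>\<^bsub>F\<^esub> = e \<one>\<^bsub>R\<^esub> \<one>\<^bsub>S\<^esub>"
  unfolding pre_tensor_def by (simp add: monoid_ring_one[OF comm_monoid_prod])

text \<open>The generators of \<open>tensor_ideal\<close>, named so that single relations can be
  recognised and the generated ideal can be bounded by minimality.\<close>

definition relations :: "('a \<times> 'b \<Rightarrow> int) set" where
  "relations =
     {e (a \<oplus>\<^bsub>R\<^esub> a') b \<ominus>\<^bsub>F\<^esub> (e a b \<oplus>\<^bsub>F\<^esub> e a' b) | a a' b. a \<in> carrier R \<and> a' \<in> carrier R \<and> b \<in> carrier S}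
   \<union> {e a (b \<oplus>\<^bsub>S\<^esub> b') \<ominus>\<^bsub>F\<^esub> (e a b \<oplus>\<^bsub>F\<^esub> e a b') | a b b'. a \<in> carrier R \<and> b \<in> carrier S \<and> b' \<in> carrier S}
   \<union> {e (f c \<otimes>\<^bsub>R\<^esub> a) b \<ominus>\<^bsub>F\<^esub> e a (g c \<otimes>\<^bsub>S\<^esub> b) | c a b. c \<in> carrier k \<and> a \<in> carrier R \<and> b \<in> carrier S}"

lemma tensor_ideal_eq: "I = Idl\<^bsub>F\<^esub> relations"
  by (simp add: tensor_ideal_def relations_def Let_def)

lemma relations_closed: "relations \<subseteq> carrier F"
  unfolding relations_def by (intro Un_least subsetI) (auto intro!: F.minus_closed F.add.m_closed)

lemma I_ideal: "ideal I F"
  unfolding tensor_ideal_eq by (rule F.genideal_ideal[OF relations_closed])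

interpretation I: ideal I F by (rule I_ideal)

lemma relation_coset:
  assumes "x \<ominus>\<^bsub>F\<^esub> y \<in> relations" "x \<in> carrier F" "y \<in> carrier F"
  shows "I +>\<^bsub>F\<^esub> x = I +>\<^bsub>F\<^esub> y"
  using assms F.genideal_self[OF relations_closed]
  by (intro F.quotient_eq_iff_same_a_r_cos[OF I.ideal_axioms, THEN iffD1])
    (auto simp: tensor_ideal_eq)

lemma T_cring: "cring T"
  unfolding tensor_def by (rule I.quotient_is_cring[OF F_cring])

interpretation T: cring T by (rule T_cring)

lemma T_ring: "ring T" ..

lemma coset_hom: "(\<lambda>w. I +>\<^bsub>F\<^esub> w) \<in> ring_hom F T"
  unfolding tensor_def by (rule I.rcos_ring_hom)

lemma coset_add: "x \<in> carrier F \<Longrightarrow> y \<in> carrier F \<Longrightarrow> I +>\<^bsub>F\<^esub> (x \<oplus>\<^bsub>F\<^esub> y) = (I +>\<^bsub>F\<^esub> x) \<oplus>\<^bsub>T\<^esub> (I +>\<^bsub>F\<^esub> y)"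
  and coset_mult: "x \<in> carrier F \<Longrightarrow> y \<in> carrier F \<Longrightarrow> I +>\<^bsub>F\<^esub> (x \<otimes>\<^bsub>F\<^esub> y) = (I +>\<^bsub>F\<^esub> x) \<otimes>\<^bsub>T\<^esub> (I +>\<^bsub>F\<^esub> y)"
  and coset_closed: "x \<in> carrier F \<Longrightarrow> I +>\<^bsub>F\<^esub> x \<in> carrier T"
  using ring_hom_add[OF coset_hom] ring_hom_mult[OF coset_hom] ring_hom_closed[OF coset_hom] by auto

lemma pure_closed [simp]: "a \<in> carrier R \<Longrightarrow> b \<in> carrier S \<Longrightarrow> t a b \<in> carrier T"
  by (simp add: pure_def coset_closed)

lemma pure_mult:
  assumes "a \<in> carrier R" "b \<in> carrier S" "a' \<in> carrier R" "b' \<in> carrier S"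
  shows "t a b \<otimes>\<^bsub>T\<^esub> t a' b' = t (a \<otimes>\<^bsub>R\<^esub> a') (b \<otimes>\<^bsub>S\<^esub> b')"
  using assms by (simp add: pure_def coset_mult[symmetric] e_mult)

lemma pure_one: "\<one>\<^bsub>T\<^esub> = t \<one>\<^bsub>R\<^esub> \<one>\<^bsub>S\<^esub>"
  using ring_hom_one[OF coset_hom] by (simp add: pure_def e_one)

lemma pure_add_left:
  assumes "a \<in> carrier R" "a' \<in> carrier R" "b \<in> carrier S"
  shows "t (a \<oplus>\<^bsub>R\<^esub> a') b = t a b \<oplus>\<^bsub>T\<^esub> t a' b"
proof -
  have "e (a \<oplus>\<^bsub>R\<^esub> a') b \<ominus>\<^bsub>F\<^esub> (e a b \<oplus>\<^bsub>F\<^esub> e a' b) \<in> relations"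
    unfolding relations_def using assms by blast
  then show ?thesis
    using assms unfolding pure_def by (subst relation_coset) (auto simp: coset_add)
qed

lemma pure_add_right:
  assumes "a \<in> carrier R" "b \<in> carrier S" "b' \<in> carrier S"
  shows "t a (b \<oplus>\<^bsub>S\<^esub> b') = t a b \<oplus>\<^bsub>T\<^esub> t a b'"
proof -
  have "e a (b \<oplus>\<^bsub>S\<^esub> b') \<ominus>\<^bsub>F\<^esub> (e a b \<oplus>\<^bsub>F\<^esub> e a b') \<in> relations"
    unfolding relations_def using assms by blast
  then show ?thesis
    using assms unfolding pure_def by (subst relation_coset) (auto simp: coset_add)
qed

lemma pure_balanced:
  assumes "c \<in> carrier k" "a \<in> carrier R" "b \<in> carrier S"
  shows "t (f c \<otimes>\<^bsub>R\<^esub> a) b = t a (g c \<otimes>\<^bsub>S\<^esub> b)"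
proof -
  have "e (f c \<otimes>\<^bsub>R\<^esub> a) b \<ominus>\<^bsub>F\<^esub> e a (g c \<otimes>\<^bsub>S\<^esub> b) \<in> relations"
    unfolding relations_def using assms by blast
  then show ?thesis
    using assms unfolding pure_def by (intro relation_coset) auto
qed

lemma pure_scalar: "c \<in> carrier k \<Longrightarrow> t (f c) \<one>\<^bsub>S\<^esub> = t \<one>\<^bsub>R\<^esub> (g c)"
  using pure_balanced[of c "\<one>\<^bsub>R\<^esub>" "\<one>\<^bsub>S\<^esub>"] by simp

lemma pure_split:
  assumes "a \<in> carrier R" "b \<in> carrier S"
  shows "t a b = t a \<one>\<^bsub>S\<^esub> \<otimes>\<^bsub>T\<^esub> t \<one>\<^bsub>R\<^esub> b"
  using assms by (simp add: pure_mult)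

lemma pure_left_hom: "(\<lambda>a. t a \<one>\<^bsub>S\<^esub>) \<in> ring_hom R T"
  by (rule ring_hom_memI) (auto simp: pure_mult pure_add_left pure_one)

lemma pure_right_hom: "(\<lambda>b. t \<one>\<^bsub>R\<^esub> b) \<in> ring_hom S T"
  by (rule ring_hom_memI) (auto simp: pure_mult pure_add_right pure_one)

lemma pure_zero_left: "b \<in> carrier S \<Longrightarrow> t \<zero>\<^bsub>R\<^esub> b = \<zero>\<^bsub>T\<^esub>"
  using pure_add_left[of "\<zero>\<^bsub>R\<^esub>" "\<zero>\<^bsub>R\<^esub>" b] by (simp add: T.add.l_cancel_one)

lemma pure_zero_right: "a \<in> carrier R \<Longrightarrow> t a \<zero>\<^bsub>S\<^esub> = \<zero>\<^bsub>T\<^esub>"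
  using pure_add_right[of a "\<zero>\<^bsub>S\<^esub>" "\<zero>\<^bsub>S\<^esub>"] by (simp add: T.add.l_cancel_one)

lemma coset_neg: "x \<in> carrier F \<Longrightarrow> I +>\<^bsub>F\<^esub> (\<ominus>\<^bsub>F\<^esub> x) = \<ominus>\<^bsub>T\<^esub> (I +>\<^bsub>F\<^esub> x)"
  by (rule nonunital_hom_neg[OF F.ring_axioms T.ring_axioms ring_hom_nonunital[OF coset_hom]])

lemma pure_neg:
  assumes "a \<in> carrier R" "b \<in> carrier S"
  shows "\<ominus>\<^bsub>T\<^esub> t a b = t (\<ominus>\<^bsub>R\<^esub> a) b"
  using assms pure_add_left[of "\<ominus>\<^bsub>R\<^esub> a" a b]
  by (intro T.minus_equality) (auto simp: R.l_neg pure_zero_left)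

lemma tensor_carrier: "carrier T = (\<lambda>w. I +>\<^bsub>F\<^esub> w) ` carrier F"
  by (auto simp: tensor_def FactRing_def A_RCOSETS_def' a_r_coset_def')

text \<open>Negation causes no extra case because the negative of \<open>a \<otimes> b\<close> is
  the pure tensor \<open>(\<ominus> a) \<otimes> b\<close>, so sums of pure tensors exhaust the
  tensor product.\<close>

lemma tensor_induct [consumes 1, case_names pure add]:
  assumes z: "z \<in> carrier T"
    and pure: "\<And>a b. a \<in> carrier R \<Longrightarrow> b \<in> carrier S \<Longrightarrow> P (t a b)"
    and add: "\<And>x y. x \<in> carrier T \<Longrightarrow> y \<in> carrier T \<Longrightarrow> P x \<Longrightarrow> P y \<Longrightarrow> P (x \<oplus>\<^bsub>T\<^esub> y)"
  shows "P z"
proof -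
  obtain w where w: "w \<in> carrier F" and z: "z = I +>\<^bsub>F\<^esub> w"
    using z by (auto simp: tensor_carrier)
  \<comment> \<open>The claim is strengthened to the coset and its negative, as the induction on the
    monoid ring has a case for negation while \<open>P\<close> is only known to respect
    sums.\<close>
  have "P (I +>\<^bsub>F\<^esub> w) \<and> P (\<ominus>\<^bsub>T\<^esub> (I +>\<^bsub>F\<^esub> w))"
    using w
  proof (induction w rule: monoid_ring_induct[OF comm_monoid_prod, folded pre_tensor_def, consumes 1,
        case_names zero basis add neg])
    case zero
    have "I +>\<^bsub>F\<^esub> \<zero>\<^bsub>F\<^esub> = t \<zero>\<^bsub>R\<^esub> \<zero>\<^bsub>S\<^esub>"
      using nonunital_hom_zero[OF F.ring_axioms T.ring_axioms ring_hom_nonunital[OF coset_hom]]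
      by (simp add: pure_zero_left)
    then show ?case using pure[of "\<zero>\<^bsub>R\<^esub>" "\<zero>\<^bsub>S\<^esub>"] by (simp add: pure_zero_left)
  next
    case (basis x)
    then obtain a b where "x = (a, b)" "a \<in> carrier R" "b \<in> carrier S" by auto
    then show ?case
      using pure[of a b] pure[of "\<ominus>\<^bsub>R\<^esub> a" b] pure_neg[of a b] by (simp add: pure_def)
  next
    case (add u v)
    then show ?case
      using assms(3) coset_closed by (simp add: coset_add T.minus_add)
  next
    case (neg u)
    then show ?case using coset_closed by (simp add: coset_neg)
  qed
  then show ?thesis using z by simp
qed

text \<open>Stated for additive maps so that it also covers \<open>of_prod \<circ> to_prod\<close>
  and sums of two maps, which do not come with a proof of multiplicativity.\<close>

lemma additive_tensor_eqI:
  assumes "z \<in> carrier T"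
    and "\<And>x y. x \<in> carrier T \<Longrightarrow> y \<in> carrier T \<Longrightarrow> h (x \<oplus>\<^bsub>T\<^esub> y) = h x \<oplus>\<^bsub>D\<^esub> h y"
    and "\<And>x y. x \<in> carrier T \<Longrightarrow> y \<in> carrier T \<Longrightarrow> h' (x \<oplus>\<^bsub>T\<^esub> y) = h' x \<oplus>\<^bsub>D\<^esub> h' y"
    and "\<And>a b. a \<in> carrier R \<Longrightarrow> b \<in> carrier S \<Longrightarrow> h (t a b) = h' (t a b)"
  shows "h z = h' z"
  using assms(1)
proof (induction z rule: tensor_induct)
  case (pure a b)
  then show ?case by (rule assms(4))
next
  case (add x y)
  then show ?case by (simp only: assms(2,3))
qed

lemma nonunital_hom_tensor_eqI:
  assumes "z \<in> carrier T" "h \<in> nonunital_hom T D" "h' \<in> nonunital_hom T D"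
    and "\<And>a b. a \<in> carrier R \<Longrightarrow> b \<in> carrier S \<Longrightarrow> h (t a b) = h' (t a b)"
  shows "h z = h' z"
  by (rule additive_tensor_eqI[OF assms(1) nonunital_hom_add[OF assms(2)]
        nonunital_hom_add[OF assms(3)] assms(4)])

lemma ring_hom_tensor_eqI:
  assumes "z \<in> carrier T" "h \<in> ring_hom T D" "h' \<in> ring_hom T D"
    and "\<And>a. a \<in> carrier R \<Longrightarrow> h (t a \<one>\<^bsub>S\<^esub>) = h' (t a \<one>\<^bsub>S\<^esub>)"
    and "\<And>b. b \<in> carrier S \<Longrightarrow> h (t \<one>\<^bsub>R\<^esub> b) = h' (t \<one>\<^bsub>R\<^esub> b)"
  shows "h z = h' z"
  using assms(1)
proof (rule nonunital_hom_tensor_eqI[OF _ ring_hom_nonunital[OF assms(2)] ring_hom_nonunital[OF assms(3)]])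
  fix a b assume ab: "a \<in> carrier R" "b \<in> carrier S"
  then show "h (t a b) = h' (t a b)"
    unfolding pure_split[OF ab]
    by (simp only: ring_hom_mult[OF assms(2)] ring_hom_mult[OF assms(3)] assms(4,5)
        pure_closed R.one_closed S.one_closed)
qed

text \<open>The maps \<open>u\<close> and \<open>v\<close> need not be unital: multiplicativity is what makes the kernel of the
  induced map on the monoid ring an ideal.\<close>

definition balanced :: "('d, 'o) ring_scheme \<Rightarrow> ('a \<Rightarrow> 'd) \<Rightarrow> ('b \<Rightarrow> 'd) \<Rightarrow> bool" where
  "balanced D u v \<longleftrightarrow> cring D \<and> u \<in> nonunital_hom R D \<and> v \<in> nonunital_hom S D \<and>
    (\<forall>c \<in> carrier k. \<forall>a \<in> carrier R. \<forall>b \<in> carrier S.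
      u (f c \<otimes>\<^bsub>R\<^esub> a) \<otimes>\<^bsub>D\<^esub> v b = u a \<otimes>\<^bsub>D\<^esub> v (g c \<otimes>\<^bsub>S\<^esub> b))"

text \<open>Commutativity of \<open>D\<close> lets the common value \<open>u (f c) = v (g c)\<close>
  pass from one factor to the other.\<close>

lemma balanced_homI:
  assumes D: "cring D" and u: "u \<in> ring_hom R D" and v: "v \<in> ring_hom S D"
    and eq: "\<And>c. c \<in> carrier k \<Longrightarrow> u (f c) = v (g c)"
  shows "balanced D u v"
  unfolding balanced_def
proof (intro conjI ballI)
  interpret D: cring D by fact
  fix c a b assume "c \<in> carrier k" "a \<in> carrier R" "b \<in> carrier S"
  then show "u (f c \<otimes>\<^bsub>R\<^esub> a) \<otimes>\<^bsub>D\<^esub> v b = u a \<otimes>\<^bsub>D\<^esub> v (g c \<otimes>\<^bsub>S\<^esub> b)"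
    using ring_hom_closed[OF u] ring_hom_closed[OF v]
    by (simp add: ring_hom_mult[OF u] ring_hom_mult[OF v] eq D.m_ac)
qed (use D u v ring_hom_nonunital in auto)

section \<open>The map induced by a balanced pair\<close>

context
  fixes D :: "('d, 'o) ring_scheme" and u :: "'a \<Rightarrow> 'd" and v :: "'b \<Rightarrow> 'd"
  assumes bal: "balanced D u v"
begin

interpretation D: cring D using bal by (simp add: balanced_def)

abbreviation (input) "ev \<equiv> monoid_ring_eval D (\<lambda>z. u (fst z) \<otimes>\<^bsub>D\<^esub> v (snd z))"

lemma u: "u \<in> nonunital_hom R D" and v: "v \<in> nonunital_hom S D"
  using bal by (auto simp: balanced_def)

lemma uv_Pi: "(\<lambda>z. u (fst z) \<otimes>\<^bsub>D\<^esub> v (snd z)) \<in> carrier (R \<times>\<times> S) \<rightarrow> carrier D"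
  using nonunital_hom_closed[OF u] nonunital_hom_closed[OF v] by auto

lemmas ev_simps =
  monoid_ring_eval_closed[OF comm_monoid_prod D.is_cring uv_Pi, folded pre_tensor_def]
  monoid_ring_eval_add[OF comm_monoid_prod D.is_cring uv_Pi, folded pre_tensor_def]
  monoid_ring_eval_zero[OF comm_monoid_prod D.is_cring uv_Pi, folded pre_tensor_def]
  monoid_ring_eval_neg[OF comm_monoid_prod D.is_cring uv_Pi, folded pre_tensor_def]
  monoid_ring_eval_minus[OF comm_monoid_prod D.is_cring uv_Pi, folded pre_tensor_def]

lemma ev_e: "a \<in> carrier R \<Longrightarrow> b \<in> carrier S \<Longrightarrow> ev (e a b) = u a \<otimes>\<^bsub>D\<^esub> v b"
  using monoid_ring_eval_basis[OF comm_monoid_prod D.is_cring uv_Pi, of "(a, b)"] by simp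

lemma ev_mult:
  assumes "x \<in> carrier F" "y \<in> carrier F"
  shows "ev (x \<otimes>\<^bsub>F\<^esub> y) = ev x \<otimes>\<^bsub>D\<^esub> ev y"
proof (rule monoid_ring_eval_mult[OF comm_monoid_prod D.is_cring uv_Pi, folded pre_tensor_def, OF _ assms])
  fix x y assume "x \<in> carrier (R \<times>\<times> S)" "y \<in> carrier (R \<times>\<times> S)"
  then show "u (fst (x \<otimes>\<^bsub>R \<times>\<times> S\<^esub> y)) \<otimes>\<^bsub>D\<^esub> v (snd (x \<otimes>\<^bsub>R \<times>\<times> S\<^esub> y)) =
      u (fst x) \<otimes>\<^bsub>D\<^esub> v (snd x) \<otimes>\<^bsub>D\<^esub> (u (fst y) \<otimes>\<^bsub>D\<^esub> v (snd y))"
    using nonunital_hom_closed[OF u] nonunital_hom_closed[OF v]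
    by (auto simp: nonunital_hom_mult[OF u] nonunital_hom_mult[OF v] D.m_ac)
qed

text \<open>\<open>ev\<close> is additive and multiplicative, and the kernel of such a map absorbs
  products whether or not the unit is preserved.\<close>

lemma ideal_ev_zero: "ideal {w \<in> carrier F. ev w = \<zero>\<^bsub>D\<^esub>} F"
proof (rule idealI[OF F.ring_axioms])
  show "subgroup {w \<in> carrier F. ev w = \<zero>\<^bsub>D\<^esub>} (add_monoid F)"
    by (rule F.add.subgroupI) (auto simp: ev_simps a_inv_def[symmetric] intro: exI[of _ "\<zero>\<^bsub>F\<^esub>"])
qed (auto simp: ev_mult ev_simps)

lemma relations_ev_zero: "relations \<subseteq> {w \<in> carrier F. ev w = \<zero>\<^bsub>D\<^esub>}"
proof -
  have "ev w = \<zero>\<^bsub>D\<^esub>" if "w \<in> relations" for w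
    using that bal nonunital_hom_closed[OF u] nonunital_hom_closed[OF v] unfolding relations_def
    by (auto simp: balanced_def ev_simps ev_e nonunital_hom_add[OF u] nonunital_hom_add[OF v]
        D.r_distr D.l_distr D.r_neg a_minus_def)
  then show ?thesis using relations_closed by blast
qed

lemma ev_tensor_ideal: "w \<in> I \<Longrightarrow> ev w = \<zero>\<^bsub>D\<^esub>"
  using F.genideal_minimal[OF ideal_ev_zero relations_ev_zero] by (auto simp: tensor_ideal_eq)

text \<open>\<open>ev\<close> vanishes on the ideal and is therefore constant on the coset;
  \<open>the_elem\<close> is applied to a singleton.\<close>

lemma tensor_lift_coset:
  assumes w: "w \<in> carrier F"
  shows "tensor_lift D u v (I +>\<^bsub>F\<^esub> w) = ev w"
proof -
  have "ev (h \<oplus>\<^bsub>F\<^esub> w) = ev w" if "h \<in> I" for h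
    using that w I.Icarr[OF that] ev_tensor_ideal[OF that] by (simp add: ev_simps)
  moreover have "I +>\<^bsub>F\<^esub> w = (\<lambda>h. h \<oplus>\<^bsub>F\<^esub> w) ` I" by (auto simp: a_r_coset_def')
  moreover have "I \<noteq> {}" using I.zero_closed by blast
  ultimately have "ev ` (I +>\<^bsub>F\<^esub> w) = {ev w}" by (simp add: image_image image_constant_conv)
  then show ?thesis by (simp add: tensor_lift_def monoid_ring_eval_def)
qed

lemma tensor_lift_nonunital_hom: "tensor_lift D u v \<in> nonunital_hom T D"
proof (rule nonunital_homI)
  fix x assume "x \<in> carrier T"
  then obtain w where w: "w \<in> carrier F" "x = I +>\<^bsub>F\<^esub> w" by (auto simp: tensor_carrier)
  then show "tensor_lift D u v x \<in> carrier D" by (simp add: tensor_lift_coset ev_simps)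
next
  fix x y assume "x \<in> carrier T" "y \<in> carrier T"
  then obtain w w' where w: "w \<in> carrier F" "x = I +>\<^bsub>F\<^esub> w" "w' \<in> carrier F" "y = I +>\<^bsub>F\<^esub> w'"
    by (auto simp: tensor_carrier)
  show "tensor_lift D u v (x \<otimes>\<^bsub>T\<^esub> y) = tensor_lift D u v x \<otimes>\<^bsub>D\<^esub> tensor_lift D u v y"
    using w by (simp add: coset_mult[symmetric] tensor_lift_coset ev_mult)
  show "tensor_lift D u v (x \<oplus>\<^bsub>T\<^esub> y) = tensor_lift D u v x \<oplus>\<^bsub>D\<^esub> tensor_lift D u v y"
    using w by (simp add: coset_add[symmetric] tensor_lift_coset ev_simps)
qed

lemma tensor_lift_pure:
  assumes "a \<in> carrier R" "b \<in> carrier S"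
  shows "tensor_lift D u v (t a b) = u a \<otimes>\<^bsub>D\<^esub> v b"
  using assms by (simp add: pure_def tensor_lift_coset ev_e)

lemma balanced_cong:
  assumes u': "\<And>a. a \<in> carrier R \<Longrightarrow> u' a = u a" and v': "\<And>b. b \<in> carrier S \<Longrightarrow> v' b = v b"
  shows "balanced D u' v'"
proof -
  have "u' \<in> nonunital_hom R D" "v' \<in> nonunital_hom S D"
    using u v u' v' by (auto simp: nonunital_hom_def)
  moreover have "u' (f c \<otimes>\<^bsub>R\<^esub> a) \<otimes>\<^bsub>D\<^esub> v' b = u' a \<otimes>\<^bsub>D\<^esub> v' (g c \<otimes>\<^bsub>S\<^esub> b)"
    if "c \<in> carrier k" "a \<in> carrier R" "b \<in> carrier S" for a b c
    using that bal by (simp add: balanced_def u' v' del: R.m_closed S.m_closed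
        add: R.m_closed[OF f_closed] S.m_closed[OF g_closed])
  ultimately show ?thesis using D.is_cring by (simp add: balanced_def)
qed

end

text \<open>The functions \<open>u'\<close> and \<open>v'\<close> may be arbitrary outside the
  carriers, so the two lifts are different terms. They are compared on pure tensors, where only
  values on the carriers enter.\<close>

lemma tensor_lift_cong:
  assumes "balanced D u v" "z \<in> carrier T"
    and "\<And>a. a \<in> carrier R \<Longrightarrow> u' a = u a" and "\<And>b. b \<in> carrier S \<Longrightarrow> v' b = v b"
  shows "tensor_lift D u' v' z = tensor_lift D u v z"
proof -
  have bal: "balanced D u' v'" using assms(1,3,4) by (rule balanced_cong)
  show ?thesis
  proof (rule nonunital_hom_tensor_eqI[OF assms(2) tensor_lift_nonunital_hom[OF bal]
        tensor_lift_nonunital_hom[OF assms(1)]])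
    fix a b assume "a \<in> carrier R" "b \<in> carrier S"
    then show "tensor_lift D u' v' (t a b) = tensor_lift D u v (t a b)"
      by (simp only: tensor_lift_pure[OF bal] tensor_lift_pure[OF assms(1)] assms(3,4))
  qed
qed

lemma tensor_lift_ring_hom:
  assumes "cring D" "u \<in> ring_hom R D" "v \<in> ring_hom S D"
    and "\<And>c. c \<in> carrier k \<Longrightarrow> u (f c) = v (g c)"
  shows "tensor_lift D u v \<in> ring_hom T D"
proof -
  interpret D: cring D by fact
  have bal: "balanced D u v" using assms by (rule balanced_homI)
  show ?thesis
    using ring_hom_one[OF assms(2)] ring_hom_one[OF assms(3)]
    by (intro nonunital_hom_ring_hom tensor_lift_nonunital_hom[OF bal])
      (simp add: pure_one tensor_lift_pure[OF bal])
qed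

lemma tensor_lift_left:
  assumes "cring D" "u \<in> ring_hom R D" "v \<in> ring_hom S D"
    and "\<And>c. c \<in> carrier k \<Longrightarrow> u (f c) = v (g c)" and "a \<in> carrier R"
  shows "tensor_lift D u v (t a \<one>\<^bsub>S\<^esub>) = u a"
proof -
  interpret D: cring D by fact
  show ?thesis
    using tensor_lift_pure[OF balanced_homI[OF assms(1-4)], of a "\<one>\<^bsub>S\<^esub>"] assms(5)
      ring_hom_one[OF assms(3)] ring_hom_closed[OF assms(2)] by simp
qed

lemma tensor_lift_right:
  assumes "cring D" "u \<in> ring_hom R D" "v \<in> ring_hom S D"
    and "\<And>c. c \<in> carrier k \<Longrightarrow> u (f c) = v (g c)" and "b \<in> carrier S"
  shows "tensor_lift D u v (t \<one>\<^bsub>R\<^esub> b) = v b"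
proof -
  interpret D: cring D by fact
  show ?thesis
    using tensor_lift_pure[OF balanced_homI[OF assms(1-4)], of "\<one>\<^bsub>R\<^esub>" b] assms(5)
      ring_hom_one[OF assms(2)] ring_hom_closed[OF assms(3)] by simp
qed

end


section \<open>Functoriality of the tensor product\<close>

text \<open>Source and target may have different base rings, linked by \<open>\<tau>\<close>,
  because the endomorphisms of twisted rings and the morphisms of Hopf algebras below are
  semilinear.\<close>

locale tensor_product_map =
  src: tensor_product k0 f0 R0 g0 S0 + tgt: tensor_product k f R g S
  for k0 :: "('c0, 'l0) ring_scheme" and f0 :: "'c0 \<Rightarrow> 'a0" and R0 :: "('a0, 'm0) ring_scheme"
    and g0 :: "'c0 \<Rightarrow> 'b0" and S0 :: "('b0, 'n0) ring_scheme"
    and k :: "('c, 'l) ring_scheme" and f :: "'c \<Rightarrow> 'a" and R :: "('a, 'm) ring_scheme"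
    and g :: "'c \<Rightarrow> 'b" and S :: "('b, 'n) ring_scheme" +
  fixes \<tau> :: "'c0 \<Rightarrow> 'c" and u :: "'a0 \<Rightarrow> 'a" and v :: "'b0 \<Rightarrow> 'b"
  assumes \<tau>: "\<And>c. c \<in> carrier k0 \<Longrightarrow> \<tau> c \<in> carrier k"
    and u: "u \<in> ring_hom R0 R" and v: "v \<in> ring_hom S0 S"
    and uf: "\<And>c. c \<in> carrier k0 \<Longrightarrow> u (f0 c) = f (\<tau> c)"
    and vg: "\<And>c. c \<in> carrier k0 \<Longrightarrow> v (g0 c) = g (\<tau> c)"
begin

lemma tensor_map_compat:
  "cring tgt.T" "(\<lambda>a. tgt.t (u a) \<one>\<^bsub>S\<^esub>) \<in> ring_hom R0 tgt.T" "(\<lambda>b. tgt.t \<one>\<^bsub>R\<^esub> (v b)) \<in> ring_hom S0 tgt.T"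
  "\<And>c. c \<in> carrier k0 \<Longrightarrow> tgt.t (u (f0 c)) \<one>\<^bsub>S\<^esub> = tgt.t \<one>\<^bsub>R\<^esub> (v (g0 c))"
  using \<tau> by (auto simp: uf vg tgt.pure_scalar tgt.T_cring
      intro: ring_hom_comp'[OF u tgt.pure_left_hom] ring_hom_comp'[OF v tgt.pure_right_hom])

lemma tensor_map_hom: "tensor_map k f R g S u v \<in> ring_hom src.T tgt.T"
  unfolding tensor_map_def by (rule src.tensor_lift_ring_hom[OF tensor_map_compat])

lemma tensor_map_pure:
  assumes "a \<in> carrier R0" "b \<in> carrier S0"
  shows "tensor_map k f R g S u v (src.t a b) = tgt.t (u a) (v b)"
proof -
  have bal: "src.balanced tgt.T (\<lambda>a. tgt.t (u a) \<one>\<^bsub>S\<^esub>) (\<lambda>b. tgt.t \<one>\<^bsub>R\<^esub> (v b))"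
    by (rule src.balanced_homI[OF tensor_map_compat])
  interpret R: cring R by (rule tgt.R_cring)
  interpret S: cring S by (rule tgt.S_cring)
  from src.tensor_lift_pure[OF bal assms] show ?thesis
    using assms ring_hom_closed[OF u] ring_hom_closed[OF v] by (simp add: tensor_map_def tgt.pure_mult)
qed

end


section \<open>Hopf algebras\<close>

lemma ring_hom_generate_ring_eqI:
  assumes R: "ring R" and D: "ring D" and h: "h \<in> ring_hom R D" and h': "h' \<in> ring_hom R D"
    and Y: "Y \<subseteq> carrier R" and eq: "\<And>x. x \<in> Y \<Longrightarrow> h x = h' x"
    and z: "z \<in> generate_ring R Y"
  shows "h z = h' z"
  using z
proof induction
  case one
  then show ?case by (simp add: ring_hom_one[OF h] ring_hom_one[OF h'])
next
  case (incl x)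
  then show ?case by (rule eq)
next
  case (a_inv x)
  then show ?case
    using ring.generate_ring_in_carrier[OF R Y]
    by (simp add: nonunital_hom_neg[OF R D ring_hom_nonunital[OF h]]
        nonunital_hom_neg[OF R D ring_hom_nonunital[OF h']])
next
  case (eng_add x y)
  then show ?case
    using ring.generate_ring_in_carrier[OF R Y] by (simp add: ring_hom_add[OF h] ring_hom_add[OF h'])
next
  case (eng_mult x y)
  then show ?case
    using ring.generate_ring_in_carrier[OF R Y] by (simp add: ring_hom_mult[OF h] ring_hom_mult[OF h'])
qed

text \<open>The part of the Hopf algebra axioms that makes sense of the remaining identities.\<close>

locale pre_hopf =
  fixes k :: "('c, 'l) ring_scheme" and H :: "('c, 'a) hopf"
  assumes k_cring: "cring k" and A_cring: "cring (hring H)"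
    and hunit: "hunit H \<in> ring_hom k (hring H)"
    and comul: "comul H \<in> ring_hom (hring H) (hopf_sq k H)"
    and counit: "counit H \<in> ring_hom (hring H) k"
    and antipode: "antipode H \<in> ring_hom (hring H) (hring H)"
    and comul_hunit: "\<And>c. c \<in> carrier k \<Longrightarrow> comul H (hunit H c) = hopf_sq_unit k H c"
    and counit_hunit: "\<And>c. c \<in> carrier k \<Longrightarrow> counit H (hunit H c) = c"
    and antipode_hunit: "\<And>c. c \<in> carrier k \<Longrightarrow> antipode H (hunit H c) = hunit H c"

sublocale pre_hopf \<subseteq> sq: tensor_product k "hunit H" "hring H" "hunit H" "hring H"
  by (intro tensor_product.intro k_cring A_cring hunit)

text \<open>The Hopf-algebraic product of \<open>u\<close> and \<open>v\<close>: on points with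
  values in a commutative ring it is the group law of the represented group.\<close>

definition conv :: "('d, 'm) ring_scheme \<Rightarrow> ('c, 'a) hopf \<Rightarrow> ('a \<Rightarrow> 'd) \<Rightarrow> ('a \<Rightarrow> 'd) \<Rightarrow> 'a \<Rightarrow> 'd" where
  "conv D H u v a = tensor_lift D u v (comul H a)"

context pre_hopf
begin

lemma k_ring: "ring k" and A_ring: "ring (hring H)"
  using k_cring A_cring by (simp_all add: cring.axioms(1))

lemma hunit_closed [simp]: "c \<in> carrier k \<Longrightarrow> hunit H c \<in> carrier (hring H)"
  by (rule ring_hom_closed[OF hunit])

lemma comul_closed [simp]: "a \<in> carrier (hring H) \<Longrightarrow> comul H a \<in> carrier sq.T"
  by (rule ring_hom_closed[OF comul])

lemma counit_closed [simp]: "a \<in> carrier (hring H) \<Longrightarrow> counit H a \<in> carrier k"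
  by (rule ring_hom_closed[OF counit])

lemma antipode_closed [simp]: "a \<in> carrier (hring H) \<Longrightarrow> antipode H a \<in> carrier (hring H)"
  by (rule ring_hom_closed[OF antipode])

text \<open>Agreement on scalars makes the pair balanced over \<open>k\<close>. Commutativity of
  \<open>D\<close> is included because the convolution of ring morphisms is a ring morphism only
  under such a condition on the target.\<close>

definition convolvable :: "('d, 'm) ring_scheme \<Rightarrow> ('a \<Rightarrow> 'd) \<Rightarrow> ('a \<Rightarrow> 'd) \<Rightarrow> bool" where
  "convolvable D u v \<longleftrightarrow> cring D \<and> u \<in> ring_hom (hring H) D \<and> v \<in> ring_hom (hring H) D \<and>
    (\<forall>c \<in> carrier k. u (hunit H c) = v (hunit H c))"

lemma convolvableI:
  assumes "cring D" "u \<in> ring_hom (hring H) D" "v \<in> ring_hom (hring H) D"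
    and "\<And>c. c \<in> carrier k \<Longrightarrow> u (hunit H c) = v (hunit H c)"
  shows "convolvable D u v"
  using assms by (simp add: convolvable_def)

lemma convolvable_balanced: "convolvable D u v \<Longrightarrow> sq.balanced D u v"
  unfolding convolvable_def by (intro sq.balanced_homI) auto

lemma convolvable_lift_hom: "convolvable D u v \<Longrightarrow> tensor_lift D u v \<in> ring_hom sq.T D"
  unfolding convolvable_def by (intro sq.tensor_lift_ring_hom) auto

lemma conv_hom: "convolvable D u v \<Longrightarrow> conv D H u v \<in> ring_hom (hring H) D"
  unfolding conv_def[abs_def] by (rule ring_hom_comp'[OF comul convolvable_lift_hom])

text \<open>The comultiplication of a scalar is that scalar placed in the left factor, so
  \<open>v\<close> is evaluated at the unit.\<close>

lemma conv_hunit: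
  assumes "convolvable D u v" "c \<in> carrier k"
  shows "conv D H u v (hunit H c) = u (hunit H c)"
  unfolding conv_def comul_hunit[OF assms(2)] using assms
  by (intro sq.tensor_lift_left) (auto simp: convolvable_def)

lemma conv_cong:
  assumes "convolvable D u v" "a \<in> carrier (hring H)"
    and "\<And>x. x \<in> carrier (hring H) \<Longrightarrow> u' x = u x" "\<And>x. x \<in> carrier (hring H) \<Longrightarrow> v' x = v x"
  shows "conv D H u' v' a = conv D H u v a"
  unfolding conv_def
  by (rule sq.tensor_lift_cong[OF convolvable_balanced[OF assms(1)] comul_closed[OF assms(2)] assms(3,4)])

lemma convolvable_comp:
  assumes "convolvable D u v" "h \<in> ring_hom D D'" "cring D'"
  shows "convolvable D' (\<lambda>x. h (u x)) (\<lambda>x. h (v x))"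
  using assms ring_hom_comp'[OF _ assms(2)] by (auto simp: convolvable_def)

text \<open>On a pure tensor \<open>h\<close> turns \<open>u x \<cdot> v y\<close> into
  \<open>h (u x) \<cdot> h (v y)\<close>, so postcomposition passes inside a convolution.\<close>

lemma conv_natural:
  assumes uv: "convolvable D u v" and h: "h \<in> ring_hom D D'" and D': "cring D'"
    and a: "a \<in> carrier (hring H)"
  shows "h (conv D H u v a) = conv D' H (\<lambda>x. h (u x)) (\<lambda>x. h (v x)) a"
proof -
  have huv: "convolvable D' (\<lambda>x. h (u x)) (\<lambda>x. h (v x))"
    by (rule convolvable_comp[OF uv h D'])
  have closed: "u x \<in> carrier D" "v x \<in> carrier D" if "x \<in> carrier (hring H)" for x
    using uv that by (auto simp: convolvable_def intro: ring_hom_closed)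
  have "h (tensor_lift D u v z) = tensor_lift D' (\<lambda>x. h (u x)) (\<lambda>x. h (v x)) z"
    if "z \<in> carrier sq.T" for z
    using that
  proof (rule sq.nonunital_hom_tensor_eqI)
    show "(\<lambda>z. h (tensor_lift D u v z)) \<in> nonunital_hom sq.T D'"
      by (intro ring_hom_nonunital ring_hom_comp'[OF convolvable_lift_hom[OF uv] h])
    show "tensor_lift D' (\<lambda>x. h (u x)) (\<lambda>x. h (v x)) \<in> nonunital_hom sq.T D'"
      by (intro ring_hom_nonunital convolvable_lift_hom[OF huv])
  next
    fix x y assume "x \<in> carrier (hring H)" "y \<in> carrier (hring H)"
    then show "h (tensor_lift D u v (sq.t x y)) = tensor_lift D' (\<lambda>x. h (u x)) (\<lambda>x. h (v x)) (sq.t x y)"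
      by (simp only: sq.tensor_lift_pure[OF convolvable_balanced[OF uv]]
          sq.tensor_lift_pure[OF convolvable_balanced[OF huv]] ring_hom_mult[OF h] closed)
  qed
  then show ?thesis using comul_closed[OF a] by (simp only: conv_def)
qed

abbreviation j1 where "j1 a \<equiv> hopf_pure k H a \<one>\<^bsub>hring H\<^esub>"
abbreviation j2 where "j2 a \<equiv> hopf_pure k H \<one>\<^bsub>hring H\<^esub> a"

lemma j_convolvable: "convolvable sq.T j1 j2"
  using sq.pure_left_hom sq.pure_right_hom sq.pure_scalar sq.T_cring by (intro convolvableI) auto

end

text \<open>Compatibility with comultiplication thereby becomes an identity between convolutions, to
  which naturality and pullback apply.\<close>

lemma hopf_sq_map_conv: "hopf_sq_map l B f (comul H a) =
    conv (hopf_sq l B) H (\<lambda>x. hopf_pure l B (f x) \<one>\<^bsub>hring B\<^esub>) (\<lambda>x. hopf_pure l B \<one>\<^bsub>hring B\<^esub> (f x)) a"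
  by (simp add: conv_def tensor_map_def)

section \<open>Semilinear morphisms and the pullback of convolutions\<close>

locale pre_hopf_hom = H: pre_hopf k H + B: pre_hopf l B
  for k :: "('c, 'l) ring_scheme" and H :: "('c, 'a) hopf"
    and l :: "('d, 'm) ring_scheme" and B :: "('d, 'b) hopf" +
  fixes \<tau> :: "'c \<Rightarrow> 'd" and \<iota> :: "'a \<Rightarrow> 'b"
  assumes \<tau>: "\<tau> \<in> ring_hom k l" and \<iota>: "\<iota> \<in> hopf_hom k l \<tau> H B"
begin

lemma \<iota>_hom: "\<iota> \<in> ring_hom (hring H) (hring B)"
  and \<iota>_hunit: "c \<in> carrier k \<Longrightarrow> \<iota> (hunit H c) = hunit B (\<tau> c)"
  and \<iota>_comul: "a \<in> carrier (hring H) \<Longrightarrow> comul B (\<iota> a) =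
    conv B.sq.T H (\<lambda>x. B.j1 (\<iota> x)) (\<lambda>x. B.j2 (\<iota> x)) a"
  and \<iota>_counit: "a \<in> carrier (hring H) \<Longrightarrow> counit B (\<iota> a) = \<tau> (counit H a)"
  and \<iota>_antipode: "a \<in> carrier (hring H) \<Longrightarrow> antipode B (\<iota> a) = \<iota> (antipode H a)"
  using \<iota> by (auto simp: hopf_hom_def hopf_sq_map_conv)

lemma \<iota>_closed [simp]: "a \<in> carrier (hring H) \<Longrightarrow> \<iota> a \<in> carrier (hring B)"
  by (rule ring_hom_closed[OF \<iota>_hom])

lemma \<tau>_closed [simp]: "c \<in> carrier k \<Longrightarrow> \<tau> c \<in> carrier l"
  by (rule ring_hom_closed[OF \<tau>])

lemma convolvable_pullback:
  assumes "B.convolvable D u v"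
  shows "H.convolvable D (\<lambda>x. u (\<iota> x)) (\<lambda>x. v (\<iota> x))"
  using assms ring_hom_comp'[OF \<iota>_hom] by (auto simp: B.convolvable_def H.convolvable_def \<iota>_hunit)

text \<open>The comultiplication of \<open>B\<close> after \<open>\<iota>\<close> is the convolution
  of \<open>j1 \<circ> \<iota>\<close> and \<open>j2 \<circ> \<iota>\<close>; applying the lift of
  \<open>u\<close> and \<open>v\<close> to it replaces the two embeddings by \<open>u\<close> and
  \<open>v\<close>.\<close>

lemma conv_pullback:
  assumes uv: "B.convolvable D u v" and a: "a \<in> carrier (hring H)"
  shows "conv D B u v (\<iota> a) = conv D H (\<lambda>x. u (\<iota> x)) (\<lambda>x. v (\<iota> x)) a"
proof -
  have D: "cring D" and u: "u \<in> ring_hom (hring B) D" and v: "v \<in> ring_hom (hring B) D"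
    and eq: "\<And>c. c \<in> carrier l \<Longrightarrow> u (hunit B c) = v (hunit B c)"
    using uv by (auto simp: B.convolvable_def)
  have "conv D B u v (\<iota> a) = tensor_lift D u v (conv B.sq.T H (\<lambda>x. B.j1 (\<iota> x)) (\<lambda>x. B.j2 (\<iota> x)) a)"
    using a by (simp add: conv_def[of D B] \<iota>_comul)
  also have "\<dots> = conv D H (\<lambda>x. tensor_lift D u v (B.j1 (\<iota> x))) (\<lambda>x. tensor_lift D u v (B.j2 (\<iota> x))) a"
    by (rule H.conv_natural[OF convolvable_pullback[OF B.j_convolvable] B.convolvable_lift_hom[OF uv] D a])
  also have "\<dots> = conv D H (\<lambda>x. u (\<iota> x)) (\<lambda>x. v (\<iota> x)) a"
    by (rule H.conv_cong[OF convolvable_pullback[OF uv] a])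
      (auto intro: B.sq.tensor_lift_left[OF D u v eq] B.sq.tensor_lift_right[OF D u v eq])
  finally show ?thesis .
qed

end

text \<open>Comultiplicativity of the composite is \<open>conv_pullback\<close> for the pair
  \<open>j1 \<circ> \<kappa>\<close>, \<open>j2 \<circ> \<kappa>\<close>, whose convolution on
  \<open>B\<close> is the comultiplication of \<open>C\<close> after
  \<open>\<kappa>\<close>.\<close>

lemma hopf_hom_comp:
  assumes "pre_hopf_hom k H l B \<tau> \<iota>" "pre_hopf_hom l B m C \<tau>' \<kappa>"
  shows "pre_hopf_hom k H m C (\<lambda>c. \<tau>' (\<tau> c)) (\<lambda>a. \<kappa> (\<iota> a))"
proof -
  interpret f: pre_hopf_hom k H l B \<tau> \<iota> by fact
  interpret g: pre_hopf_hom l B m C \<tau>' \<kappa> by fact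
  show ?thesis
  proof (intro pre_hopf_hom.intro pre_hopf_hom_axioms.intro f.H.pre_hopf_axioms g.B.pre_hopf_axioms)
    show "(\<lambda>c. \<tau>' (\<tau> c)) \<in> ring_hom k m" by (rule ring_hom_comp'[OF f.\<tau> g.\<tau>])
    show "(\<lambda>a. \<kappa> (\<iota> a)) \<in> hopf_hom k m (\<lambda>c. \<tau>' (\<tau> c)) H C"
      using ring_hom_comp'[OF f.\<iota>_hom g.\<iota>_hom]
      by (auto simp: hopf_hom_def hopf_sq_map_conv f.\<iota>_hunit g.\<iota>_hunit f.\<iota>_counit g.\<iota>_counit
          f.\<iota>_antipode g.\<iota>_antipode g.\<iota>_comul f.conv_pullback[OF g.convolvable_pullback[OF g.B.j_convolvable]])
  qed
qed

locale generating_hopf_hom = pre_hopf_hom k H l B \<tau> \<iota>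
  for k :: "('c, 'l) ring_scheme" and H :: "('c, 'a) hopf"
    and l :: "('d, 'm) ring_scheme" and B :: "('d, 'b) hopf" and \<tau> \<iota> +
  assumes generate: "carrier (hring B) \<subseteq>
    generate_ring (hring B) (hunit B ` carrier l \<union> \<iota> ` carrier (hring H))"
begin

lemma ring_hom_eqI:
  assumes D: "ring D" and h: "h \<in> ring_hom (hring B) D" and h': "h' \<in> ring_hom (hring B) D"
    and "\<And>c. c \<in> carrier l \<Longrightarrow> h (hunit B c) = h' (hunit B c)"
    and "\<And>a. a \<in> carrier (hring H) \<Longrightarrow> h (\<iota> a) = h' (\<iota> a)"
    and z: "z \<in> carrier (hring B)"
  shows "h z = h' z"
proof -
  let ?Y = "hunit B ` carrier l \<union> \<iota> ` carrier (hring H)"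
  have Y: "?Y \<subseteq> carrier (hring B)"
    by (intro Un_least image_subsetI B.hunit_closed \<iota>_closed)
  have eq: "h x = h' x" if "x \<in> ?Y" for x
    using that
  proof (elim UnE imageE)
    fix c assume "x = hunit B c" "c \<in> carrier l"
    then show "h x = h' x" by (simp only: assms(4))
  next
    fix a assume "x = \<iota> a" "a \<in> carrier (hring H)"
    then show "h x = h' x" by (simp only: assms(5))
  qed
  show ?thesis
    by (rule ring_hom_generate_ring_eqI[OF B.A_ring D h h' Y eq subsetD[OF generate z]])
qed

text \<open>In each of the three identities both sides are ring morphisms out of \<open>B\<close>;
  for \<open>comul\<close> this uses that convolutions are ring morphisms. On scalars they agree by
  semilinearity, on the image of \<open>\<iota>\<close> by the assumption on
  \<open>f \<circ> \<iota>\<close>.\<close>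

lemma hopf_hom_from_generators:
  assumes C: "pre_hopf_hom k H m C (\<lambda>c. \<tau>' (\<tau> c)) (\<lambda>a. f (\<iota> a))"
    and \<tau>': "\<tau>' \<in> ring_hom l m" and f: "f \<in> ring_hom (hring B) (hring C)"
    and f_hunit: "\<And>c. c \<in> carrier l \<Longrightarrow> f (hunit B c) = hunit C (\<tau>' c)"
  shows "pre_hopf_hom l B m C \<tau>' f"
proof -
  interpret C: pre_hopf_hom k H m C "\<lambda>c. \<tau>' (\<tau> c)" "\<lambda>a. f (\<iota> a)" by fact
  note \<tau>'_closed = ring_hom_closed[OF \<tau>']
  have fc: "B.convolvable C.B.sq.T (\<lambda>x. C.B.j1 (f x)) (\<lambda>x. C.B.j2 (f x))"
    using \<tau>'_closed
    by (intro B.convolvableI C.B.sq.T_cring ring_hom_comp'[OF f C.B.sq.pure_left_hom]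
        ring_hom_comp'[OF f C.B.sq.pure_right_hom]) (simp add: f_hunit C.B.sq.pure_scalar)
  have "comul C (f b) = conv C.B.sq.T B (\<lambda>x. C.B.j1 (f x)) (\<lambda>x. C.B.j2 (f x)) b"
    if "b \<in> carrier (hring B)" for b
    by (rule ring_hom_eqI[OF C.B.sq.T_ring ring_hom_comp'[OF f C.B.comul] B.conv_hom[OF fc]])
      (simp_all add: B.conv_hunit[OF fc] f_hunit C.B.comul_hunit C.\<iota>_comul conv_pullback[OF fc] that \<tau>'_closed)
  moreover have "counit C (f b) = \<tau>' (counit B b)" if "b \<in> carrier (hring B)" for b
    by (rule ring_hom_eqI[OF C.B.k_ring ring_hom_comp'[OF f C.B.counit] ring_hom_comp'[OF B.counit \<tau>']])
      (simp_all add: f_hunit C.B.counit_hunit B.counit_hunit C.\<iota>_counit \<iota>_counit that \<tau>'_closed)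
  moreover have "antipode C (f b) = f (antipode B b)" if "b \<in> carrier (hring B)" for b
    by (rule ring_hom_eqI[OF C.B.A_ring ring_hom_comp'[OF f C.B.antipode] ring_hom_comp'[OF B.antipode f]])
      (simp_all add: f_hunit C.B.antipode_hunit B.antipode_hunit C.\<iota>_antipode \<iota>_antipode that \<tau>'_closed)
  ultimately show ?thesis
    using f f_hunit \<tau>'
    by (intro pre_hopf_hom.intro pre_hopf_hom_axioms.intro B.pre_hopf_axioms C.B.pre_hopf_axioms)
      (simp_all add: hopf_hom_def hopf_sq_map_conv)
qed

text \<open>\<open>\<iota>\<close> carries scalars of \<open>k\<close> to scalars of
  \<open>l\<close>, so the images of finitely many generators of \<open>H\<close> already produce
  the whole image of \<open>\<iota>\<close> over \<open>l\<close>.\<close>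

lemma finitely_generated:
  assumes "finitely_generated_hopf k H"
  shows "finitely_generated_hopf l B"
proof -
  obtain F where F: "finite F" "F \<subseteq> carrier (hring H)"
    "generate_ring (hring H) (hunit H ` carrier k \<union> F) = carrier (hring H)"
    using assms by (auto simp: finitely_generated_hopf_def)
  let ?Y = "hunit B ` carrier l \<union> \<iota> ` F"
  have Y: "?Y \<subseteq> carrier (hring B)"
    by (intro Un_least image_subsetI B.hunit_closed \<iota>_closed subsetD[OF F(2)])
  have "\<iota> a \<in> generate_ring (hring B) ?Y" if "a \<in> generate_ring (hring H) (hunit H ` carrier k \<union> F)" for a
    using that
  proof induction
    case one
    then show ?case using generate_ring.one by (simp add: ring_hom_one[OF \<iota>_hom])
  next
    case (incl a)
    then show ?case by (auto simp: \<iota>_hunit intro!: generate_ring.incl)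
  next
    case (a_inv a)
    then show ?case
      using F by (simp add: generate_ring.a_inv
          nonunital_hom_neg[OF H.A_ring B.A_ring ring_hom_nonunital[OF \<iota>_hom]])
  next
    case (eng_add a b)
    then show ?case using F by (simp add: generate_ring.eng_add ring_hom_add[OF \<iota>_hom])
  next
    case (eng_mult a b)
    then show ?case using F by (simp add: generate_ring.eng_mult ring_hom_mult[OF \<iota>_hom])
  qed
  then have sub: "hunit B ` carrier l \<union> \<iota> ` carrier (hring H) \<subseteq> generate_ring (hring B) ?Y"
    using F(3) by (auto intro: generate_ring.incl)
  have "generate_ring (hring B) (hunit B ` carrier l \<union> \<iota> ` carrier (hring H)) \<subseteq> generate_ring (hring B) ?Y"
    by (rule ring.generate_ring_min_subring1[OF B.A_ring _ ring.generate_ring_is_subring[OF B.A_ring Y] sub])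
      (intro Un_least image_subsetI B.hunit_closed \<iota>_closed)
  then have "carrier (hring B) = generate_ring (hring B) ?Y"
    using generate ring.generate_ring_incl[OF B.A_ring Y] by blast
  then show ?thesis
    using F(1) unfolding finitely_generated_hopf_def
    by (intro exI[of _ "\<iota> ` F"] conjI finite_imageI image_subsetI \<iota>_closed subsetD[OF F(2)]) auto
qed

end


section \<open>The Hopf axioms as identities of convolutions\<close>

context pre_hopf
begin

lemma sq_unit_hom: "hopf_sq_unit k H \<in> ring_hom k sq.T"
  by (rule ring_hom_comp'[OF hunit sq.pure_left_hom])

end

sublocale pre_hopf \<subseteq> tri: tensor_product k "hunit H" "hring H" "hopf_sq_unit k H" "hopf_sq k H"
  by (intro tensor_product.intro k_cring A_cring sq.T_cring hunit sq_unit_hom)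

context pre_hopf
begin

abbreviation i1 where "i1 a \<equiv> tri.t a \<one>\<^bsub>sq.T\<^esub>"
abbreviation i2 where "i2 a \<equiv> tri.t \<one>\<^bsub>hring H\<^esub> (j1 a)"
abbreviation i3 where "i3 a \<equiv> tri.t \<one>\<^bsub>hring H\<^esub> (j2 a)"

lemma i_homs: "i1 \<in> ring_hom (hring H) tri.T" "i2 \<in> ring_hom (hring H) tri.T"
  "i3 \<in> ring_hom (hring H) tri.T"
  by (rule tri.pure_left_hom ring_hom_comp'[OF sq.pure_left_hom tri.pure_right_hom]
      ring_hom_comp'[OF sq.pure_right_hom tri.pure_right_hom])+

lemma i_hunit:
  assumes "c \<in> carrier k"
  shows "i2 (hunit H c) = i1 (hunit H c)" "i3 (hunit H c) = i1 (hunit H c)"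
  using tri.pure_scalar[OF assms] sq.pure_scalar[OF assms] by simp_all

lemma i_convolvable: "convolvable tri.T i1 i2" "convolvable tri.T i2 i3"
  by (rule convolvableI[OF tri.T_cring]; simp add: i_homs i_hunit)+

lemma i_convolvable': "convolvable tri.T (conv tri.T H i1 i2) i3" "convolvable tri.T i1 (conv tri.T H i2 i3)"
  by (rule convolvableI[OF tri.T_cring];
      simp add: i_homs i_hunit conv_hom[OF i_convolvable(1)] conv_hom[OF i_convolvable(2)]
        conv_hunit[OF i_convolvable(1)] conv_hunit[OF i_convolvable(2)])+

text \<open>Coassociativity is associativity of convolution for the three universal maps
  \<open>i1\<close>, \<open>i2\<close>, \<open>i3\<close> into the threefold tensor product.\<close>

lemma coassociative_iff: "coassociative k H \<longleftrightarrow> (\<forall>a \<in> carrier (hring H).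
    conv tri.T H (conv tri.T H i1 i2) i3 a = conv tri.T H i1 (conv tri.T H i2 i3) a)"
  by (simp add: coassociative_def conv_def[abs_def] Let_def)

lemma hunit_counit_hom: "(\<lambda>a. hunit H (counit H a)) \<in> ring_hom (hring H) (hring H)"
  by (rule ring_hom_comp'[OF counit hunit])

lemma id_hom: "id \<in> ring_hom (hring H) (hring H)"
  by (simp add: ring_hom_def)

lemma counit_convolvable:
  "convolvable (hring H) (\<lambda>a. hunit H (counit H a)) id"
  "convolvable (hring H) id (\<lambda>a. hunit H (counit H a))"
  "convolvable (hring H) (antipode H) id"
  "convolvable (hring H) id (antipode H)"
  by (rule convolvableI[OF A_cring];
      simp add: hunit_counit_hom id_hom antipode counit_hunit antipode_hunit)+

text \<open>In terms of convolution, the counit followed by the unit is neutral for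
  \<open>id\<close>, and the antipode is a two-sided inverse of \<open>id\<close>; the structural
  axioms are already part of \<open>pre_hopf\<close>.\<close>

lemma is_hopf_iff: "is_hopf k H \<longleftrightarrow> coassociative k H \<and> (\<forall>a \<in> carrier (hring H).
    conv (hring H) H (\<lambda>b. hunit H (counit H b)) id a = a \<and>
    conv (hring H) H id (\<lambda>b. hunit H (counit H b)) a = a \<and>
    conv (hring H) H (antipode H) id a = hunit H (counit H a) \<and>
    conv (hring H) H id (antipode H) a = hunit H (counit H a))"
  using k_cring A_cring hunit comul counit antipode
  by (simp add: is_hopf_def Let_def conv_def comul_hunit counit_hunit antipode_hunit)

end

lemma is_hopf_pre_hopf: "is_hopf k H \<Longrightarrow> pre_hopf k H"
  unfolding is_hopf_def Let_def by (intro pre_hopf.intro) blast+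

context pre_hopf_hom
begin

lemma sq_map: "tensor_product_map k (hunit H) (hring H) (hunit H) (hring H)
    l (hunit B) (hring B) (hunit B) (hring B) \<tau> \<iota> \<iota>"
  by (intro tensor_product_map.intro tensor_product_map_axioms.intro H.sq.tensor_product_axioms
      B.sq.tensor_product_axioms \<tau>_closed \<iota>_hom \<iota>_hunit)

interpretation sq: tensor_product_map k "hunit H" "hring H" "hunit H" "hring H"
  l "hunit B" "hring B" "hunit B" "hring B" \<tau> \<iota> \<iota>
  by (rule sq_map)

interpretation H: cring "hring H" by (rule H.A_cring)
interpretation B: cring "hring B" by (rule B.A_cring)

lemma tri_map: "tensor_product_map k (hunit H) (hring H) (hopf_sq_unit k H) H.sq.T
    l (hunit B) (hring B) (hopf_sq_unit l B) B.sq.T \<tau> \<iota> (hopf_sq_map l B \<iota>)"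
  by (intro tensor_product_map.intro tensor_product_map_axioms.intro H.tri.tensor_product_axioms
      B.tri.tensor_product_axioms \<tau>_closed \<iota>_hom \<iota>_hunit sq.tensor_map_hom)
    (simp_all add: sq.tensor_map_pure \<iota>_hunit ring_hom_one[OF \<iota>_hom])

interpretation tri: tensor_product_map k "hunit H" "hring H" "hopf_sq_unit k H" H.sq.T
    l "hunit B" "hring B" "hopf_sq_unit l B" B.sq.T \<tau> \<iota> "hopf_sq_map l B \<iota>"
  by (rule tri_map)

abbreviation "\<iota>3 \<equiv> tensor_map l (hunit B) (hring B) (hopf_sq_unit l B) B.sq.T \<iota> (hopf_sq_map l B \<iota>)"

lemma \<iota>3_hom: "\<iota>3 \<in> ring_hom H.tri.T B.tri.T"
  by (rule tri.tensor_map_hom)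

lemma sq_T_one: "\<one>\<^bsub>H.sq.T\<^esub> \<in> carrier H.sq.T"
  using H.sq.T_ring by (rule ring.ring_simprules)

text \<open>\<open>\<iota>3\<close> is \<open>\<iota> \<otimes> (\<iota> \<otimes> \<iota>)\<close>.
  It matches the three embeddings of \<open>H\<close> with those of \<open>B\<close>; the iterated
  convolutions are built from these alone, so it matches them too.\<close>

lemma \<iota>3_i:
  assumes "a \<in> carrier (hring H)"
  shows "\<iota>3 (H.i1 a) = B.i1 (\<iota> a)" "\<iota>3 (H.i2 a) = B.i2 (\<iota> a)" "\<iota>3 (H.i3 a) = B.i3 (\<iota> a)"
  using assms sq_T_one
  by (simp_all add: tri.tensor_map_pure sq.tensor_map_pure ring_hom_one[OF \<iota>_hom]
      ring_hom_one[OF sq.tensor_map_hom])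

lemma coassociativity_pullback:
  assumes a: "a \<in> carrier (hring H)"
  shows "conv B.tri.T B (conv B.tri.T B B.i1 B.i2) B.i3 (\<iota> a) =
      \<iota>3 (conv H.tri.T H (conv H.tri.T H H.i1 H.i2) H.i3 a)"
    and "conv B.tri.T B B.i1 (conv B.tri.T B B.i2 B.i3) (\<iota> a) =
      \<iota>3 (conv H.tri.T H H.i1 (conv H.tri.T H H.i2 H.i3) a)"
proof -
  \<comment> \<open>A convolution on \<open>B\<close> is pulled back to \<open>H\<close>, and
    \<open>\<iota>3\<close> is taken out of the resulting convolution. The rule is used twice, for
    the inner and for the outer convolution.\<close>
  have conv_eq: "conv B.tri.T B u v (\<iota> a) = \<iota>3 (conv H.tri.T H u0 v0 a)"
    if "B.convolvable B.tri.T u v" "H.convolvable H.tri.T u0 v0" "a \<in> carrier (hring H)"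
      and "\<And>x. x \<in> carrier (hring H) \<Longrightarrow> u (\<iota> x) = \<iota>3 (u0 x)"
      and "\<And>x. x \<in> carrier (hring H) \<Longrightarrow> v (\<iota> x) = \<iota>3 (v0 x)" for u v u0 v0 a
    unfolding conv_pullback[OF that(1,3)] H.conv_natural[OF that(2) \<iota>3_hom B.tri.T_cring that(3)]
    by (rule H.conv_cong[OF H.convolvable_comp[OF that(2) \<iota>3_hom B.tri.T_cring] that(3) that(4,5)])
  show "conv B.tri.T B (conv B.tri.T B B.i1 B.i2) B.i3 (\<iota> a) =
      \<iota>3 (conv H.tri.T H (conv H.tri.T H H.i1 H.i2) H.i3 a)"
    by (rule conv_eq[OF B.i_convolvable'(1) H.i_convolvable'(1) a
          conv_eq[OF B.i_convolvable(1) H.i_convolvable(1)]]) (simp_all add: \<iota>3_i)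
  show "conv B.tri.T B B.i1 (conv B.tri.T B B.i2 B.i3) (\<iota> a) =
      \<iota>3 (conv H.tri.T H H.i1 (conv H.tri.T H H.i2 H.i3) a)"
    by (rule conv_eq[OF B.i_convolvable'(2) H.i_convolvable'(2) a _
          conv_eq[OF B.i_convolvable(2) H.i_convolvable(2)]]) (simp_all add: \<iota>3_i)
qed

end

section \<open>Hopf axioms inherited along a generating morphism\<close>

context generating_hopf_hom
begin

text \<open>On scalars both iterated convolutions reduce to their leftmost map \<open>i1\<close>; on
  the image of \<open>\<iota>\<close> they are the images under \<open>\<iota>3\<close> of the two
  sides for \<open>H\<close>.\<close>

lemma coassociative:
  assumes "coassociative k H"
  shows "coassociative l B"
  unfolding B.coassociative_iff
proof
  fix b assume b: "b \<in> carrier (hring B)"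
  show "conv B.tri.T B (conv B.tri.T B B.i1 B.i2) B.i3 b =
      conv B.tri.T B B.i1 (conv B.tri.T B B.i2 B.i3) b"
  proof (rule ring_hom_eqI[OF B.tri.T_ring B.conv_hom[OF B.i_convolvable'(1)]
        B.conv_hom[OF B.i_convolvable'(2)] _ _ b])
    fix c assume "c \<in> carrier l"
    then show "conv B.tri.T B (conv B.tri.T B B.i1 B.i2) B.i3 (hunit B c) =
        conv B.tri.T B B.i1 (conv B.tri.T B B.i2 B.i3) (hunit B c)"
      by (simp only: B.conv_hunit[OF B.i_convolvable'(1)] B.conv_hunit[OF B.i_convolvable'(2)]
          B.conv_hunit[OF B.i_convolvable(1)])
  next
    fix a assume "a \<in> carrier (hring H)"
    then show "conv B.tri.T B (conv B.tri.T B B.i1 B.i2) B.i3 (\<iota> a) =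
        conv B.tri.T B B.i1 (conv B.tri.T B B.i2 B.i3) (\<iota> a)"
      using assms by (simp only: coassociativity_pullback H.coassociative_iff)
  qed
qed

text \<open>The common shape of the counit and antipode axioms: \<open>w\<close> is the identity or
  the unit after the counit, and \<open>eq\<close> contains the axiom for \<open>H\<close>, moved
  into \<open>B\<close> by \<open>\<iota>\<close>.\<close>

lemma conv_eq:
  assumes uv: "B.convolvable (hring B) u v" and uv0: "H.convolvable (hring H) u0 v0"
    and w: "w \<in> ring_hom (hring B) (hring B)"
    and w_hunit: "\<And>c. c \<in> carrier l \<Longrightarrow> u (hunit B c) = w (hunit B c)"
    and u: "\<And>a. a \<in> carrier (hring H) \<Longrightarrow> u (\<iota> a) = \<iota> (u0 a)"
    and v: "\<And>a. a \<in> carrier (hring H) \<Longrightarrow> v (\<iota> a) = \<iota> (v0 a)"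
    and eq: "\<And>a. a \<in> carrier (hring H) \<Longrightarrow> w (\<iota> a) = \<iota> (conv (hring H) H u0 v0 a)"
    and b: "b \<in> carrier (hring B)"
  shows "conv (hring B) B u v b = w b"
proof (rule ring_hom_eqI[OF B.A_ring B.conv_hom[OF uv] w _ _ b])
  fix c assume c: "c \<in> carrier l"
  show "conv (hring B) B u v (hunit B c) = w (hunit B c)"
    by (simp only: B.conv_hunit[OF uv c] w_hunit[OF c])
next
  fix a assume a: "a \<in> carrier (hring H)"
  show "conv (hring B) B u v (\<iota> a) = w (\<iota> a)"
    unfolding conv_pullback[OF uv a] eq[OF a] H.conv_natural[OF uv0 \<iota>_hom B.A_cring a]
    by (rule H.conv_cong[OF H.convolvable_comp[OF uv0 \<iota>_hom B.A_cring] a u v])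
qed

lemma is_hopf:
  assumes H: "is_hopf k H"
  shows "is_hopf l B"
  unfolding B.is_hopf_iff
proof (intro conjI ballI)
  note ax = H[unfolded H.is_hopf_iff, THEN conjunct2, rule_format]
  show "coassociative l B" using H by (intro coassociative) (simp add: H.is_hopf_iff)
  fix b assume b: "b \<in> carrier (hring B)"
  note rules = B.counit_hunit B.antipode_hunit \<iota>_counit \<iota>_hunit \<iota>_antipode
  have "conv (hring B) B (\<lambda>b. hunit B (counit B b)) id b = id b"
    by (rule conv_eq[OF B.counit_convolvable(1) H.counit_convolvable(1) B.id_hom _ _ _ _ b])
      (simp_all add: rules ax)
  then show "conv (hring B) B (\<lambda>b. hunit B (counit B b)) id b = b" by simp
  have "conv (hring B) B id (\<lambda>b. hunit B (counit B b)) b = id b"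
    by (rule conv_eq[OF B.counit_convolvable(2) H.counit_convolvable(2) B.id_hom _ _ _ _ b])
      (simp_all add: rules ax)
  then show "conv (hring B) B id (\<lambda>b. hunit B (counit B b)) b = b" by simp
  show "conv (hring B) B (antipode B) id b = hunit B (counit B b)"
    by (rule conv_eq[OF B.counit_convolvable(3) H.counit_convolvable(3) B.hunit_counit_hom _ _ _ _ b])
      (simp_all add: rules ax)
  show "conv (hring B) B id (antipode B) b = hunit B (counit B b)"
    by (rule conv_eq[OF B.counit_convolvable(4) H.counit_convolvable(4) B.hunit_counit_hom _ _ _ _ b])
      (simp_all add: rules ax)
qed

end


text \<open>Composition and lifting produce maps that equal the intended ones on carriers only. The
  replacement must therefore be justified inside the convolution as well.\<close>

lemma pre_hopf_hom_cong:
  assumes "pre_hopf_hom k H l B \<tau> \<iota>"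
    and \<tau>_eq: "\<And>c. c \<in> carrier k \<Longrightarrow> \<tau>' c = \<tau> c"
    and \<iota>_eq: "\<And>a. a \<in> carrier (hring H) \<Longrightarrow> \<iota>' a = \<iota> a"
  shows "pre_hopf_hom k H l B \<tau>' \<iota>'"
proof -
  interpret pre_hopf_hom k H l B \<tau> \<iota> by fact
  interpret k: cring k by (rule H.k_cring)
  interpret A: cring "hring H" by (rule H.A_cring)
  have \<tau>_hom: "\<tau>' \<in> ring_hom k l"
    using \<tau>_eq[OF k.m_closed] \<tau>_eq[OF k.a_closed] \<tau>_eq
    by (intro ring_hom_memI)
      (simp_all add: ring_hom_mult[OF \<tau>] ring_hom_add[OF \<tau>] ring_hom_one[OF \<tau>])
  have \<iota>_hom': "\<iota>' \<in> ring_hom (hring H) (hring B)"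
    using \<iota>_eq[OF A.m_closed] \<iota>_eq[OF A.a_closed] \<iota>_eq
    by (intro ring_hom_memI)
      (simp_all add: ring_hom_mult[OF \<iota>_hom] ring_hom_add[OF \<iota>_hom] ring_hom_one[OF \<iota>_hom])
  have conv: "conv B.sq.T H (\<lambda>x. B.j1 (\<iota>' x)) (\<lambda>x. B.j2 (\<iota>' x)) a =
      conv B.sq.T H (\<lambda>x. B.j1 (\<iota> x)) (\<lambda>x. B.j2 (\<iota> x)) a" if "a \<in> carrier (hring H)" for a
    using that by (intro H.conv_cong[OF convolvable_pullback[OF B.j_convolvable]]) (simp_all add: \<iota>_eq)
  have "\<iota>' \<in> hopf_hom k l \<tau>' H B"
    using \<iota>_hom'
    by (simp add: hopf_hom_def hopf_sq_map_conv \<tau>_eq \<iota>_eq conv \<iota>_hunit \<iota>_comul \<iota>_counit \<iota>_antipode)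
  then show ?thesis
    by (intro pre_hopf_hom.intro pre_hopf_hom_axioms.intro H.pre_hopf_axioms B.pre_hopf_axioms \<tau>_hom)
qed


section \<open>Base change of Hopf algebras\<close>

locale hopf_scalar_extension = H: pre_hopf k H
  for k :: "('c, 'l) ring_scheme" and H :: "('c, 'a) hopf" +
  fixes S :: "('d, 'm) ring_scheme" and j :: "'c \<Rightarrow> 'd"
  assumes S_cring: "cring S" and j: "j \<in> ring_hom k S"

sublocale hopf_scalar_extension \<subseteq> bc: tensor_product k "hunit H" "hring H" j S
  by (intro tensor_product.intro H.k_cring H.A_cring S_cring H.hunit j)

context hopf_scalar_extension
begin

interpretation S: cring S by (rule S_cring)
interpretation A: cring "hring H" by (rule H.A_cring)
interpretation T: cring bc.T by (rule bc.T_cring)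

abbreviation "B \<equiv> hopf_base_change k H S j"
abbreviation \<iota> where "\<iota> a \<equiv> bc.t a \<one>\<^bsub>S\<^esub>"
abbreviation \<eta> where "\<eta> s \<equiv> bc.t \<one>\<^bsub>hring H\<^esub> s"

lemma \<iota>_hunit: "c \<in> carrier k \<Longrightarrow> \<iota> (hunit H c) = \<eta> (j c)"
  by (rule bc.pure_scalar)

interpretation sq: tensor_product S \<eta> bc.T \<eta> bc.T
  by (intro tensor_product.intro S_cring bc.T_cring bc.pure_right_hom)

interpretation sqm: tensor_product_map k "hunit H" "hring H" "hunit H" "hring H" S \<eta> bc.T \<eta> bc.T j \<iota> \<iota>
  by (intro tensor_product_map.intro tensor_product_map_axioms.intro H.sq.tensor_product_axioms
      sq.tensor_product_axioms bc.pure_left_hom \<iota>_hunit ring_hom_closed[OF j])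

interpretation anti: tensor_product_map k "hunit H" "hring H" j S k "hunit H" "hring H" j S id "antipode H" id
  by (intro tensor_product_map.intro tensor_product_map_axioms.intro bc.tensor_product_axioms H.antipode)
    (simp_all add: H.antipode_hunit ring_hom_def)

lemma B_simps [simp]: "hring B = bc.T" "hunit B = \<eta>"
  "comul B = tensor_lift sq.T (\<lambda>h. tensor_map S \<eta> bc.T \<eta> bc.T \<iota> \<iota> (comul H h)) (\<lambda>s. sq.t (\<eta> s) \<one>\<^bsub>bc.T\<^esub>)"
  "counit B = tensor_lift S (\<lambda>h. j (counit H h)) id"
  "antipode B = tensor_map k (hunit H) (hring H) j S (antipode H) id"
  by (simp_all add: hopf_base_change_def Let_def)

lemma comul_compat:
  "cring sq.T" "(\<lambda>h. tensor_map S \<eta> bc.T \<eta> bc.T \<iota> \<iota> (comul H h)) \<in> ring_hom (hring H) sq.T"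
  "(\<lambda>s. sq.t (\<eta> s) \<one>\<^bsub>bc.T\<^esub>) \<in> ring_hom S sq.T"
  "\<And>c. c \<in> carrier k \<Longrightarrow> tensor_map S \<eta> bc.T \<eta> bc.T \<iota> \<iota> (comul H (hunit H c)) = sq.t (\<eta> (j c)) \<one>\<^bsub>bc.T\<^esub>"
  by (rule sq.T_cring ring_hom_comp'[OF H.comul sqm.tensor_map_hom]
      ring_hom_comp'[OF bc.pure_right_hom sq.pure_left_hom])+
    (simp add: H.comul_hunit sqm.tensor_map_pure \<iota>_hunit bc.pure_one)

lemma counit_compat:
  "cring S" "(\<lambda>h. j (counit H h)) \<in> ring_hom (hring H) S" "id \<in> ring_hom S S"
  "\<And>c. c \<in> carrier k \<Longrightarrow> j (counit H (hunit H c)) = id (j c)"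
  by (rule S_cring ring_hom_comp'[OF H.counit j])+ (simp_all add: H.counit_hunit ring_hom_def)

text \<open>The comultiplication, counit and antipode are lifts from the tensor product, so their
  values on scalars are those prescribed on the right factor.\<close>

lemma pre_hopf_base_change: "pre_hopf S B"
proof (rule pre_hopf.intro)
  show "comul B \<in> ring_hom (hring B) (hopf_sq S B)"
    using bc.tensor_lift_ring_hom[OF comul_compat] by simp
  show "counit B \<in> ring_hom (hring B) S"
    unfolding B_simps by (rule bc.tensor_lift_ring_hom[OF counit_compat])
  show "antipode B \<in> ring_hom (hring B) (hring B)"
    using anti.tensor_map_hom by simp
  fix s assume s: "s \<in> carrier S"
  show "comul B (hunit B s) = hopf_sq_unit S B s"
    using bc.tensor_lift_right[OF comul_compat s] by simp
  show "counit B (hunit B s) = s"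
    unfolding B_simps by (rule trans[OF bc.tensor_lift_right[OF counit_compat s] id_apply])
  show "antipode B (hunit B s) = hunit B s"
    using s by (simp add: anti.tensor_map_pure ring_hom_one[OF H.antipode])
qed (simp_all add: bc.pure_right_hom S_cring bc.T_cring)

text \<open>Compatibility of \<open>\<iota>\<close> with these lifts holds by construction, since
  their values on the left factor were prescribed by the structure of \<open>H\<close>.\<close>

lemma base_change_hom: "generating_hopf_hom k H S B j \<iota>"
proof (intro generating_hopf_hom.intro generating_hopf_hom_axioms.intro pre_hopf_hom.intro
    pre_hopf_hom_axioms.intro H.pre_hopf_axioms pre_hopf_base_change j)
  have "counit B (\<iota> a) = j (counit H a)" if "a \<in> carrier (hring H)" for a
    unfolding B_simps by (rule bc.tensor_lift_left[OF counit_compat that])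
  then show "\<iota> \<in> hopf_hom k S j H B"
    using bc.tensor_lift_left[OF comul_compat]
    by (simp add: hopf_hom_def bc.pure_left_hom \<iota>_hunit anti.tensor_map_pure del: B_simps(4))
  show "carrier (hring B) \<subseteq> generate_ring (hring B) (hunit B ` carrier S \<union> \<iota> ` carrier (hring H))"
  proof
    fix z assume "z \<in> carrier (hring B)"
    then have "z \<in> carrier bc.T" by simp
    then show "z \<in> generate_ring (hring B) (hunit B ` carrier S \<union> \<iota> ` carrier (hring H))"
    proof (induction z rule: bc.tensor_induct)
      case (pure a b)
      \<comment> \<open>A pure tensor is the product of an element of the image of
        \<open>\<iota>\<close> and a scalar.\<close>
      then have "\<iota> a \<otimes>\<^bsub>hring B\<^esub> \<eta> b \<in> generate_ring (hring B) (hunit B ` carrier S \<union> \<iota> ` carrier (hring H))"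
        by (intro generate_ring.eng_mult generate_ring.incl) simp_all
      then show ?case using bc.pure_split[OF pure] by simp
    next
      case (add x y)
      then show ?case using generate_ring.eng_add[of _ "hring B"] by simp
    qed
  qed
qed

lemma is_hopf_base_change: "is_hopf k H \<Longrightarrow> is_hopf S B"
  by (rule generating_hopf_hom.is_hopf[OF base_change_hom])

lemma finitely_generated_base_change: "finitely_generated_hopf k H \<Longrightarrow> finitely_generated_hopf S B"
  by (rule generating_hopf_hom.finitely_generated[OF base_change_hom])

lemma lift_compat:
  assumes "pre_hopf_hom k H m C (\<lambda>c. \<tau> (j c)) \<psi>" "\<tau> \<in> ring_hom S m"
  shows "cring (hring C)" "\<psi> \<in> ring_hom (hring H) (hring C)" "(\<lambda>s. hunit C (\<tau> s)) \<in> ring_hom S (hring C)"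
    "\<And>c. c \<in> carrier k \<Longrightarrow> \<psi> (hunit H c) = hunit C (\<tau> (j c))"
proof -
  interpret C: pre_hopf_hom k H m C "\<lambda>c. \<tau> (j c)" \<psi> by fact
  show "cring (hring C)" "\<psi> \<in> ring_hom (hring H) (hring C)" "(\<lambda>s. hunit C (\<tau> s)) \<in> ring_hom S (hring C)"
    by (rule C.B.A_cring C.\<iota>_hom ring_hom_comp'[OF assms(2) C.B.hunit])+
  show "\<psi> (hunit H c) = hunit C (\<tau> (j c))" if "c \<in> carrier k" for c
    using that by (rule C.\<iota>_hunit)
qed

text \<open>The universal property of base change for Hopf algebras: a morphism out of
  \<open>H\<close> that is semilinear over \<open>\<tau> \<circ> j\<close> extends over the new
  scalars.\<close>

lemma lift_hopf_hom:
  assumes \<psi>: "pre_hopf_hom k H m C (\<lambda>c. \<tau> (j c)) \<psi>" and \<tau>: "\<tau> \<in> ring_hom S m"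
  shows "pre_hopf_hom S B m C \<tau> (tensor_lift (hring C) \<psi> (\<lambda>s. hunit C (\<tau> s)))"
proof (rule generating_hopf_hom.hopf_hom_from_generators[OF base_change_hom _ \<tau>])
  note compat = lift_compat[OF \<psi> \<tau>]
  show "pre_hopf_hom k H m C (\<lambda>c. \<tau> (j c)) (\<lambda>a. tensor_lift (hring C) \<psi> (\<lambda>s. hunit C (\<tau> s)) (\<iota> a))"
    by (rule pre_hopf_hom_cong[OF \<psi> refl bc.tensor_lift_left[OF compat]])
  show "tensor_lift (hring C) \<psi> (\<lambda>s. hunit C (\<tau> s)) \<in> ring_hom (hring B) (hring C)"
    using bc.tensor_lift_ring_hom[OF compat] by simp
  show "tensor_lift (hring C) \<psi> (\<lambda>s. hunit C (\<tau> s)) (hunit B c) = hunit C (\<tau> c)"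
    if "c \<in> carrier S" for c
    using bc.tensor_lift_right[OF compat that] by simp
qed

end

text \<open>\<open>\<psi>\<close> followed by \<open>a \<mapsto> a \<otimes> 1\<close> is semilinear
  over \<open>j' \<circ> \<tau>0 = \<tau> \<circ> j\<close>; its extension to the base change is
  \<open>\<psi> \<otimes> \<tau>\<close> by definition of \<open>tensor_map\<close>.\<close>

lemma base_change_map_hopf_hom:
  assumes H: "hopf_scalar_extension k H S j" and H': "hopf_scalar_extension k' H' S' j'"
    and \<psi>: "pre_hopf_hom k H k' H' \<tau>0 \<psi>" and \<tau>: "\<tau> \<in> ring_hom S S'"
    and eq: "\<And>c. c \<in> carrier k \<Longrightarrow> \<tau> (j c) = j' (\<tau>0 c)"
  shows "pre_hopf_hom S (hopf_base_change k H S j) S' (hopf_base_change k' H' S' j') \<tau>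
    (tensor_map k' (hunit H') (hring H') j' S' \<psi> \<tau>)"
proof -
  interpret hopf_scalar_extension k H S j by fact
  interpret H': hopf_scalar_extension k' H' S' j' by fact
  have "pre_hopf_hom k H S' H'.B (\<lambda>c. j' (\<tau>0 c)) (\<lambda>a. H'.\<iota> (\<psi> a))"
    by (rule hopf_hom_comp[OF \<psi> generating_hopf_hom.axioms(1)[OF H'.base_change_hom]])
  then have "pre_hopf_hom k H S' H'.B (\<lambda>c. \<tau> (j c)) (\<lambda>a. H'.\<iota> (\<psi> a))"
    by (rule pre_hopf_hom_cong) (simp_all add: eq)
  from lift_hopf_hom[OF this \<tau>] show ?thesis
    by (simp add: tensor_map_def H'.B_simps)
qed


section \<open>Products\<close>

lemma RDirProd_simps:
  "(a, b) \<otimes>\<^bsub>RDirProd R S\<^esub> (c, d) = (a \<otimes>\<^bsub>R\<^esub> c, b \<otimes>\<^bsub>S\<^esub> d)"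
  "(a, b) \<oplus>\<^bsub>RDirProd R S\<^esub> (c, d) = (a \<oplus>\<^bsub>R\<^esub> c, b \<oplus>\<^bsub>S\<^esub> d)"
  "\<one>\<^bsub>RDirProd R S\<^esub> = (\<one>\<^bsub>R\<^esub>, \<one>\<^bsub>S\<^esub>)" "\<zero>\<^bsub>RDirProd R S\<^esub> = (\<zero>\<^bsub>R\<^esub>, \<zero>\<^bsub>S\<^esub>)"
  "carrier (RDirProd R S) = carrier R \<times> carrier S"
  by (simp_all add: RDirProd_def DirProd_def monoid.defs)

lemma RDirProd_cring:
  assumes "cring R" "cring S"
  shows "cring (RDirProd R S)"
proof -
  interpret R: cring R by fact
  interpret S: cring S by fact
  interpret P: ring "RDirProd R S" by (rule RDirProd_ring[OF R.ring_axioms S.ring_axioms])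
  show ?thesis
    by (intro cring.intro P.ring_axioms P.monoid_comm_monoidI)
      (auto simp: RDirProd_simps R.m_comm S.m_comm)
qed

lemma map_prod_ring_hom:
  assumes "f \<in> ring_hom R R'" "g \<in> ring_hom S S'"
  shows "map_prod f g \<in> ring_hom (RDirProd R S) (RDirProd R' S')"
  using assms by (auto simp: ring_hom_def RDirProd_simps Pi_iff)

lemma diag_ring_hom: "(\<lambda>a. (a, a)) \<in> ring_hom R (RDirProd R R)"
  by (auto simp: ring_hom_def RDirProd_simps)

section \<open>The product of two copies of a Hopf algebra\<close>

context pre_hopf
begin

interpretation k: cring k by (rule k_cring)
interpretation A: cring "hring H" by (rule A_cring)
interpretation T: cring sq.T by (rule sq.T_cring)

abbreviation (input) "P \<equiv> hopf_prod k k H H"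
abbreviation (input) "k2 \<equiv> RDirProd k k"
abbreviation (input) "A2 \<equiv> RDirProd (hring H) (hring H)"
abbreviation (input) "u2 \<equiv> map_prod (hunit H) (hunit H)"
abbreviation (input) "e1 \<equiv> \<lambda>a. (a, \<zero>\<^bsub>hring H\<^esub>)"
abbreviation (input) "e2 \<equiv> \<lambda>b. (\<zero>\<^bsub>hring H\<^esub>, b)"

interpretation psq: tensor_product k2 u2 A2 u2 A2
  by (intro tensor_product.intro RDirProd_cring k_cring A_cring map_prod_ring_hom hunit)

interpretation A2: cring A2 by (rule psq.R_cring)
interpretation PT: cring psq.T by (rule psq.T_cring)

lemma P_simps: "hring P = A2" "hunit P = u2"
  "comul P = (\<lambda>(a, b). tensor_map k2 u2 A2 u2 A2 e1 e1 (comul H a) \<oplus>\<^bsub>psq.T\<^esub>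
     tensor_map k2 u2 A2 u2 A2 e2 e2 (comul H b))"
  "counit P = map_prod (counit H) (counit H)" "antipode P = map_prod (antipode H) (antipode H)"
  by (simp_all add: hopf_prod_def Let_def)

lemma A2_simps: "carrier A2 = carrier (hring H) \<times> carrier (hring H)"
  "(a, b) \<otimes>\<^bsub>A2\<^esub> (c, d) = (a \<otimes>\<^bsub>hring H\<^esub> c, b \<otimes>\<^bsub>hring H\<^esub> d)"
  "(a, b) \<oplus>\<^bsub>A2\<^esub> (c, d) = (a \<oplus>\<^bsub>hring H\<^esub> c, b \<oplus>\<^bsub>hring H\<^esub> d)"
  "\<one>\<^bsub>A2\<^esub> = (\<one>\<^bsub>hring H\<^esub>, \<one>\<^bsub>hring H\<^esub>)" "\<zero>\<^bsub>A2\<^esub> = (\<zero>\<^bsub>hring H\<^esub>, \<zero>\<^bsub>hring H\<^esub>)"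
  by (simp_all add: RDirProd_simps)

lemma hunit_zero: "hunit H \<zero>\<^bsub>k\<^esub> = \<zero>\<^bsub>hring H\<^esub>"
  by (rule nonunital_hom_zero[OF k_ring A_ring ring_hom_nonunital[OF hunit]])

lemma hunit_one: "hunit H \<one>\<^bsub>k\<^esub> = \<one>\<^bsub>hring H\<^esub>"
  by (rule ring_hom_one[OF hunit])

text \<open>The idempotent \<open>(1, 0)\<close> of \<open>k \<times> k\<close> fixes
  \<open>e1 a\<close> and kills \<open>e2 b\<close>; being a scalar, it may be applied on either
  side of the tensor sign. \<open>(0, 1)\<close> does the same for the other order.\<close>

lemma psq_cross:
  assumes "a \<in> carrier (hring H)" "b \<in> carrier (hring H)"
  shows "psq.t (e1 a) (e2 b) = \<zero>\<^bsub>psq.T\<^esub>" "psq.t (e2 a) (e1 b) = \<zero>\<^bsub>psq.T\<^esub>"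
proof -
  have "psq.t (u2 (\<one>\<^bsub>k\<^esub>, \<zero>\<^bsub>k\<^esub>) \<otimes>\<^bsub>A2\<^esub> e1 a) (e2 b) = psq.t (e1 a) (u2 (\<one>\<^bsub>k\<^esub>, \<zero>\<^bsub>k\<^esub>) \<otimes>\<^bsub>A2\<^esub> e2 b)"
    using assms by (intro psq.pure_balanced) (simp_all add: RDirProd_simps)
  then show "psq.t (e1 a) (e2 b) = \<zero>\<^bsub>psq.T\<^esub>"
    using assms psq.pure_zero_right[of "e1 a"] by (simp add: A2_simps hunit_zero hunit_one)
  have "psq.t (u2 (\<zero>\<^bsub>k\<^esub>, \<one>\<^bsub>k\<^esub>) \<otimes>\<^bsub>A2\<^esub> e2 a) (e1 b) = psq.t (e2 a) (u2 (\<zero>\<^bsub>k\<^esub>, \<one>\<^bsub>k\<^esub>) \<otimes>\<^bsub>A2\<^esub> e1 b)"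
    using assms by (intro psq.pure_balanced) (simp_all add: RDirProd_simps)
  then show "psq.t (e2 a) (e1 b) = \<zero>\<^bsub>psq.T\<^esub>"
    using assms psq.pure_zero_right[of "e2 a"] by (simp add: A2_simps hunit_zero hunit_one)
qed

text \<open>After expanding both arguments the mixed terms drop out. This is the splitting of the
  tensor square of a product into the two tensor squares.\<close>

lemma psq_pure_decomp:
  assumes "a \<in> carrier (hring H)" "a' \<in> carrier (hring H)" "b \<in> carrier (hring H)" "b' \<in> carrier (hring H)"
  shows "psq.t (a, a') (b, b') = psq.t (e1 a) (e1 b) \<oplus>\<^bsub>psq.T\<^esub> psq.t (e2 a') (e2 b')"
proof -
  have split: "psq.t (a, a') z = psq.t (e1 a) z \<oplus>\<^bsub>psq.T\<^esub> psq.t (e2 a') z"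
    if "z \<in> carrier A2" for z
    using psq.pure_add_left[of "e1 a" "e2 a'" z] that assms by (simp add: A2_simps)
  have split1: "psq.t (e1 a) (b, b') = psq.t (e1 a) (e1 b)"
    using psq.pure_add_right[of "e1 a" "e1 b" "e2 b'"] assms psq_cross psq.pure_closed[of "e1 a" "e1 b"]
    by (simp add: A2_simps)
  have split2: "psq.t (e2 a') (b, b') = psq.t (e2 a') (e2 b')"
    using psq.pure_add_right[of "e2 a'" "e1 b" "e2 b'"] assms psq_cross psq.pure_closed[of "e2 a'" "e2 b'"]
    by (simp add: A2_simps)
  show ?thesis using split[of "(b, b')"] assms by (simp add: split1 split2 A2_simps)
qed

lemma e_nonunital: "e1 \<in> nonunital_hom (hring H) A2" "e2 \<in> nonunital_hom (hring H) A2"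
  by (auto simp: nonunital_hom_def A2_simps)

text \<open>\<open>balanced_homI\<close> does not apply because \<open>e\<close> is not unital.
  Scalars act on the image of \<open>e\<close> through \<open>(c, c)\<close>, so balancedness over
  \<open>k\<close> is the relation over \<open>k \<times> k\<close> at diagonal scalars.\<close>

lemma e_balanced:
  assumes e: "e = e1 \<or> e = e2"
  shows "sq.balanced psq.T (\<lambda>a. psq.t (e a) \<one>\<^bsub>A2\<^esub>) (\<lambda>b. psq.t \<one>\<^bsub>A2\<^esub> (e b))"
  unfolding sq.balanced_def
proof (intro conjI ballI)
  have e_hom: "e \<in> nonunital_hom (hring H) A2" using e e_nonunital by auto
  show "(\<lambda>a. psq.t (e a) \<one>\<^bsub>A2\<^esub>) \<in> nonunital_hom (hring H) psq.T"
    by (rule nonunital_hom_comp[OF e_hom ring_hom_nonunital[OF psq.pure_left_hom]])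
  show "(\<lambda>b. psq.t \<one>\<^bsub>A2\<^esub> (e b)) \<in> nonunital_hom (hring H) psq.T"
    by (rule nonunital_hom_comp[OF e_hom ring_hom_nonunital[OF psq.pure_right_hom]])
  fix c a b assume *: "c \<in> carrier k" "a \<in> carrier (hring H)" "b \<in> carrier (hring H)"
  have ec: "e x \<in> carrier A2" if "x \<in> carrier (hring H)" for x
    using nonunital_hom_closed[OF e_hom that] .
  have scal: "e (hunit H c \<otimes>\<^bsub>hring H\<^esub> x) = u2 (c, c) \<otimes>\<^bsub>A2\<^esub> e x" if "x \<in> carrier (hring H)" for x
    using e that * by (auto simp: A2_simps)
  have "psq.t (u2 (c, c) \<otimes>\<^bsub>A2\<^esub> e a) (e b) = psq.t (e a) (u2 (c, c) \<otimes>\<^bsub>A2\<^esub> e b)"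
    using * ec by (intro psq.pure_balanced) (simp_all add: RDirProd_simps(5))
  moreover have "psq.t x y = psq.t x \<one>\<^bsub>A2\<^esub> \<otimes>\<^bsub>psq.T\<^esub> psq.t \<one>\<^bsub>A2\<^esub> y"
    if "x \<in> carrier A2" "y \<in> carrier A2" for x y by (rule psq.pure_split[OF that])
  moreover have "u2 (c, c) \<otimes>\<^bsub>A2\<^esub> e x \<in> carrier A2" if "x \<in> carrier (hring H)" for x
    using ec[of "hunit H c \<otimes>\<^bsub>hring H\<^esub> x"] that * by (simp only: scal A.m_closed hunit_closed)
  ultimately show "psq.t (e (hunit H c \<otimes>\<^bsub>hring H\<^esub> a)) \<one>\<^bsub>A2\<^esub> \<otimes>\<^bsub>psq.T\<^esub> psq.t \<one>\<^bsub>A2\<^esub> (e b) =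
      psq.t (e a) \<one>\<^bsub>A2\<^esub> \<otimes>\<^bsub>psq.T\<^esub> psq.t \<one>\<^bsub>A2\<^esub> (e (hunit H c \<otimes>\<^bsub>hring H\<^esub> b))"
    using * ec by (simp only: scal)
qed (rule psq.T_cring)

abbreviation (input) "E1 \<equiv> tensor_map k2 u2 A2 u2 A2 e1 e1"
abbreviation (input) "E2 \<equiv> tensor_map k2 u2 A2 u2 A2 e2 e2"

lemma E_hom: "E1 \<in> nonunital_hom sq.T psq.T" "E2 \<in> nonunital_hom sq.T psq.T"
  unfolding tensor_map_def by (rule sq.tensor_lift_nonunital_hom e_balanced disjI1 disjI2 refl)+

lemma E_closed: "z \<in> carrier sq.T \<Longrightarrow> E1 z \<in> carrier psq.T" "z \<in> carrier sq.T \<Longrightarrow> E2 z \<in> carrier psq.T"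
  using nonunital_hom_closed[OF E_hom(1)] nonunital_hom_closed[OF E_hom(2)] by auto

lemma E_pure:
  assumes "a \<in> carrier (hring H)" "b \<in> carrier (hring H)"
  shows "E1 (sq.t a b) = psq.t (e1 a) (e1 b)" "E2 (sq.t a b) = psq.t (e2 a) (e2 b)"
proof -
  have "E1 (sq.t a b) = psq.t (e1 a) \<one>\<^bsub>A2\<^esub> \<otimes>\<^bsub>psq.T\<^esub> psq.t \<one>\<^bsub>A2\<^esub> (e1 b)"
    unfolding tensor_map_def by (rule sq.tensor_lift_pure[OF e_balanced assms]) simp
  also have "\<dots> = psq.t (e1 a) (e1 b)"
    using assms by (intro psq.pure_split[symmetric]) (simp_all add: A2_simps)
  finally show "E1 (sq.t a b) = psq.t (e1 a) (e1 b)" .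
  have "E2 (sq.t a b) = psq.t (e2 a) \<one>\<^bsub>A2\<^esub> \<otimes>\<^bsub>psq.T\<^esub> psq.t \<one>\<^bsub>A2\<^esub> (e2 b)"
    unfolding tensor_map_def by (rule sq.tensor_lift_pure[OF e_balanced assms]) simp
  also have "\<dots> = psq.t (e2 a) (e2 b)"
    using assms by (intro psq.pure_split[symmetric]) (simp_all add: A2_simps)
  finally show "E2 (sq.t a b) = psq.t (e2 a) (e2 b)" .
qed

text \<open>Pure tensors multiply factorwise and \<open>(a, 0) \<cdot> (0, c) = 0\<close>;
  additivity in both arguments gives the rest.\<close>

lemma E_cross:
  assumes x: "x \<in> carrier sq.T" and y: "y \<in> carrier sq.T"
  shows "E1 x \<otimes>\<^bsub>psq.T\<^esub> E2 y = \<zero>\<^bsub>psq.T\<^esub>"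
  using x
proof (induction x rule: sq.tensor_induct)
  case (pure a b)
  from y show ?case
  proof (induction y rule: sq.tensor_induct)
    case (pure c d)
    then have "psq.t (e1 a) (e1 b) \<otimes>\<^bsub>psq.T\<^esub> psq.t (e2 c) (e2 d) = psq.t \<zero>\<^bsub>A2\<^esub> \<zero>\<^bsub>A2\<^esub>"
      using \<open>a \<in> _\<close> \<open>b \<in> _\<close> by (subst psq.pure_mult) (simp_all add: A2_simps)
    then show ?case
      using pure \<open>a \<in> _\<close> \<open>b \<in> _\<close> by (simp only: E_pure psq.pure_zero_left A2.zero_closed)
  next
    case (add x y)
    then show ?case
      using E_closed sq.pure_closed[OF \<open>a \<in> _\<close> \<open>b \<in> _\<close>] by (simp add: nonunital_hom_add[OF E_hom(2)] PT.r_distr)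
  qed
next
  case (add x x')
  then show ?case
    using E_closed y by (simp add: nonunital_hom_add[OF E_hom(1)] PT.l_distr)
qed

lemma comul_P: "comul P (a, b) = E1 (comul H a) \<oplus>\<^bsub>psq.T\<^esub> E2 (comul H b)"
  by (simp add: P_simps)

text \<open>\<open>E1\<close> and \<open>E2\<close> are multiplicative and annihilate each other, so
  the glued map is multiplicative. It preserves the unit because \<open>1 \<otimes> 1\<close> is the
  sum of its two pieces.\<close>

lemma comul_P_hom: "comul P \<in> ring_hom A2 psq.T"
proof (rule ring_hom_memI)
  fix x assume "x \<in> carrier A2"
  then show "comul P x \<in> carrier psq.T"
    by (cases x) (simp add: A2_simps comul_P E_closed)
next
  fix x y assume "x \<in> carrier A2" "y \<in> carrier A2"
  then obtain a b c d where xy: "x = (a, b)" "y = (c, d)" and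
    cl: "a \<in> carrier (hring H)" "b \<in> carrier (hring H)" "c \<in> carrier (hring H)" "d \<in> carrier (hring H)"
    by (auto simp: A2_simps)
  have E: "E1 (comul H a) \<in> carrier psq.T" "E2 (comul H b) \<in> carrier psq.T"
    "E1 (comul H c) \<in> carrier psq.T" "E2 (comul H d) \<in> carrier psq.T"
    using cl by (simp_all add: E_closed)
  have cross: "E1 (comul H a) \<otimes>\<^bsub>psq.T\<^esub> E2 (comul H d) = \<zero>\<^bsub>psq.T\<^esub>"
    "E2 (comul H b) \<otimes>\<^bsub>psq.T\<^esub> E1 (comul H c) = \<zero>\<^bsub>psq.T\<^esub>"
    using cl E_cross[of "comul H a" "comul H d"] E_cross[of "comul H c" "comul H b"] E
    by (simp_all add: PT.m_comm)
  have "comul P (x \<otimes>\<^bsub>A2\<^esub> y) = E1 (comul H a) \<otimes>\<^bsub>psq.T\<^esub> E1 (comul H c) \<oplus>\<^bsub>psq.T\<^esub>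
      E2 (comul H b) \<otimes>\<^bsub>psq.T\<^esub> E2 (comul H d)"
    using cl unfolding xy A2_simps comul_P
    by (simp add: ring_hom_mult[OF comul] nonunital_hom_mult[OF E_hom(1)] nonunital_hom_mult[OF E_hom(2)])
  also have "\<dots> = comul P x \<otimes>\<^bsub>psq.T\<^esub> comul P y"
    using E unfolding xy comul_P by (simp add: PT.l_distr PT.r_distr cross)
  finally show "comul P (x \<otimes>\<^bsub>A2\<^esub> y) = comul P x \<otimes>\<^bsub>psq.T\<^esub> comul P y" .
  show "comul P (x \<oplus>\<^bsub>A2\<^esub> y) = comul P x \<oplus>\<^bsub>psq.T\<^esub> comul P y"
    using cl E unfolding xy A2_simps comul_P
    by (simp add: ring_hom_add[OF comul] nonunital_hom_add[OF E_hom(1)] nonunital_hom_add[OF E_hom(2)] PT.a_ac)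
next
  show "comul P \<one>\<^bsub>A2\<^esub> = \<one>\<^bsub>psq.T\<^esub>"
    by (simp add: A2_simps comul_P ring_hom_one[OF comul] sq.pure_one E_pure psq.pure_one psq_pure_decomp[symmetric])
qed

text \<open>On a pure tensor the right-hand side is \<open>(a, a) \<otimes> (b, b)\<close>, and the
  left-hand side is its splitting into two pieces.\<close>

lemma comul_P_diag:
  assumes "a \<in> carrier (hring H)"
  shows "comul P (a, a) = tensor_map k2 u2 A2 u2 A2 (\<lambda>a. (a, a)) (\<lambda>a. (a, a)) (comul H a)"
proof -
  interpret diag: tensor_product_map k "hunit H" "hring H" "hunit H" "hring H" k2 u2 A2 u2 A2
    "\<lambda>c. (c, c)" "\<lambda>a. (a, a)" "\<lambda>a. (a, a)"
    by (intro tensor_product_map.intro tensor_product_map_axioms.intro sq.tensor_product_axioms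
        psq.tensor_product_axioms diag_ring_hom) (simp_all add: RDirProd_simps)
  have "E1 z \<oplus>\<^bsub>psq.T\<^esub> E2 z = tensor_map k2 u2 A2 u2 A2 (\<lambda>a. (a, a)) (\<lambda>a. (a, a)) z"
    if "z \<in> carrier sq.T" for z
    using that
  proof (rule sq.additive_tensor_eqI[where D = psq.T])
    fix x y assume "x \<in> carrier sq.T" "y \<in> carrier sq.T"
    then show "E1 (x \<oplus>\<^bsub>sq.T\<^esub> y) \<oplus>\<^bsub>psq.T\<^esub> E2 (x \<oplus>\<^bsub>sq.T\<^esub> y) =
        E1 x \<oplus>\<^bsub>psq.T\<^esub> E2 x \<oplus>\<^bsub>psq.T\<^esub> (E1 y \<oplus>\<^bsub>psq.T\<^esub> E2 y)"
      using E_closed by (simp add: nonunital_hom_add[OF E_hom(1)] nonunital_hom_add[OF E_hom(2)] PT.a_ac)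
    show "tensor_map k2 u2 A2 u2 A2 (\<lambda>a. (a, a)) (\<lambda>a. (a, a)) (x \<oplus>\<^bsub>sq.T\<^esub> y) =
      tensor_map k2 u2 A2 u2 A2 (\<lambda>a. (a, a)) (\<lambda>a. (a, a)) x \<oplus>\<^bsub>psq.T\<^esub>
      tensor_map k2 u2 A2 u2 A2 (\<lambda>a. (a, a)) (\<lambda>a. (a, a)) y"
      using \<open>x \<in> _\<close> \<open>y \<in> _\<close> by (rule ring_hom_add[OF diag.tensor_map_hom])
  next
    fix a b assume "a \<in> carrier (hring H)" "b \<in> carrier (hring H)"
    then show "E1 (sq.t a b) \<oplus>\<^bsub>psq.T\<^esub> E2 (sq.t a b) =
        tensor_map k2 u2 A2 u2 A2 (\<lambda>a. (a, a)) (\<lambda>a. (a, a)) (sq.t a b)"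
      by (simp add: E_pure diag.tensor_map_pure psq_pure_decomp[symmetric])
  qed
  then show ?thesis using assms by (simp add: comul_P)
qed

lemma pre_hopf_prod: "pre_hopf k2 P"
proof (rule pre_hopf.intro)
  show "cring k2" "cring (hring P)" by (simp_all add: P_simps psq.k_cring psq.R_cring)
  show "hunit P \<in> ring_hom k2 (hring P)" "counit P \<in> ring_hom (hring P) k2"
    "antipode P \<in> ring_hom (hring P) (hring P)"
    unfolding P_simps by (rule map_prod_ring_hom hunit counit antipode)+
  show "comul P \<in> ring_hom (hring P) (hopf_sq k2 P)"
    using comul_P_hom by (simp only: P_simps(1,2))
  fix c assume "c \<in> carrier k2"
  then obtain c1 c2 where c: "c = (c1, c2)" "c1 \<in> carrier k" "c2 \<in> carrier k"
    by (auto simp: RDirProd_simps)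
  then show "counit P (hunit P c) = c" "antipode P (hunit P c) = hunit P c"
    by (simp_all add: P_simps counit_hunit antipode_hunit)
  show "comul P (hunit P c) = hopf_sq_unit k2 P c"
    using c by (simp add: P_simps(1,2) comul_P comul_hunit E_pure A2_simps psq_pure_decomp[symmetric])
qed

lemma diag_hom: "generating_hopf_hom k H k2 P (\<lambda>c. (c, c)) (\<lambda>a. (a, a))"
proof (intro generating_hopf_hom.intro generating_hopf_hom_axioms.intro pre_hopf_hom.intro
    pre_hopf_hom_axioms.intro pre_hopf_axioms pre_hopf_prod diag_ring_hom)
  show "(\<lambda>a. (a, a)) \<in> hopf_hom k k2 (\<lambda>c. (c, c)) H P"
    unfolding hopf_hom_def
    by (simp add: P_simps(1,2,4,5) comul_P_diag diag_ring_hom)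
  let ?G = "generate_ring A2 (u2 ` carrier k2 \<union> (\<lambda>a. (a, a)) ` carrier (hring H))"
  have "(a, b) \<in> ?G" if "a \<in> carrier (hring H)" "b \<in> carrier (hring H)" for a b
  proof -
    \<comment> \<open>\<open>(a, b) = (a, a) (1, 0) + (b, b) (0, 1)\<close>, with the idempotents
      taken from the scalars.\<close>
    have "(a, a) \<otimes>\<^bsub>A2\<^esub> u2 (\<one>\<^bsub>k\<^esub>, \<zero>\<^bsub>k\<^esub>) \<oplus>\<^bsub>A2\<^esub> (b, b) \<otimes>\<^bsub>A2\<^esub> u2 (\<zero>\<^bsub>k\<^esub>, \<one>\<^bsub>k\<^esub>) \<in> ?G"
      using that
      by (intro generate_ring.eng_add generate_ring.eng_mult generate_ring.incl UnI1[OF imageI] UnI2)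
        (auto simp: RDirProd_simps(5))
    then show ?thesis using that by (simp add: A2_simps hunit_one hunit_zero)
  qed
  then show "carrier (hring P) \<subseteq>
      generate_ring (hring P) (hunit P ` carrier k2 \<union> (\<lambda>a. (a, a)) ` carrier (hring H))"
    unfolding P_simps by (auto simp: A2_simps(1))
qed

end


section \<open>Rings of prime characteristic\<close>

lemma nonunital_hom_nat_multiple:
  assumes "ring R" "ring S" "h \<in> nonunital_hom R S" "x \<in> carrier R"
  shows "h ([(n::nat)] \<cdot>\<^bsub>R\<^esub> x) = [n] \<cdot>\<^bsub>S\<^esub> h x"
proof -
  interpret R: ring R by fact
  interpret S: ring S by fact
  show ?thesis
    by (induction n) (simp_all add: nonunital_hom_zero[OF assms(1-3)] nonunital_hom_add[OF assms(3)] assms(4))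
qed

lemma nonunital_hom_int_multiple:
  assumes "ring R" "ring S" "h \<in> nonunital_hom R S" "x \<in> carrier R"
  shows "h ([(n::int)] \<cdot>\<^bsub>R\<^esub> x) = [n] \<cdot>\<^bsub>S\<^esub> h x"
proof -
  interpret R: ring R by fact
  interpret S: ring S by fact
  show ?thesis
    using nonunital_hom_neg[OF assms(1-3), of "[nat (- n)] \<cdot>\<^bsub>R\<^esub> x"] assms(4)
    by (cases "n \<ge> 0") (simp_all add: add_pow_int_ge add_pow_int_lt nonunital_hom_nat_multiple[OF assms])
qed

lemma ring_hom_int_map:
  assumes "ring R" "ring S" "h \<in> ring_hom R S"
  shows "h (int_map R n) = int_map S n"
  using nonunital_hom_int_multiple[OF assms(1,2) ring_hom_nonunital[OF assms(3)] monoid.one_closed[OF ring.axioms(2)[OF assms(1)]]]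
  by (simp add: int_map_def ring_hom_one[OF assms(3)])

lemma ring_hom_nat_power:
  assumes "ring R" "ring S" "h \<in> ring_hom R S" "x \<in> carrier R"
  shows "h (x [^]\<^bsub>R\<^esub> (n::nat)) = h x [^]\<^bsub>S\<^esub> n"
proof -
  interpret R: ring R by fact
  show ?thesis
    by (induction n) (simp_all add: ring_hom_one[OF assms(3)] ring_hom_mult[OF assms(3)] assms(4))
qed

lemma char_p_ring_hom:
  assumes "char_p_ring p R" "cring S" "h \<in> ring_hom R S"
  shows "char_p_ring p S"
proof -
  interpret R: cring R using assms(1) by (simp add: char_p_ring_def)
  interpret S: cring S by fact
  note h = ring_hom_nonunital[OF assms(3)]
  have "h ([p] \<cdot>\<^bsub>R\<^esub> \<one>\<^bsub>R\<^esub>) = [p] \<cdot>\<^bsub>S\<^esub> \<one>\<^bsub>S\<^esub>"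
    by (simp add: nonunital_hom_nat_multiple[OF R.ring_axioms S.ring_axioms h] ring_hom_one[OF assms(3)])
  then show ?thesis
    using assms(1,2) by (simp add: char_p_ring_def nonunital_hom_zero[OF R.ring_axioms S.ring_axioms h])
qed

text \<open>Pascal's rule, after multiplying the inductive expansion by \<open>x\<close> and by
  \<open>y\<close> separately.\<close>

lemma (in cring) binomial:
  assumes x: "x \<in> carrier R" and y: "y \<in> carrier R"
  shows "(x \<oplus> y) [^] n = (\<Oplus>i\<in>{..n}. [(n choose i)] \<cdot> (x [^] i \<otimes> y [^] (n - i)))"
proof (induction n)
  case 0
  then show ?case using x y by simp
next
  case (Suc n)
  let ?f = "\<lambda>i. [(n choose i)] \<cdot> (x [^] i \<otimes> y [^] (n - i))"
  let ?g = "\<lambda>i. [(n choose i)] \<cdot> (x [^] i \<otimes> y [^] (Suc n - i))"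
  \<comment> \<open>The sum coming from the factor \<open>x\<close>, shifted by one. Its coefficient
    at \<open>i = 0\<close> is set to zero so that both sums run over
    \<open>{..Suc n}\<close>.\<close>
  let ?h = "\<lambda>i. [(if i = 0 then 0 else n choose (i - 1))] \<cdot> (x [^] i \<otimes> y [^] (Suc n - i))"
  have closed: "?f i \<in> carrier R" "?g i \<in> carrier R" "?h i \<in> carrier R" for i
    using x y by simp_all
  have fx: "?f i \<otimes> x = ?h (Suc i)" for i
    using x y by (simp add: m_ac add_pow_rdistr)
  have fy: "?f i \<otimes> y = ?g i" if "i \<le> n" for i
    using x y that by (simp add: add_pow_ldistr m_assoc Suc_diff_le)
  have "(x \<oplus> y) [^] Suc n = (\<Oplus>i\<in>{..n}. ?f i) \<otimes> x \<oplus> (\<Oplus>i\<in>{..n}. ?f i) \<otimes> y"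
    using x y closed by (simp add: Suc r_distr finsum_closed)
  also have "(\<Oplus>i\<in>{..n}. ?f i) \<otimes> x = (\<Oplus>i\<in>{..n}. ?h (Suc i))"
    using x closed by (subst finsum_ldistr) (auto simp: fx intro!: finsum_cong')
  also have "\<dots> = (\<Oplus>i\<in>{..Suc n}. ?h i)"
  proof -
    have "(\<Oplus>i\<in>{..n}. ?h (Suc i)) \<in> carrier R" using closed by (intro finsum_closed Pi_I)
    moreover have "?h 0 = \<zero>" using x y by simp
    moreover have "?h \<in> {..Suc n} \<rightarrow> carrier R" using closed by (intro Pi_I)
    ultimately show ?thesis by (simp only: finsum_Suc2 r_zero)
  qed
  also have "(\<Oplus>i\<in>{..n}. ?f i) \<otimes> y = (\<Oplus>i\<in>{..n}. ?g i)"
    using y closed by (subst finsum_ldistr) (auto simp: fy intro!: finsum_cong')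
  \<comment> \<open>The added index \<open>Suc n\<close> has coefficient
    \<open>n choose Suc n = 0\<close>.\<close>
  also have "\<dots> = (\<Oplus>i\<in>{..Suc n}. ?g i)"
    using closed by (subst finsum_Suc) (auto simp: binomial_eq_0)
  also have "(\<Oplus>i\<in>{..Suc n}. ?h i) \<oplus> (\<Oplus>i\<in>{..Suc n}. ?g i) = (\<Oplus>i\<in>{..Suc n}. ?h i \<oplus> ?g i)"
    using closed by (subst finsum_addf) auto
  also have "\<dots> = (\<Oplus>i\<in>{..Suc n}. [(Suc n choose i)] \<cdot> (x [^] i \<otimes> y [^] (Suc n - i)))"
  proof (intro finsum_cong' refl)
    fix i
    show "?h i \<oplus> ?g i = [(Suc n choose i)] \<cdot> (x [^] i \<otimes> y [^] (Suc n - i))"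
      using x y by (cases i) (simp_all add: add.nat_pow_mult)
  qed (use x y in auto)
  finally show ?case .
qed

lemma char_p_multiple_zero:
  assumes "char_p_ring p R" "p dvd n" "x \<in> carrier R"
  shows "[n] \<cdot>\<^bsub>R\<^esub> x = \<zero>\<^bsub>R\<^esub>"
proof -
  interpret cring R using assms(1) by (simp add: char_p_ring_def)
  obtain q where n: "n = p * q" using assms(2) by blast
  have "[n] \<cdot>\<^bsub>R\<^esub> x = [q] \<cdot>\<^bsub>R\<^esub> ([p] \<cdot>\<^bsub>R\<^esub> (\<one>\<^bsub>R\<^esub> \<otimes>\<^bsub>R\<^esub> x))"
    using assms(3) by (simp add: n add.nat_pow_pow)
  also have "\<dots> = \<zero>\<^bsub>R\<^esub>"
    using assms(1,3) by (simp add: add_pow_ldistr[symmetric] char_p_ring_def del: l_one)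
  finally show ?thesis .
qed

text \<open>The prime \<open>p\<close> divides every binomial coefficient strictly between the two
  ends, so only the terms for \<open>i = 0\<close> and \<open>i = p\<close> remain in the expansion
  of a sum.\<close>

lemma frobenius_hom:
  assumes p: "prime p" and R: "char_p_ring p R"
  shows "(\<lambda>x. x [^]\<^bsub>R\<^esub> p) \<in> ring_hom R R"
proof -
  interpret cring R using R by (simp add: char_p_ring_def)
  have add: "(x \<oplus>\<^bsub>R\<^esub> y) [^]\<^bsub>R\<^esub> p = x [^]\<^bsub>R\<^esub> p \<oplus>\<^bsub>R\<^esub> y [^]\<^bsub>R\<^esub> p"
    if x: "x \<in> carrier R" and y: "y \<in> carrier R" for x y
  proof -
    let ?f = "\<lambda>i. [(p choose i)] \<cdot>\<^bsub>R\<^esub> (x [^]\<^bsub>R\<^esub> i \<otimes>\<^bsub>R\<^esub> y [^]\<^bsub>R\<^esub> (p - i))"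
    have p0: "p \<noteq> 0" using p by (auto simp: prime_gt_0_nat)
    have "(x \<oplus>\<^bsub>R\<^esub> y) [^]\<^bsub>R\<^esub> p = (\<Oplus>\<^bsub>R\<^esub>i\<in>{..p}. ?f i)" by (rule binomial[OF x y])
    also have "\<dots> = (\<Oplus>\<^bsub>R\<^esub>i\<in>{p, 0}. ?f i)"
    proof (rule add.finprod_mono_neutral_cong_right)
      show "?f i = \<zero>\<^bsub>R\<^esub>" if "i \<in> {..p} - {p, 0}" for i
        using that p x y by (intro char_p_multiple_zero[OF R] dvd_choose_prime) auto
    qed (use x y in auto)
    also have "\<dots> = x [^]\<^bsub>R\<^esub> p \<oplus>\<^bsub>R\<^esub> y [^]\<^bsub>R\<^esub> p"
      using x y p0 by (simp add: finsum_insert)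
    finally show ?thesis .
  qed
  show ?thesis
    by (rule ring_hom_memI) (auto simp: add nat_pow_distrib)
qed

lemma RDirProd_nat_power:
  "(a, b) [^]\<^bsub>RDirProd R S\<^esub> (n::nat) = (a [^]\<^bsub>R\<^esub> n, b [^]\<^bsub>S\<^esub> n)"
  by (induction n) (simp_all add: RDirProd_simps)

lemma RDirProd_nat_multiple:
  "[(n::nat)] \<cdot>\<^bsub>RDirProd R S\<^esub> (a, b) = ([n] \<cdot>\<^bsub>R\<^esub> a, [n] \<cdot>\<^bsub>S\<^esub> b)"
  by (induction n) (simp_all add: RDirProd_simps add_pow_def nat_pow_def)

lemma char_p_ring_RDirProd:
  assumes "char_p_ring p R" "char_p_ring p S"
  shows "char_p_ring p (RDirProd R S)"
  using assms by (simp add: char_p_ring_def RDirProd_cring RDirProd_nat_multiple RDirProd_simps)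


section \<open>Prime fields\<close>

context
  fixes p :: nat
  assumes p: "prime p"
begin

interpretation Fp: residues_prime p "Fp p"
  using p by unfold_locales simp_all

lemma Fp_simps: "carrier (Fp p) = {0..int p - 1}" "x \<otimes>\<^bsub>Fp p\<^esub> y = x * y mod int p"
  "x \<oplus>\<^bsub>Fp p\<^esub> y = (x + y) mod int p" "\<one>\<^bsub>Fp p\<^esub> = 1" "\<zero>\<^bsub>Fp p\<^esub> = 0"
  by (simp_all add: residue_ring_def)

lemma Fp_cring: "cring (Fp p)"
  by (rule Fp.cring)

lemma Fp_multiple: "[(n::nat)] \<cdot>\<^bsub>Fp p\<^esub> 1 = int n mod int p"
proof (induction n)
  case 0
  then show ?case by (simp add: Fp_simps add_pow_def nat_pow_def)
next
  case (Suc n)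
  interpret cring "Fp p" by (rule Fp_cring)
  have "[(Suc n)] \<cdot>\<^bsub>Fp p\<^esub> 1 = [n] \<cdot>\<^bsub>Fp p\<^esub> 1 \<oplus>\<^bsub>Fp p\<^esub> 1" by simp
  then show ?case by (simp add: Suc Fp_simps mod_simps add_ac)
qed

lemma Fp_char_p: "char_p_ring p (Fp p)"
  using Fp_multiple[of p] by (simp add: char_p_ring_def Fp_cring Fp_simps(4,5))

text \<open>Fermat's little theorem; it is what makes \<open>(Fp p, id)\<close> a twisted
  ring.\<close>

lemma Fp_frobenius:
  assumes "x \<in> carrier (Fp p)"
  shows "x [^]\<^bsub>Fp p\<^esub> p = x"
proof -
  obtain a where a: "x = int a" "a < p"
    using assms zero_le_imp_eq_int[of x] by (auto simp: Fp_simps)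
  \<comment> \<open>The form \<open>a ^ (p - 1) = 1\<close> requires \<open>a\<close> to be prime to
    \<open>p\<close>, so multiples of \<open>p\<close> are treated apart.\<close>
  have "[a ^ p = a] (mod p)"
  proof (cases "p dvd a")
    case True
    then show ?thesis using dvd_trans[OF True dvd_power[of p a]] prime_gt_0_nat[OF p]
      by (simp add: cong_def)
  next
    case False
    then have "[a ^ (p - 1) * a = 1 * a] (mod p)" by (intro cong_mult fermat_theorem p) simp_all
    then show ?thesis using prime_gt_0_nat[OF p] by (simp add: power_Suc2[symmetric] del: power_Suc)
  qed
  then have "int a ^ p mod int p = int a mod int p"
    by (metis cong_def of_nat_mod of_nat_power)
  moreover have "x [^]\<^bsub>Fp p\<^esub> p = int a ^ p mod int p"
    using Fp.pow_cong[of "int a" p] a by simp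
  ultimately show ?thesis using a by simp
qed

text \<open>Elements of \<open>Fp p\<close> are the integers from \<open>0\<close> to
  \<open>p - 1\<close>, and its operations reduce modulo \<open>p\<close>. The map
  \<open>n \<mapsto> n \<cdot> 1\<close> is insensitive to this reduction because
  \<open>p \<cdot> 1 = 0\<close>.\<close>

lemma int_map_hom:
  assumes R: "char_p_ring p R"
  shows "int_map R \<in> ring_hom (Fp p) R"
proof -
  interpret cring R using R by (simp add: char_p_ring_def)
  have closed: "int_map R a \<in> carrier R" for a by (simp add: int_map_def add.int_pow_closed)
  have add: "int_map R (a + b) = int_map R a \<oplus>\<^bsub>R\<^esub> int_map R b" for a b
    by (simp add: int_map_def add.int_pow_mult)
  have mult: "int_map R (a * b) = int_map R a \<otimes>\<^bsub>R\<^esub> int_map R b" for a b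
  proof -
    have "int_map R a \<otimes>\<^bsub>R\<^esub> int_map R b = [a] \<cdot>\<^bsub>R\<^esub> ([b] \<cdot>\<^bsub>R\<^esub> \<one>\<^bsub>R\<^esub>)"
      using closed[of b] by (simp add: int_map_def add_pow_ldistr_int)
    then show ?thesis by (simp add: int_map_def add.int_pow_pow mult.commute)
  qed
  have "int_map R (int p) = \<zero>\<^bsub>R\<^esub>"
    using R by (simp add: int_map_def add_pow_int_ge char_p_ring_def)
  then have mod: "int_map R (a mod int p) = int_map R a" for a
    using add[of "int p * (a div int p)" "a mod int p"] mult[of "int p" "a div int p"] closed by simp
  have one: "int_map R 1 = \<one>\<^bsub>R\<^esub>"
    by (simp add: int_map_def add.int_pow_1)
  show ?thesis
    by (rule ring_hom_memI) (simp_all add: closed Fp_simps mod add mult one)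
qed

lemma is_twisted_ring_F_sqrt: "is_twisted_ring p (F_sqrt p)"
  by (simp add: is_twisted_ring_def F_sqrt_def Fp_char_p Fp_frobenius ring_hom_def)

text \<open>Ring morphisms preserve integer multiples of the unit, so \<open>endo Z\<close> fixes
  the image of the prime field, as compatibility with \<open>id\<close> demands.\<close>

lemma F_sqrt_algebra:
  assumes "is_twisted_ring p Z"
  shows "is_twisted_algebra p (F_sqrt p) Z (int_map (base Z))"
proof -
  have Z: "char_p_ring p (base Z)" "endo Z \<in> ring_hom (base Z) (base Z)"
    using assms by (simp_all add: is_twisted_ring_def)
  then have "ring (base Z)" by (simp add: char_p_ring_def cring.axioms)
  from ring_hom_int_map[OF this this Z(2)] show ?thesis
    using assms int_map_hom[OF Z(1)]
    by (simp add: is_twisted_algebra_def is_twisted_ring_F_sqrt[unfolded F_sqrt_def] twisted_hom_def F_sqrt_def)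
qed

end


section \<open>Twisted rings\<close>

lemma is_twisted_algebra_tensor:
  assumes "is_twisted_algebra p K Z s" "is_twisted_algebra p K L j"
  shows "tensor_product (base K) s (base Z) j (base L)"
  using assms
  by (intro tensor_product.intro)
    (simp_all add: is_twisted_algebra_def is_twisted_ring_def char_p_ring_def twisted_hom_def)

lemma twisted_endo_tensor_map:
  assumes Z: "is_twisted_algebra p K Z s" and L: "is_twisted_algebra p K L j"
  shows "tensor_product_map (base K) s (base Z) j (base L) (base K) s (base Z) j (base L)
    (endo K) (endo Z) (endo L)"
  using assms
  by (intro tensor_product_map.intro tensor_product_map_axioms.intro
      is_twisted_algebra_tensor[OF Z L])
    (auto simp: is_twisted_algebra_def is_twisted_ring_def twisted_hom_def intro: ring_hom_closed)

text \<open>The square of the tensored endomorphism and the Frobenius are both ring morphisms on the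
  tensor product, so they are compared on the two factors, where the axioms of \<open>Z\<close> and
  \<open>L\<close> apply.\<close>

lemma is_twisted_algebra_base_change:
  assumes p: "prime p" and Z: "is_twisted_algebra p K Z s" and L: "is_twisted_algebra p K L j"
  shows "is_twisted_algebra p L (twisted_base_change K Z s L j) (twisted_base_change_unit K Z s L j)"
proof -
  interpret tp: tensor_product "base K" s "base Z" j "base L"
    using Z L by (rule is_twisted_algebra_tensor)
  have K': "is_twisted_ring p K" and Z': "is_twisted_ring p Z" "s \<in> twisted_hom K Z"
    and L': "is_twisted_ring p L" "j \<in> twisted_hom K L"
    using Z L by (simp_all add: is_twisted_algebra_def)
  interpret endo: tensor_product_map "base K" s "base Z" j "base L" "base K" s "base Z" j "base L"
    "endo K" "endo Z" "endo L"
    using Z L by (rule twisted_endo_tensor_map)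
  interpret Zr: cring "base Z" by (rule tp.R_cring)
  interpret Lr: cring "base L" by (rule tp.S_cring)
  let ?e = "tensor_map (base K) s (base Z) j (base L) (endo Z) (endo L)"
  have char: "char_p_ring p tp.T"
    using Z'(1) by (intro char_p_ring_hom[OF _ tp.T_cring tp.pure_left_hom]) (simp add: is_twisted_ring_def)
  note closed = ring_hom_closed[OF endo.u] ring_hom_closed[OF endo.v]
  note one = ring_hom_one[OF endo.u] ring_hom_one[OF endo.v]
  have "?e (?e z) = z [^]\<^bsub>tp.T\<^esub> p" if z: "z \<in> carrier tp.T" for z
  proof (rule tp.ring_hom_tensor_eqI[OF z ring_hom_comp'[OF endo.tensor_map_hom endo.tensor_map_hom]
        frobenius_hom[OF p char]])
    fix a assume a: "a \<in> carrier (base Z)"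
    then show "?e (?e (tp.t a \<one>\<^bsub>base L\<^esub>)) = tp.t a \<one>\<^bsub>base L\<^esub> [^]\<^bsub>tp.T\<^esub> p"
      using Z'(1) ring_hom_nat_power[OF Zr.ring_axioms tp.T_ring tp.pure_left_hom a, of p]
      by (simp add: endo.tensor_map_pure closed one is_twisted_ring_def)
  next
    fix b assume b: "b \<in> carrier (base L)"
    then show "?e (?e (tp.t \<one>\<^bsub>base Z\<^esub> b)) = tp.t \<one>\<^bsub>base Z\<^esub> b [^]\<^bsub>tp.T\<^esub> p"
      using L'(1) ring_hom_nat_power[OF Lr.ring_axioms tp.T_ring tp.pure_right_hom b, of p]
      by (simp add: endo.tensor_map_pure closed one is_twisted_ring_def)
  qed
  moreover have "tp.t \<one>\<^bsub>base Z\<^esub> (endo L d) = ?e (tp.t \<one>\<^bsub>base Z\<^esub> d)" if "d \<in> carrier (base L)" for d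
    using that by (simp add: endo.tensor_map_pure one)
  moreover have "is_twisted_ring p (twisted_base_change K Z s L j)"
    using calculation(1) char endo.tensor_map_hom by (simp add: is_twisted_ring_def twisted_base_change_def)
  ultimately show ?thesis
    using L'(1) tp.pure_right_hom
    by (simp add: is_twisted_algebra_def twisted_base_change_def twisted_base_change_unit_def twisted_hom_def)
qed

lemma is_twisted_ring_of_mixed:
  assumes "is_mixed_ring p M"
  shows "is_twisted_ring p (twisted_of_mixed M)"
  using assms
  by (auto simp: is_mixed_ring_def is_twisted_ring_def twisted_of_mixed_def char_p_ring_RDirProd
      ring_hom_def RDirProd_simps RDirProd_nat_power Pi_iff)

lemma is_twisted_algebra_of_mixed:
  assumes "is_mixed_algebra p K M t1 t2"
  shows "is_twisted_algebra p (twisted_of_mixed K) (twisted_of_mixed M) (map_prod t1 t2)"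
proof -
  have M: "is_mixed_ring p K" "is_mixed_ring p M" "(t1, t2) \<in> mixed_hom K M"
    using assms by (simp_all add: is_mixed_algebra_def)
  moreover have "map_prod t1 t2 \<in> ring_hom (RDirProd (ring1 K) (ring2 K)) (RDirProd (ring1 M) (ring2 M))"
    using M(3) by (intro map_prod_ring_hom) (simp_all add: mixed_hom_def)
  ultimately show ?thesis
    using is_twisted_ring_of_mixed[OF M(1)] is_twisted_ring_of_mixed[OF M(2)]
    by (auto simp: is_twisted_algebra_def twisted_hom_def mixed_hom_def twisted_of_mixed_def RDirProd_simps)
qed

lemma is_mixed_ring_diag:
  "is_mixed_ring p \<lparr>ring1 = R, ring2 = R, map12 = \<phi>, map21 = \<phi>\<rparr> \<longleftrightarrow> is_twisted_ring p \<lparr>base = R, endo = \<phi>\<rparr>"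
  by (auto simp: is_mixed_ring_def is_twisted_ring_def)

lemma is_mixed_algebra_diag:
  assumes "is_twisted_algebra p \<lparr>base = k, endo = \<sigma>\<rparr> \<lparr>base = R, endo = \<phi>\<rparr> s"
  shows "is_mixed_algebra p \<lparr>ring1 = k, ring2 = k, map12 = \<sigma>, map21 = \<sigma>\<rparr>
    \<lparr>ring1 = R, ring2 = R, map12 = \<phi>, map21 = \<phi>\<rparr> s s"
  using assms by (auto simp: is_mixed_algebra_def is_twisted_algebra_def is_mixed_ring_diag
      twisted_hom_def mixed_hom_def)

lemma twisted_of_mixed_diag:
  "twisted_of_mixed \<lparr>ring1 = k, ring2 = k, map12 = \<sigma>, map21 = \<sigma>\<rparr> =
    \<lparr>base = RDirProd k k, endo = (\<lambda>(x, y). (\<sigma> y, \<sigma> x))\<rparr>"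
  by (simp add: twisted_of_mixed_def)

text \<open>The swap ring is the twisted ring of the mixed ring
  \<open>(k, k, \<sigma>, \<sigma>)\<close>, and swapping is invisible on the diagonal.\<close>

lemma diag_algebra:
  assumes "is_twisted_ring p \<lparr>base = k, endo = \<sigma>\<rparr>"
  shows "is_twisted_algebra p \<lparr>base = k, endo = \<sigma>\<rparr> \<lparr>base = RDirProd k k, endo = (\<lambda>(x, y). (\<sigma> y, \<sigma> x))\<rparr> (\<lambda>x. (x, x))"
  using assms is_twisted_ring_of_mixed[OF assms[folded is_mixed_ring_diag]]
  by (simp add: is_twisted_algebra_def twisted_of_mixed_diag twisted_hom_def diag_ring_hom)


section \<open>Base change along the diagonal\<close>

locale diagonal_base_change =
  fixes k :: "('c, 'l) ring_scheme" and R :: "('a, 'm) ring_scheme" and s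
  assumes k_cring: "cring k" and R_cring: "cring R" and s_hom: "s \<in> ring_hom k R"
begin

abbreviation (input) "k2 \<equiv> RDirProd k k"
abbreviation (input) "R2 \<equiv> RDirProd R R"

interpretation k: cring k by (rule k_cring)
interpretation R: cring R by (rule R_cring)
interpretation tp: tensor_product k s R "\<lambda>x. (x, x)" k2
  by (intro tensor_product.intro k_cring R_cring RDirProd_cring s_hom diag_ring_hom)
interpretation T: cring tp.T by (rule tp.T_cring)

definition to_prod where "to_prod = tensor_lift R2 (\<lambda>a. (a, a)) (map_prod s s)"
text \<open>The inverse of \<open>to_prod\<close>; the idempotents of \<open>k \<times> k\<close>
  keep the two coordinates apart.\<close>

definition of_prod where "of_prod z = tp.t (fst z) (\<one>\<^bsub>k\<^esub>, \<zero>\<^bsub>k\<^esub>) \<oplus>\<^bsub>tp.T\<^esub> tp.t (snd z) (\<zero>\<^bsub>k\<^esub>, \<one>\<^bsub>k\<^esub>)"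

lemma to_prod_compat:
  "cring R2" "(\<lambda>a. (a, a)) \<in> ring_hom R R2" "map_prod s s \<in> ring_hom k2 R2"
  "\<And>c. c \<in> carrier k \<Longrightarrow> (s c, s c) = map_prod s s (c, c)"
  by (rule RDirProd_cring R_cring diag_ring_hom map_prod_ring_hom s_hom)+ simp

lemma s_simps: "s \<zero>\<^bsub>k\<^esub> = \<zero>\<^bsub>R\<^esub>" "s \<one>\<^bsub>k\<^esub> = \<one>\<^bsub>R\<^esub>"
  by (rule nonunital_hom_zero[OF k.ring_axioms R.ring_axioms ring_hom_nonunital[OF s_hom]] ring_hom_one[OF s_hom])+

lemma to_prod_hom: "to_prod \<in> ring_hom tp.T R2"
  unfolding to_prod_def by (rule tp.tensor_lift_ring_hom[OF to_prod_compat])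

lemma to_prod_pure:
  assumes "a \<in> carrier R" "c \<in> carrier k" "d \<in> carrier k"
  shows "to_prod (tp.t a (c, d)) = (a \<otimes>\<^bsub>R\<^esub> s c, a \<otimes>\<^bsub>R\<^esub> s d)"
proof -
  have "tp.balanced R2 (\<lambda>a. (a, a)) (map_prod s s)" by (rule tp.balanced_homI[OF to_prod_compat])
  from tp.tensor_lift_pure[OF this, of a "(c, d)"] show ?thesis
    using assms by (simp add: to_prod_def RDirProd_simps)
qed

lemma of_prod_closed: "z \<in> carrier R2 \<Longrightarrow> of_prod z \<in> carrier tp.T"
  unfolding of_prod_def by (intro T.a_closed tp.pure_closed) (auto simp: RDirProd_simps)

lemma to_prod_of_prod:
  assumes z: "z \<in> carrier R2"
  shows "to_prod (of_prod z) = z"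
proof -
  have "tp.t (fst z) (\<one>\<^bsub>k\<^esub>, \<zero>\<^bsub>k\<^esub>) \<in> carrier tp.T" "tp.t (snd z) (\<zero>\<^bsub>k\<^esub>, \<one>\<^bsub>k\<^esub>) \<in> carrier tp.T"
    using z by (auto simp: RDirProd_simps intro!: tp.pure_closed)
  then show ?thesis
    using z by (auto simp: of_prod_def ring_hom_add[OF to_prod_hom] to_prod_pure s_simps RDirProd_simps)
qed

lemma of_prod_to_prod:
  assumes z: "z \<in> carrier tp.T"
  shows "of_prod (to_prod z) = z"
proof (rule tp.additive_tensor_eqI[OF z, where D = tp.T])
  have of_prod_add: "of_prod (x \<oplus>\<^bsub>R2\<^esub> y) = of_prod x \<oplus>\<^bsub>tp.T\<^esub> of_prod y"
    if "x \<in> carrier R2" "y \<in> carrier R2" for x y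
  proof -
    obtain a b c d where xy: "x = (a, b)" "y = (c, d)" "a \<in> carrier R" "b \<in> carrier R"
      "c \<in> carrier R" "d \<in> carrier R"
      using \<open>x \<in> _\<close> \<open>y \<in> _\<close> by (auto simp: RDirProd_simps)
    then show ?thesis
      by (simp add: of_prod_def RDirProd_simps tp.pure_add_left T.a_ac)
  qed
  fix x y assume "x \<in> carrier tp.T" "y \<in> carrier tp.T"
  then show "of_prod (to_prod (x \<oplus>\<^bsub>tp.T\<^esub> y)) = of_prod (to_prod x) \<oplus>\<^bsub>tp.T\<^esub> of_prod (to_prod y)"
    by (simp add: ring_hom_add[OF to_prod_hom] of_prod_add ring_hom_closed[OF to_prod_hom])
next
  fix a z assume a: "a \<in> carrier R" and "z \<in> carrier k2"
  then obtain c d where z: "z = (c, d)" "c \<in> carrier k" "d \<in> carrier k" by (auto simp: RDirProd_simps)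
  have sc: "s c \<in> carrier R" "s d \<in> carrier R" using z ring_hom_closed[OF s_hom] by auto
  have "of_prod (to_prod (tp.t a z)) = tp.t (s c \<otimes>\<^bsub>R\<^esub> a) (\<one>\<^bsub>k\<^esub>, \<zero>\<^bsub>k\<^esub>) \<oplus>\<^bsub>tp.T\<^esub> tp.t (s d \<otimes>\<^bsub>R\<^esub> a) (\<zero>\<^bsub>k\<^esub>, \<one>\<^bsub>k\<^esub>)"
    using a z sc by (simp add: to_prod_pure of_prod_def R.m_comm)
  \<comment> \<open>The scalar \<open>s c\<close> moves to the right factor as
    \<open>(c, c)\<close>, which the idempotent \<open>(1, 0)\<close> cuts down to
    \<open>(c, 0)\<close>; likewise for \<open>d\<close>.\<close>
  also have "\<dots> = tp.t a (c, \<zero>\<^bsub>k\<^esub>) \<oplus>\<^bsub>tp.T\<^esub> tp.t a (\<zero>\<^bsub>k\<^esub>, d)"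
    using a z by (simp add: tp.pure_balanced RDirProd_simps)
  also have "\<dots> = tp.t a z"
    using a z by (simp add: tp.pure_add_right[symmetric] RDirProd_simps)
  finally show "of_prod (to_prod (tp.t a z)) = tp.t a z" .
qed simp

lemma to_prod_bij: "bij_betw to_prod (carrier tp.T) (carrier R2)"
  by (rule bij_betw_byWitness[where f' = of_prod])
    (auto simp: of_prod_to_prod to_prod_of_prod of_prod_closed ring_hom_closed[OF to_prod_hom])

lemma to_prod_unit: "d \<in> carrier k2 \<Longrightarrow> to_prod (tp.t \<one>\<^bsub>R\<^esub> d) = map_prod s s d"
  unfolding to_prod_def by (rule tp.tensor_lift_right[OF to_prod_compat])

end

text \<open>Compatibility of \<open>to_prod\<close> with the endomorphisms is tested on the two
  factors: on \<open>R\<close> both sides duplicate \<open>\<phi> a\<close>, on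
  \<open>k \<times> k\<close> it is \<open>s \<circ> \<sigma> = \<phi> \<circ> s\<close>. It is a
  conclusion of its own because the correspondence for groups uses it again.\<close>

lemma
  assumes p: "prime p" and alg: "is_twisted_algebra p \<lparr>base = k, endo = \<sigma>\<rparr> \<lparr>base = R, endo = \<phi>\<rparr> s"
  defines "L \<equiv> \<lparr>base = RDirProd k k, endo = (\<lambda>(x, y). (\<sigma> y, \<sigma> x))\<rparr>"
  shows diagonal_base_change_hom: "diagonal_base_change.to_prod R s \<in>
      twisted_hom (twisted_base_change \<lparr>base = k, endo = \<sigma>\<rparr> \<lparr>base = R, endo = \<phi>\<rparr> s L (\<lambda>x. (x, x)))
        \<lparr>base = RDirProd R R, endo = (\<lambda>(x, y). (\<phi> y, \<phi> x))\<rparr>"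
    and diagonal_base_change_corresponds:
    "corresponds_mixed_algebra p \<lparr>ring1 = k, ring2 = k, map12 = \<sigma>, map21 = \<sigma>\<rparr>
    (twisted_base_change \<lparr>base = k, endo = \<sigma>\<rparr> \<lparr>base = R, endo = \<phi>\<rparr> s L (\<lambda>x. (x, x)))
    (twisted_base_change_unit \<lparr>base = k, endo = \<sigma>\<rparr> \<lparr>base = R, endo = \<phi>\<rparr> s L (\<lambda>x. (x, x)))
    \<lparr>ring1 = R, ring2 = R, map12 = \<phi>, map21 = \<phi>\<rparr> s s"
proof -
  let ?K = "\<lparr>base = k, endo = \<sigma>\<rparr>" and ?Z = "\<lparr>base = R, endo = \<phi>\<rparr>"
  let ?Y = "\<lparr>base = RDirProd R R, endo = (\<lambda>(x, y). (\<phi> y, \<phi> x))\<rparr>"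
  let ?B = "twisted_base_change ?K ?Z s L (\<lambda>x. (x, x))"
  have K: "is_twisted_ring p ?K" and Z: "is_twisted_ring p ?Z" and s: "s \<in> twisted_hom ?K ?Z"
    using alg by (simp_all add: is_twisted_algebra_def)
  have L: "is_twisted_algebra p ?K L (\<lambda>x. (x, x))" unfolding L_def by (rule diag_algebra[OF K])
  note mixed = is_mixed_algebra_diag[OF alg]
  have Y: "is_twisted_algebra p L ?Y (map_prod s s)"
    using is_twisted_algebra_of_mixed[OF mixed] by (simp add: twisted_of_mixed_diag L_def)
  have B: "is_twisted_algebra p L ?B (twisted_base_change_unit ?K ?Z s L (\<lambda>x. (x, x)))"
    by (rule is_twisted_algebra_base_change[OF p alg L])
  interpret diagonal_base_change k R s
    using K Z s by (intro diagonal_base_change.intro)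
      (simp_all add: is_twisted_ring_def char_p_ring_def twisted_hom_def)
  interpret tp: tensor_product k s R "\<lambda>x. (x, x)" "RDirProd k k"
    using is_twisted_algebra_tensor[OF alg L] by (simp add: L_def)
  interpret e: tensor_product_map k s R "\<lambda>x. (x, x)" "RDirProd k k" k s R "\<lambda>x. (x, x)" "RDirProd k k"
    \<sigma> \<phi> "\<lambda>(x, y). (\<sigma> y, \<sigma> x)"
    using twisted_endo_tensor_map[OF alg L] by (simp add: L_def)
  interpret k: cring k by (rule k_cring)
  interpret R: cring R by (rule R_cring)
  let ?e = "tensor_map k s R (\<lambda>x. (x, x)) (RDirProd k k) \<phi> (\<lambda>(x, y). (\<sigma> y, \<sigma> x))"
  have \<sigma>: "\<sigma> \<in> ring_hom k k" and \<phi>: "\<phi> \<in> ring_hom R R" and s\<sigma>: "\<And>c. c \<in> carrier k \<Longrightarrow> s (\<sigma> c) = \<phi> (s c)"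
    using K Z s by (simp_all add: is_twisted_ring_def twisted_hom_def)
  have endo: "to_prod (?e z) = (\<lambda>(x, y). (\<phi> y, \<phi> x)) (to_prod z)" if z: "z \<in> carrier tp.T" for z
  proof (rule tp.ring_hom_tensor_eqI[OF z ring_hom_comp'[OF e.tensor_map_hom to_prod_hom]
        ring_hom_comp'[OF to_prod_hom]])
    show "(\<lambda>(x, y). (\<phi> y, \<phi> x)) \<in> ring_hom (RDirProd R R) (RDirProd R R)"
      using Y by (simp add: is_twisted_algebra_def is_twisted_ring_def)
  next
    fix a assume a: "a \<in> carrier R"
    then show "to_prod (?e (tp.t a \<one>\<^bsub>RDirProd k k\<^esub>)) =
        (\<lambda>(x, y). (\<phi> y, \<phi> x)) (to_prod (tp.t a \<one>\<^bsub>RDirProd k k\<^esub>))"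
      using ring_hom_closed[OF \<phi>]
      by (simp add: e.tensor_map_pure RDirProd_simps ring_hom_one[OF \<sigma>] to_prod_pure s_simps)
  next
    fix b assume "b \<in> carrier (RDirProd k k)"
    then obtain c d where "b = (c, d)" "c \<in> carrier k" "d \<in> carrier k" by (auto simp: RDirProd_simps)
    then show "to_prod (?e (tp.t \<one>\<^bsub>R\<^esub> b)) = (\<lambda>(x, y). (\<phi> y, \<phi> x)) (to_prod (tp.t \<one>\<^bsub>R\<^esub> b))"
      using ring_hom_closed[OF \<sigma>] ring_hom_closed[OF \<phi>] ring_hom_closed[OF s_hom]
      by (simp add: e.tensor_map_pure RDirProd_simps ring_hom_one[OF \<phi>] to_prod_pure s\<sigma>)
  qed
  show hom: "to_prod \<in> twisted_hom ?B ?Y"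
    using to_prod_hom endo by (simp add: twisted_hom_def twisted_base_change_def L_def)
  have "bij_betw to_prod (carrier (base ?B)) (carrier (base ?Y))"
    using to_prod_bij by (simp add: twisted_base_change_def L_def)
  moreover have "to_prod (twisted_base_change_unit ?K ?Z s L (\<lambda>x. (x, x)) c) = map_prod s s c"
    if "c \<in> carrier (base L)" for c
    using that to_prod_unit by (simp add: twisted_base_change_unit_def L_def)
  ultimately have "twisted_algebra_isomorphic p L ?B
      (twisted_base_change_unit ?K ?Z s L (\<lambda>x. (x, x))) ?Y (map_prod s s)"
    using B Y hom by (auto simp: twisted_algebra_isomorphic_def)
  then show "corresponds_mixed_algebra p \<lparr>ring1 = k, ring2 = k, map12 = \<sigma>, map21 = \<sigma>\<rparr>
      ?B (twisted_base_change_unit ?K ?Z s L (\<lambda>x. (x, x)))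
      \<lparr>ring1 = R, ring2 = R, map12 = \<phi>, map21 = \<phi>\<rparr> s s"
    using mixed by (simp add: corresponds_mixed_algebra_def twisted_of_mixed_diag L_def)
qed

text \<open>The case \<open>k = Fp p\<close>, \<open>\<sigma> = id\<close> of the correspondence for
  algebras, as every twisted ring of characteristic \<open>p\<close> is an algebra over
  \<open>F_sqrt p\<close>.\<close>

lemma base_change_to_T_ring:
  assumes p: "prime p" and Z: "is_twisted_ring p \<lparr>base = R, endo = \<phi>\<rparr>"
  defines "B \<equiv> twisted_base_change (F_sqrt p) \<lparr>base = R, endo = \<phi>\<rparr> (int_map R) (T_ring p) (\<lambda>n. (n, n))"
    and "u \<equiv> twisted_base_change_unit (F_sqrt p) \<lparr>base = R, endo = \<phi>\<rparr> (int_map R) (T_ring p) (\<lambda>n. (n, n))"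
  shows "twisted_algebra_isomorphic p (T_ring p) B u
      \<lparr>base = RDirProd R R, endo = (\<lambda>(x, y). (\<phi> y, \<phi> x))\<rparr> (\<lambda>(m, n). (int_map R m, int_map R n))" (is ?iso)
    and "corresponds_mixed_ring p B u \<lparr>ring1 = R, ring2 = R, map12 = \<phi>, map21 = \<phi>\<rparr>"
proof -
  \<comment> \<open>Writing the swap with \<open>id\<close> exhibits \<open>T_ring p\<close> as the
    swap ring of \<open>(Fp p, id)\<close>.\<close>
  have T: "T_ring p = \<lparr>base = RDirProd (Fp p) (Fp p), endo = (\<lambda>(x, y). (id y, id x))\<rparr>"
    by (simp add: T_ring_def)
  have "corresponds_mixed_algebra p \<lparr>ring1 = Fp p, ring2 = Fp p, map12 = id, map21 = id\<rparr> B u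
      \<lparr>ring1 = R, ring2 = R, map12 = \<phi>, map21 = \<phi>\<rparr> (int_map R) (int_map R)"
    unfolding B_def u_def T F_sqrt_def
    using F_sqrt_algebra[OF p Z] by (intro diagonal_base_change_corresponds[OF p]) (simp add: F_sqrt_def)
  then have iso: "twisted_algebra_isomorphic p (T_ring p) B u
      \<lparr>base = RDirProd R R, endo = (\<lambda>(x, y). (\<phi> y, \<phi> x))\<rparr> (map_prod (int_map R) (int_map R))"
    by (simp add: corresponds_mixed_algebra_def twisted_of_mixed_diag T_ring_def)
  then show ?iso by (simp add: map_prod_def)
  show "corresponds_mixed_ring p B u \<lparr>ring1 = R, ring2 = R, map12 = \<phi>, map21 = \<phi>\<rparr>"
    using iso Z by (simp add: corresponds_mixed_ring_def is_mixed_ring_diag twisted_of_mixed_diag)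
qed


section \<open>Identity and transport\<close>

lemma (in tensor_product) tensor_map_id:
  assumes z: "z \<in> carrier T" and u: "\<And>a. a \<in> carrier R \<Longrightarrow> u a = a" and v: "\<And>b. b \<in> carrier S \<Longrightarrow> v b = b"
  shows "tensor_map k f R g S u v z = z"
proof -
  interpret id: tensor_product_map k f R g S k f R g S id id id
    by (intro tensor_product_map.intro tensor_product_map_axioms.intro tensor_product_axioms)
      (simp_all add: ring_hom_def)
  have bal: "balanced T (\<lambda>a. t (id a) \<one>\<^bsub>S\<^esub>) (\<lambda>b. t \<one>\<^bsub>R\<^esub> (id b))"
    by (rule balanced_homI[OF id.tensor_map_compat])
  have "tensor_map k f R g S u v z = tensor_map k f R g S id id z"
    unfolding tensor_map_def by (rule tensor_lift_cong[OF bal z]) (simp_all add: u v)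
  also have "\<dots> = id z"
    by (rule nonunital_hom_tensor_eqI[OF z ring_hom_nonunital[OF id.tensor_map_hom]])
      (auto simp: nonunital_hom_def id.tensor_map_pure)
  finally show ?thesis by simp
qed

lemma (in pre_hopf) pre_hopf_hom_id: "pre_hopf_hom k H k H id id"
proof (intro pre_hopf_hom.intro pre_hopf_hom_axioms.intro pre_hopf_axioms)
  show "id \<in> ring_hom k k" by (simp add: ring_hom_def)
  show "id \<in> hopf_hom k k id H H"
    using id_hom by (simp add: hopf_hom_def sq.tensor_map_id)
qed

text \<open>Only the relations moving a scalar across the tensor sign mention the base ring.
  Reindexing them along the bijection gives the same set, hence the same ideal and not just an
  isomorphic tensor product.\<close>

lemma tensor_base_bij:
  assumes "bij_betw f (carrier k) (carrier l)"
  shows "tensor_ideal l (\<lambda>d. u (inv_into (carrier k) f d)) R (\<lambda>d. v (inv_into (carrier k) f d)) S =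
    tensor_ideal k u R v S"
proof -
  have "inv_into (carrier k) f ` carrier l = carrier k"
    using assms by (intro bij_betw_imp_surj_on bij_betw_inv_into)
  then have bex: "(\<exists>c\<in>carrier k. Q c) \<longleftrightarrow> (\<exists>d\<in>carrier l. Q (inv_into (carrier k) f d))" for Q
    by (metis image_iff)
  have eq: "(\<exists>c a b. x = E (u c) a b (v c) \<and> c \<in> carrier k \<and> a \<in> carrier R \<and> b \<in> carrier S) \<longleftrightarrow>
      (\<exists>d a b. x = E (u (inv_into (carrier k) f d)) a b (v (inv_into (carrier k) f d)) \<and>
        d \<in> carrier l \<and> a \<in> carrier R \<and> b \<in> carrier S)" for E x
    using bex[of "\<lambda>c. \<exists>a b. x = E (u c) a b (v c) \<and> a \<in> carrier R \<and> b \<in> carrier S"] by blast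
  note eq[of _ "\<lambda>uc a b vc. basis_elt int_ring (uc \<otimes>\<^bsub>R\<^esub> a, b) \<ominus>\<^bsub>pre_tensor R S\<^esub> basis_elt int_ring (a, vc \<otimes>\<^bsub>S\<^esub> b)"]
  then show ?thesis by (simp add: tensor_ideal_def Let_def)
qed

locale hopf_transport_data = H: pre_hopf k H
  for k :: "('c, 'l) ring_scheme" and H :: "('c, 'a) hopf" +
  fixes l :: "('d, 'm) ring_scheme" and f :: "'c \<Rightarrow> 'd"
  assumes l_cring: "cring l" and f: "f \<in> ring_hom k l" and bij: "bij_betw f (carrier k) (carrier l)"
begin

abbreviation "B \<equiv> hopf_transport k f H"

lemma B_simps: "hring B = hring H" "hunit B = (\<lambda>d. hunit H (inv_into (carrier k) f d))"
  "comul B = comul H" "counit B = (\<lambda>a. f (counit H a))" "antipode B = antipode H"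
  by (simp_all add: hopf_transport_def)

text \<open>These are equalities, so the comultiplication of \<open>H\<close> can serve the
  transported Hopf algebra as it stands.\<close>

lemma hopf_sq_transport: "hopf_sq l B = hopf_sq k H" "hopf_pure l B = hopf_pure k H"
  unfolding B_simps tensor_def pure_def[abs_def] by (simp_all add: tensor_base_bij[OF bij])

lemma inv_closed: "d \<in> carrier l \<Longrightarrow> inv_into (carrier k) f d \<in> carrier k"
  using bij by (intro inv_into_into) (simp add: bij_betw_def)

lemma f_inv: "d \<in> carrier l \<Longrightarrow> f (inv_into (carrier k) f d) = d"
  using bij by (intro f_inv_into_f) (simp add: bij_betw_def)

lemma inv_f: "c \<in> carrier k \<Longrightarrow> inv_into (carrier k) f (f c) = c"
  using bij by (intro inv_into_f_f) (simp_all add: bij_betw_def)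

lemma inv_hom: "inv_into (carrier k) f \<in> ring_hom l k"
proof -
  have "f \<in> ring_iso k l" using f bij by (simp add: ring_iso_def)
  from ring_iso_set_sym[OF cring.axioms(1)[OF H.k_cring] this] show ?thesis
    by (simp add: ring_iso_def)
qed

lemma pre_hopf_transport: "pre_hopf l B"
proof (rule pre_hopf.intro)
  show "hunit B \<in> ring_hom l (hring B)"
    unfolding B_simps by (rule ring_hom_comp'[OF inv_hom H.hunit])
  show "comul B \<in> ring_hom (hring B) (hopf_sq l B)"
    unfolding hopf_sq_transport by (simp add: B_simps H.comul)
  show "counit B \<in> ring_hom (hring B) l"
    unfolding B_simps by (rule ring_hom_comp'[OF H.counit f])
  fix c assume c: "c \<in> carrier l"
  show "comul B (hunit B c) = hopf_sq_unit l B c"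
    unfolding hopf_sq_transport using c by (simp add: B_simps H.comul_hunit inv_closed)
  show "counit B (hunit B c) = c" "antipode B (hunit B c) = hunit B c"
    using c by (simp_all add: B_simps H.counit_hunit H.antipode_hunit inv_closed f_inv)
qed (simp_all add: l_cring B_simps H.A_cring H.antipode)

lemma transport_hom: "generating_hopf_hom k H l B f id"
proof (intro generating_hopf_hom.intro generating_hopf_hom_axioms.intro pre_hopf_hom.intro
    pre_hopf_hom_axioms.intro H.pre_hopf_axioms pre_hopf_transport f)
  have "hopf_sq_map l B id = hopf_sq_map k H id"
    unfolding tensor_map_def hopf_sq_transport by (simp only: B_simps)
  then show "id \<in> hopf_hom k l f H B"
    using H.id_hom by (simp add: hopf_hom_def B_simps H.sq.tensor_map_id inv_f)
qed (auto simp: B_simps intro: generate_ring.incl)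

end

lemma is_mixed_group_pre_hopf:
  assumes "is_mixed_group p M H" and "is_mixed_ring p M"
  shows "pre_hopf_hom (ring1 M) (hopf1 H) (ring2 M) (hopf2 H) (map12 M) (mmap12 H)"
    and "pre_hopf_hom (ring2 M) (hopf2 H) (ring1 M) (hopf1 H) (map21 M) (mmap21 H)"
  using assms
  by (auto simp: is_mixed_group_def is_mixed_ring_def
      intro!: pre_hopf_hom.intro pre_hopf_hom_axioms.intro is_hopf_pre_hopf)

text \<open>The identity is a generating morphism from \<open>H\<close> to its transport, so the
  claim reduces to \<open>h\<close> itself and a check on the new scalars.\<close>

lemma transport_semilinear_hom:
  assumes "hopf_transport_data k H l f" "hopf_transport_data k' H' l' f'"
    and h: "pre_hopf_hom k H k' H' \<tau> h" and \<tau>': "\<tau>' \<in> ring_hom l l'"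
    and eq: "\<And>c. c \<in> carrier k \<Longrightarrow> f' (\<tau> c) = \<tau>' (f c)"
  shows "pre_hopf_hom l (hopf_transport k f H) l' (hopf_transport k' f' H') \<tau>' h"
proof -
  interpret t: hopf_transport_data k H l f by fact
  interpret t': hopf_transport_data k' H' l' f' by fact
  interpret h: pre_hopf_hom k H k' H' \<tau> h by fact
  show ?thesis
  proof (rule generating_hopf_hom.hopf_hom_from_generators[OF t.transport_hom _ \<tau>'])
    show "pre_hopf_hom k H l' t'.B (\<lambda>c. \<tau>' (f c)) (\<lambda>a. h (id a))"
      by (rule pre_hopf_hom_cong[OF hopf_hom_comp[OF h generating_hopf_hom.axioms(1)[OF t'.transport_hom]]])
        (simp_all add: eq)
    show "h \<in> ring_hom (hring t.B) (hring t'.B)"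
      using h.\<iota>_hom by (simp add: t.B_simps t'.B_simps)
    fix d assume d: "d \<in> carrier l"
    \<comment> \<open>The scalar \<open>d\<close> is pulled back along \<open>f\<close>, where the
      commutation of \<open>f\<close>, \<open>f'\<close> with \<open>\<tau>\<close>,
      \<open>\<tau>'\<close> applies.\<close>
    have "\<tau>' d = f' (\<tau> (inv_into (carrier k) f d))"
      using d eq[of "inv_into (carrier k) f d"] by (simp add: t.inv_closed t.f_inv)
    then show "h (hunit t.B d) = hunit t'.B (\<tau>' d)"
      using d by (simp add: t.B_simps t'.B_simps t.inv_closed t'.inv_f h.\<iota>_hunit h.\<tau>_closed)
  qed
qed

text \<open>Rings and connecting maps stay the same, so the underlying mixed ring is kept literally.
  The connecting maps are semilinear for the new scalars because \<open>(f, g)\<close> commutes with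
  the maps of the base.\<close>

lemma is_mixed_group_transport:
  assumes M: "is_mixed_group p M H" and iso: "is_mixed_ring_iso p M N f g"
  shows "is_mixed_group p N (mixed_group_transport M f g H)"
proof -
  have fg: "is_mixed_ring p M" "is_mixed_ring p N" "(f, g) \<in> mixed_hom M N"
    "bij_betw f (carrier (ring1 M)) (carrier (ring1 N))" "bij_betw g (carrier (ring2 M)) (carrier (ring2 N))"
    using iso by (simp_all add: is_mixed_ring_iso_def)
  note h = is_mixed_group_pre_hopf[OF M fg(1)]
  interpret t1: hopf_transport_data "ring1 M" "hopf1 H" "ring1 N" f
    using fg pre_hopf_hom.axioms(1)[OF h(1)]
    by (intro hopf_transport_data.intro hopf_transport_data_axioms.intro)
      (simp_all add: is_mixed_ring_def char_p_ring_def mixed_hom_def)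
  interpret t2: hopf_transport_data "ring2 M" "hopf2 H" "ring2 N" g
    using fg pre_hopf_hom.axioms(1)[OF h(2)]
    by (intro hopf_transport_data.intro hopf_transport_data_axioms.intro)
      (simp_all add: is_mixed_ring_def char_p_ring_def mixed_hom_def)
  have h12: "pre_hopf_hom (ring1 N) t1.B (ring2 N) t2.B (map12 N) (mmap12 H)"
    using fg by (intro transport_semilinear_hom[OF t1.hopf_transport_data_axioms
        t2.hopf_transport_data_axioms h(1)]) (simp_all add: is_mixed_ring_def mixed_hom_def)
  have h21: "pre_hopf_hom (ring2 N) t2.B (ring1 N) t1.B (map21 N) (mmap21 H)"
    using fg by (intro transport_semilinear_hom[OF t2.hopf_transport_data_axioms
        t1.hopf_transport_data_axioms h(2)]) (simp_all add: is_mixed_ring_def mixed_hom_def)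
  interpret h12: pre_hopf_hom "ring1 N" t1.B "ring2 N" t2.B "map12 N" "mmap12 H" by (rule h12)
  interpret h21: pre_hopf_hom "ring2 N" t2.B "ring1 N" t1.B "map21 N" "mmap21 H" by (rule h21)
  have ring: "group_mixed_ring (mixed_group_transport M f g H) = group_mixed_ring H"
    by (simp add: group_mixed_ring_def mixed_group_transport_def t1.B_simps t2.B_simps)
  have "is_mixed_ring p (group_mixed_ring H)"
    using M by (simp add: is_mixed_group_def is_mixed_algebra_def)
  moreover have "(hunit t1.B, hunit t2.B) \<in> mixed_hom N (group_mixed_ring H)"
    using h12.H.hunit h12.B.hunit h12.\<iota>_hunit h21.\<iota>_hunit
    by (simp add: mixed_hom_def group_mixed_ring_def t1.B_simps(1) t2.B_simps(1))
  ultimately have "is_mixed_algebra p N (group_mixed_ring (mixed_group_transport M f g H))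
      (hunit t1.B) (hunit t2.B)"
    using fg(2) by (simp add: ring is_mixed_algebra_def)
  moreover have "is_hopf (ring1 N) t1.B" "finitely_generated_hopf (ring1 N) t1.B"
    "is_hopf (ring2 N) t2.B" "finitely_generated_hopf (ring2 N) t2.B"
    using M by (simp_all add: is_mixed_group_def generating_hopf_hom.is_hopf[OF t1.transport_hom]
        generating_hopf_hom.is_hopf[OF t2.transport_hom]
        generating_hopf_hom.finitely_generated[OF t1.transport_hom]
        generating_hopf_hom.finitely_generated[OF t2.transport_hom])
  ultimately show ?thesis
    using h12.\<iota> h21.\<iota> by (simp add: is_mixed_group_def mixed_group_transport_def)
qed


section \<open>Twisted groups\<close>

lemma is_twisted_group_pre_hopf_hom:
  assumes "is_twisted_group p K Z"
  shows "pre_hopf_hom (base K) (thopf Z) (base K) (thopf Z) (endo K) (tendo Z)"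
  using assms
  by (auto simp: is_twisted_group_def is_twisted_algebra_def is_twisted_ring_def
      intro!: pre_hopf_hom.intro pre_hopf_hom_axioms.intro is_hopf_pre_hopf)

text \<open>The ring part is base change of the underlying twisted algebra. For the Hopf part, the
  new endomorphism is an instance of functoriality of base change, semilinear over
  \<open>endo L\<close>.\<close>

lemma is_twisted_group_base_change:
  assumes p: "prime p" and Z: "is_twisted_group p K Z" and L: "is_twisted_algebra p K L j"
  shows "is_twisted_group p L (twisted_group_base_change K Z L j)"
proof -
  interpret Z: pre_hopf_hom "base K" "thopf Z" "base K" "thopf Z" "endo K" "tendo Z"
    by (rule is_twisted_group_pre_hopf_hom[OF Z])
  interpret bc: hopf_scalar_extension "base K" "thopf Z" "base L" j
    using L by (intro hopf_scalar_extension.intro hopf_scalar_extension_axioms.intro Z.H.pre_hopf_axioms)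
      (simp_all add: is_twisted_algebra_def is_twisted_ring_def char_p_ring_def twisted_hom_def)
  have alg: "is_twisted_algebra p K (group_twisted_ring Z) (hunit (thopf Z))"
    and hopf: "is_hopf (base K) (thopf Z)" "finitely_generated_hopf (base K) (thopf Z)"
    using Z by (simp_all add: is_twisted_group_def)
  have ring: "group_twisted_ring (twisted_group_base_change K Z L j) =
      twisted_base_change K (group_twisted_ring Z) (hunit (thopf Z)) L j"
    by (simp add: group_twisted_ring_def twisted_group_base_change_def twisted_base_change_def)
  have unit: "hunit (thopf (twisted_group_base_change K Z L j)) =
      twisted_base_change_unit K (group_twisted_ring Z) (hunit (thopf Z)) L j"
    by (simp add: group_twisted_ring_def twisted_group_base_change_def twisted_base_change_unit_def)
  have "pre_hopf_hom (base L) bc.B (base L) bc.B (endo L)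
      (tensor_map (base K) (hunit (thopf Z)) (hring (thopf Z)) j (base L) (tendo Z) (endo L))"
    by (rule base_change_map_hopf_hom[OF bc.hopf_scalar_extension_axioms bc.hopf_scalar_extension_axioms
          Z.pre_hopf_hom_axioms])
      (use L in \<open>simp_all add: is_twisted_algebra_def is_twisted_ring_def twisted_hom_def\<close>)
  then interpret endo: pre_hopf_hom "base L" bc.B "base L" bc.B "endo L"
    "tensor_map (base K) (hunit (thopf Z)) (hring (thopf Z)) j (base L) (tendo Z) (endo L)" .
  have "is_twisted_algebra p L (group_twisted_ring (twisted_group_base_change K Z L j))
      (hunit (thopf (twisted_group_base_change K Z L j)))"
    unfolding ring unit by (rule is_twisted_algebra_base_change[OF p alg L])
  then show ?thesis
    using endo.\<iota> bc.is_hopf_base_change[OF hopf(1)] bc.finitely_generated_base_change[OF hopf(2)]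
    by (simp add: is_twisted_group_def twisted_group_base_change_def)
qed

section \<open>A twisted group and the mixed group made of two copies of it\<close>

context
  fixes p :: nat and k :: "'k ring" and \<sigma> and G :: "('k, 'a) twisted_group"
  assumes p: "prime p" and G: "is_twisted_group p \<lparr>base = k, endo = \<sigma>\<rparr> G"
begin

abbreviation (input) "diag_mixed \<equiv> \<lparr>ring1 = k, ring2 = k, map12 = \<sigma>, map21 = \<sigma>\<rparr>"
abbreviation (input) "swap_ring \<equiv> \<lparr>base = RDirProd k k, endo = (\<lambda>(x, y). (\<sigma> y, \<sigma> x))\<rparr>"
abbreviation (input) "diag_group \<equiv> \<lparr>hopf1 = thopf G, hopf2 = thopf G, mmap12 = tendo G, mmap21 = tendo G\<rparr>"

interpretation G: pre_hopf_hom k "thopf G" k "thopf G" \<sigma> "tendo G"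
  using is_twisted_group_pre_hopf_hom[OF G] by simp

lemma G_algebra: "is_twisted_algebra p \<lparr>base = k, endo = \<sigma>\<rparr>
    \<lparr>base = hring (thopf G), endo = tendo G\<rparr> (hunit (thopf G))"
  using G by (simp add: is_twisted_group_def group_twisted_ring_def)

lemma G_hopf: "is_hopf k (thopf G)" "finitely_generated_hopf k (thopf G)"
  using G by (simp_all add: is_twisted_group_def)

lemma is_mixed_group_diag: "is_mixed_group p diag_mixed diag_group"
  using is_mixed_algebra_diag[OF G_algebra] G_hopf G.\<iota>
  by (simp add: is_mixed_group_def group_mixed_ring_def)

lemma twisted_of_mixed_group_diag: "twisted_of_mixed_group diag_mixed diag_group =
    \<lparr>thopf = hopf_prod k k (thopf G) (thopf G), tendo = (\<lambda>(x, y). (tendo G y, tendo G x))\<rparr>"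
  by (simp add: twisted_of_mixed_group_def)

lemma is_twisted_group_prod: "is_twisted_group p swap_ring (twisted_of_mixed_group diag_mixed diag_group)"
proof -
  let ?P = "hopf_prod k k (thopf G) (thopf G)"
  let ?f = "\<lambda>(x, y). (tendo G y, tendo G x)"
  interpret P: generating_hopf_hom k "thopf G" "RDirProd k k" ?P "\<lambda>c. (c, c)" "\<lambda>a. (a, a)"
    by (rule G.H.diag_hom)
  have alg: "is_twisted_algebra p swap_ring \<lparr>base = hring ?P, endo = ?f\<rparr> (hunit ?P)"
    using is_twisted_algebra_of_mixed[OF is_mixed_algebra_diag[OF G_algebra]]
    by (simp add: twisted_of_mixed_diag G.H.P_simps)
  have "pre_hopf_hom (RDirProd k k) ?P (RDirProd k k) ?P (\<lambda>(x, y). (\<sigma> y, \<sigma> x)) ?f"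
  proof (rule P.hopf_hom_from_generators)
    \<comment> \<open>On the diagonal the swap disappears: \<open>?f (a, a)\<close> is the diagonal
      image of \<open>tendo G a\<close>.\<close>
    show "pre_hopf_hom k (thopf G) (RDirProd k k) ?P (\<lambda>c. (\<lambda>(x, y). (\<sigma> y, \<sigma> x)) (c, c)) (\<lambda>a. ?f (a, a))"
      using hopf_hom_comp[OF G.pre_hopf_hom_axioms P.pre_hopf_hom_axioms] by simp
  next
    fix c assume "c \<in> carrier (RDirProd k k)"
    then show "?f (hunit ?P c) = hunit ?P ((\<lambda>(x, y). (\<sigma> y, \<sigma> x)) c)"
      by (auto simp: RDirProd_simps G.H.P_simps G.\<iota>_hunit)
  qed (use alg in \<open>simp_all add: is_twisted_algebra_def is_twisted_ring_def\<close>)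
  then interpret f: pre_hopf_hom "RDirProd k k" ?P "RDirProd k k" ?P "\<lambda>(x, y). (\<sigma> y, \<sigma> x)" ?f .
  show ?thesis
    using alg f.\<iota> P.is_hopf[OF G_hopf(1)] P.finitely_generated[OF G_hopf(2)]
    by (simp add: twisted_of_mixed_group_diag is_twisted_group_def group_twisted_ring_def)
qed

text \<open>\<open>to_prod\<close> is exactly the extension of \<open>a \<mapsto> (a, a)\<close>
  along base change, hence a morphism of Hopf algebras. Its bijectivity and its compatibility with
  the endomorphisms are those known for rings.\<close>

lemma diagonal_base_change_corresponds_group:
  "corresponds_mixed_group p diag_mixed (twisted_group_base_change \<lparr>base = k, endo = \<sigma>\<rparr> G swap_ring (\<lambda>x. (x, x))) diag_group"
proof -
  let ?K = "\<lparr>base = k, endo = \<sigma>\<rparr>"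
  let ?Z = "twisted_group_base_change ?K G swap_ring (\<lambda>x. (x, x))"
  let ?P = "hopf_prod k k (thopf G) (thopf G)"
  have L: "is_twisted_algebra p ?K swap_ring (\<lambda>x. (x, x))"
    using G_algebra by (intro diag_algebra) (simp add: is_twisted_algebra_def)
  have Z: "is_twisted_group p swap_ring ?Z" by (rule is_twisted_group_base_change[OF p G L])
  interpret P: generating_hopf_hom k "thopf G" "RDirProd k k" ?P "\<lambda>c. (c, c)" "\<lambda>a. (a, a)"
    by (rule G.H.diag_hom)
  interpret bc: hopf_scalar_extension k "thopf G" "RDirProd k k" "\<lambda>x. (x, x)"
    by (intro hopf_scalar_extension.intro hopf_scalar_extension_axioms.intro G.H.pre_hopf_axioms
        RDirProd_cring G.H.k_cring diag_ring_hom)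
  interpret diagonal_base_change k "hring (thopf G)" "hunit (thopf G)"
    by (intro diagonal_base_change.intro G.H.k_cring G.H.A_cring G.H.hunit)
  have "pre_hopf_hom (RDirProd k k) bc.B (RDirProd k k) ?P id
      (tensor_lift (hring ?P) (\<lambda>a. (a, a)) (\<lambda>s. hunit ?P (id s)))"
    by (rule bc.lift_hopf_hom) (use P.pre_hopf_hom_axioms in \<open>simp_all add: ring_hom_def\<close>)
  then have "pre_hopf_hom (RDirProd k k) bc.B (RDirProd k k) ?P id to_prod"
    by (simp add: G.H.P_simps(1,2) to_prod_def)
  then interpret f: pre_hopf_hom "RDirProd k k" bc.B "RDirProd k k" ?P id to_prod .
  have "to_prod \<in> hopf_hom (RDirProd k k) (RDirProd k k) id (thopf ?Z) ?P"
    using f.\<iota> by (simp add: twisted_group_base_change_def)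
  moreover have "to_prod \<in> twisted_hom (group_twisted_ring ?Z) (group_twisted_ring (twisted_of_mixed_group diag_mixed diag_group))"
    using diagonal_base_change_hom[OF p G_algebra]
    by (simp add: group_twisted_ring_def twisted_of_mixed_group_diag twisted_base_change_def
        twisted_group_base_change_def G.H.P_simps(1))
  moreover have "bij_betw to_prod (carrier (hring (thopf ?Z))) (carrier (hring ?P))"
    using to_prod_bij by (simp add: twisted_group_base_change_def G.H.P_simps(1))
  ultimately have "twisted_group_isomorphic p swap_ring ?Z (twisted_of_mixed_group diag_mixed diag_group)"
    using Z is_twisted_group_prod
    by (auto simp: twisted_group_isomorphic_def twisted_of_mixed_group_diag)
  then show ?thesis
    using is_mixed_group_diag by (simp add: corresponds_mixed_group_def twisted_of_mixed_diag)
qed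

end


section \<open>Groups of type \<open>\<^sup>2X\<^sub>n\<close> and \<open>X\<^sub>n\<close>\<close>

text \<open>\<open>\<sigma>\<close> is injective because \<open>k\<close> is a field, so it
  identifies \<open>k\<close> with its image. The Frobenius takes values in that image because
  \<open>\<sigma> (\<sigma> x)\<close> is the \<open>p\<close>-th power of \<open>x\<close>.\<close>

lemma
  fixes k :: "('k, 'm) ring_scheme"
  assumes p: "prime p" and k: "field k" and char: "char_p_ring p k" and \<sigma>: "is_tits_endomorphism p k \<sigma>"
  defines "K \<equiv> k\<lparr>carrier := \<sigma> ` carrier k\<rparr>"
  shows image_subfield_char: "char_p_ring p K"
    and image_subfield_hom: "\<sigma> \<in> ring_hom k K"
    and image_subfield_bij: "bij_betw \<sigma> (carrier k) (carrier K)"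
    and image_subfield_inc: "id \<in> ring_hom K k"
    and image_subfield_frobenius: "(\<lambda>x. x [^]\<^bsub>k\<^esub> p) \<in> ring_hom k K"
    and image_subfield_power: "x [^]\<^bsub>K\<^esub> (n::nat) = x [^]\<^bsub>k\<^esub> n"
proof -
  interpret k: field k by fact
  have \<sigma>: "\<sigma> \<in> ring_hom k k" and \<sigma>2: "\<And>x. x \<in> carrier k \<Longrightarrow> \<sigma> (\<sigma> x) = x [^]\<^bsub>k\<^esub> p"
    using \<sigma> by (simp_all add: is_tits_endomorphism_def)
  note \<sigma>_closed = ring_hom_closed[OF \<sigma>]
  interpret \<sigma>: ring_hom_ring k k \<sigma>
    by (intro ring_hom_ringI2 k.ring_axioms \<sigma>)
  have "subring (\<sigma> ` carrier k) k"
    by (rule \<sigma>.img_is_subring[OF k.carrier_is_subring])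
  then have "ring K"
    unfolding K_def using \<sigma>_closed by (subst k.subring_iff[symmetric]) auto
  then interpret K: ring K .
  have K_cring: "cring K"
    using \<sigma>_closed by (intro cring.intro K.ring_axioms K.monoid_comm_monoidI) (auto simp: K_def k.m_comm)
  show hom: "\<sigma> \<in> ring_hom k K"
    using \<sigma> by (auto simp: ring_hom_def K_def)
  show "char_p_ring p K" by (rule char_p_ring_hom[OF char K_cring hom])
  have "inj_on \<sigma> (carrier k)"
    by (rule non_trivial_field_hom_is_inj[OF \<sigma> k k])
  then show "bij_betw \<sigma> (carrier k) (carrier K)" by (simp add: bij_betw_def K_def)
  show "id \<in> ring_hom K k" using \<sigma>_closed by (auto simp: ring_hom_def K_def)
  have "x [^]\<^bsub>k\<^esub> p \<in> carrier K" if "x \<in> carrier k" for x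
    using that \<sigma>2[OF that, symmetric] \<sigma>_closed by (simp add: K_def)
  then show "(\<lambda>x. x [^]\<^bsub>k\<^esub> p) \<in> ring_hom k K"
    using frobenius_hom[OF p char] by (auto simp: ring_hom_def K_def)
  show "x [^]\<^bsub>K\<^esub> n = x [^]\<^bsub>k\<^esub> n"
    by (simp add: K_def nat_pow_def)
qed

text \<open>The pair \<open>(A, \<phi>)\<close> as a Hopf algebra over the prime field with an
  endomorphism squaring to the Frobenius, which is the datum of a twisted group over
  \<open>F_sqrt p\<close>.\<close>

locale isogeny_data =
  fixes p :: nat and A :: "(int, 'a) hopf" and \<phi> :: "'a \<Rightarrow> 'a"
  assumes p: "prime p" and A_hopf: "is_hopf (Fp p) A" and A_fg: "finitely_generated_hopf (Fp p) A"
    and \<phi>: "\<phi> \<in> hopf_hom (Fp p) (Fp p) id A A"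
    and \<phi>2: "\<And>a. a \<in> carrier (hring A) \<Longrightarrow> \<phi> (\<phi> a) = a [^]\<^bsub>hring A\<^esub> p"
begin

abbreviation ext where "ext l \<equiv> hopf_base_change (Fp p) A l (int_map l)"
abbreviation ext_ring where "ext_ring l \<equiv> tensor (Fp p) (hunit A) (hring A) (int_map l) l"
abbreviation ext_pure where "ext_pure l \<equiv> pure (Fp p) (hunit A) (hring A) (int_map l) l"
abbreviation ext_map where "ext_map l \<equiv> tensor_map (Fp p) (hunit A) (hring A) (int_map l) l"

lemma A_pre_hopf: "pre_hopf (Fp p) A"
  by (rule is_hopf_pre_hopf[OF A_hopf])

interpretation A: pre_hopf "Fp p" A by (rule A_pre_hopf)

lemma \<phi>_pre: "pre_hopf_hom (Fp p) A (Fp p) A id \<phi>"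
  by (intro pre_hopf_hom.intro pre_hopf_hom_axioms.intro A_pre_hopf \<phi>) (simp add: ring_hom_def)

interpretation \<phi>: pre_hopf_hom "Fp p" A "Fp p" A id \<phi> by (rule \<phi>_pre)

lemma A_char: "char_p_ring p (hring A)"
  by (rule char_p_ring_hom[OF Fp_char_p[OF p] A.A_cring A.hunit])

text \<open>It exhibits the group of type \<open>\<^sup>2X\<^sub>n\<close> as a base change from
  \<open>F_sqrt p\<close> to \<open>(k, \<sigma>)\<close>, so that the general result shows it to be
  a twisted group.\<close>

lemma A_twisted_group: "is_twisted_group p (F_sqrt p) \<lparr>thopf = A, tendo = \<phi>\<rparr>"
  using A_hopf A_fg \<phi> A_char \<phi>2 \<phi>.\<iota>_hom A.hunit \<phi>.\<iota>_hunit is_twisted_ring_F_sqrt[OF p]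
  by (simp add: is_twisted_group_def is_twisted_algebra_def is_twisted_ring_def twisted_hom_def
      group_twisted_ring_def F_sqrt_def)

lemma ext_data:
  assumes "char_p_ring p l"
  shows "hopf_scalar_extension (Fp p) A l (int_map l)"
  using assms int_map_hom[OF p assms] A_pre_hopf
  by (intro hopf_scalar_extension.intro hopf_scalar_extension_axioms.intro) (simp_all add: char_p_ring_def)

lemma ext_tensor:
  assumes "char_p_ring p l"
  shows "tensor_product (Fp p) (hunit A) (hring A) (int_map l) l"
proof -
  interpret hopf_scalar_extension "Fp p" A l "int_map l" by (rule ext_data[OF assms])
  show ?thesis by (rule bc.tensor_product_axioms)
qed

lemma ext_hring [simp]: "hring (ext l) = ext_ring l"
  by (simp add: hopf_base_change_def Let_def)

lemma ext_hopf:
  assumes l: "char_p_ring p l"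
  shows "is_hopf l (ext l)" "finitely_generated_hopf l (ext l)" "char_p_ring p (ext_ring l)"
proof -
  interpret l: hopf_scalar_extension "Fp p" A l "int_map l" by (rule ext_data[OF l])
  show "is_hopf l (ext l)" "finitely_generated_hopf l (ext l)"
    by (rule l.is_hopf_base_change[OF A_hopf] l.finitely_generated_base_change[OF A_fg])+
  show "char_p_ring p (ext_ring l)"
    by (rule char_p_ring_hom[OF l l.bc.T_cring l.bc.pure_right_hom])
qed

lemma int_map_compat:
  assumes "char_p_ring p l" "char_p_ring p l'" "\<tau> \<in> ring_hom l l'"
  shows "\<tau> (int_map l c) = int_map l' c"
  using assms by (intro ring_hom_int_map) (simp_all add: char_p_ring_def cring.axioms)

lemma ext_map_hopf_hom:
  assumes l: "char_p_ring p l" and l': "char_p_ring p l'" and \<tau>: "\<tau> \<in> ring_hom l l'"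
    and \<psi>: "pre_hopf_hom (Fp p) A (Fp p) A id \<psi>"
  shows "pre_hopf_hom l (ext l) l' (ext l') \<tau> (ext_map l' \<psi> \<tau>)"
  by (rule base_change_map_hopf_hom[OF ext_data[OF l] ext_data[OF l'] \<psi> \<tau>])
    (simp add: int_map_compat[OF l l' \<tau>])

lemma ext_map_setup:
  assumes l: "char_p_ring p l" and l': "char_p_ring p l'" and \<tau>: "\<tau> \<in> ring_hom l l'"
    and \<psi>: "pre_hopf_hom (Fp p) A (Fp p) A id \<psi>"
  shows "tensor_product_map (Fp p) (hunit A) (hring A) (int_map l) l
    (Fp p) (hunit A) (hring A) (int_map l') l' id \<psi> \<tau>"
proof -
  interpret \<psi>: pre_hopf_hom "Fp p" A "Fp p" A id \<psi> by (rule \<psi>)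
  show ?thesis
    by (intro tensor_product_map.intro tensor_product_map_axioms.intro ext_tensor l l' \<tau> \<psi>.\<iota>_hom)
      (simp_all add: int_map_compat[OF l l' \<tau>] \<psi>.\<iota>_hunit)
qed

text \<open>The map \<open>h\<close> is left general because it will be either a third map of the
  same shape or the Frobenius of the extended ring.\<close>

lemma ext_map_comp:
  assumes l: "char_p_ring p l" and l': "char_p_ring p l'" and l'': "char_p_ring p l''"
    and \<tau>: "\<tau> \<in> ring_hom l l'" and \<tau>': "\<tau>' \<in> ring_hom l' l''"
    and \<psi>: "pre_hopf_hom (Fp p) A (Fp p) A id \<psi>" and \<psi>': "pre_hopf_hom (Fp p) A (Fp p) A id \<psi>'"
    and h: "h \<in> nonunital_hom (ext_ring l) (ext_ring l'')" and z: "z \<in> carrier (ext_ring l)"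
    and h_pure: "\<And>a b. a \<in> carrier (hring A) \<Longrightarrow> b \<in> carrier l \<Longrightarrow>
      h (ext_pure l a b) = ext_pure l'' (\<psi>' (\<psi> a)) (\<tau>' (\<tau> b))"
  shows "ext_map l'' \<psi>' \<tau>' (ext_map l' \<psi> \<tau> z) = h z"
proof -
  interpret m: tensor_product_map "Fp p" "hunit A" "hring A" "int_map l" l
    "Fp p" "hunit A" "hring A" "int_map l'" l' id \<psi> \<tau> by (rule ext_map_setup[OF l l' \<tau> \<psi>])
  interpret m': tensor_product_map "Fp p" "hunit A" "hring A" "int_map l'" l'
    "Fp p" "hunit A" "hring A" "int_map l''" l'' id \<psi>' \<tau>' by (rule ext_map_setup[OF l' l'' \<tau>' \<psi>'])
  show ?thesis
  proof (rule m.src.nonunital_hom_tensor_eqI[OF z ring_hom_nonunital[OF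
          ring_hom_comp'[OF m.tensor_map_hom m'.tensor_map_hom]] h])
    fix a b assume ab: "a \<in> carrier (hring A)" "b \<in> carrier l"
    then show "ext_map l'' \<psi>' \<tau>' (ext_map l' \<psi> \<tau> (ext_pure l a b)) = h (ext_pure l a b)"
      by (simp only: h_pure m.tensor_map_pure m'.tensor_map_pure ring_hom_closed[OF m.u]
          ring_hom_closed[OF m.v])
  qed
qed

lemma ext_map_comp_map:
  assumes l: "char_p_ring p l" and l': "char_p_ring p l'" and l'': "char_p_ring p l''"
    and \<tau>: "\<tau> \<in> ring_hom l l'" and \<tau>': "\<tau>' \<in> ring_hom l' l''" and \<tau>'': "\<tau>'' \<in> ring_hom l l''"
    and \<psi>: "pre_hopf_hom (Fp p) A (Fp p) A id \<psi>" and \<psi>': "pre_hopf_hom (Fp p) A (Fp p) A id \<psi>'"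
    and \<psi>'': "pre_hopf_hom (Fp p) A (Fp p) A id \<psi>''"
    and eq: "\<And>a. a \<in> carrier (hring A) \<Longrightarrow> \<psi>' (\<psi> a) = \<psi>'' a" "\<And>b. b \<in> carrier l \<Longrightarrow> \<tau>' (\<tau> b) = \<tau>'' b"
    and z: "z \<in> carrier (ext_ring l)"
  shows "ext_map l'' \<psi>' \<tau>' (ext_map l' \<psi> \<tau> z) = ext_map l'' \<psi>'' \<tau>'' z"
proof -
  interpret m: tensor_product_map "Fp p" "hunit A" "hring A" "int_map l" l
    "Fp p" "hunit A" "hring A" "int_map l''" l'' id \<psi>'' \<tau>'' by (rule ext_map_setup[OF l l'' \<tau>'' \<psi>''])
  show ?thesis
    by (rule ext_map_comp[OF l l' l'' \<tau> \<tau>' \<psi> \<psi>' ring_hom_nonunital[OF m.tensor_map_hom] z])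
      (simp add: m.tensor_map_pure eq)
qed

text \<open>One statement for both composites of a mixed group, with \<open>l\<close> and
  \<open>l'\<close> the two base rings in either order.\<close>

lemma ext_map_frobenius:
  assumes l: "char_p_ring p l" and l': "char_p_ring p l'"
    and \<tau>: "\<tau> \<in> ring_hom l l'" and \<tau>': "\<tau>' \<in> ring_hom l' l"
    and eq: "\<And>b. b \<in> carrier l \<Longrightarrow> \<tau>' (\<tau> b) = b [^]\<^bsub>l\<^esub> p"
    and z: "z \<in> carrier (ext_ring l)"
  shows "ext_map l \<phi> \<tau>' (ext_map l' \<phi> \<tau> z) = z [^]\<^bsub>ext_ring l\<^esub> p"
proof (rule ext_map_comp[OF l l' l \<tau> \<tau>' \<phi>_pre \<phi>_pre
      ring_hom_nonunital[OF frobenius_hom[OF p ext_hopf(3)[OF l]]] z])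
  interpret tp: tensor_product "Fp p" "hunit A" "hring A" "int_map l" l by (rule ext_tensor[OF l])
  interpret l: cring l by (rule tp.S_cring)
  interpret R: cring "hring A" by (rule A.A_cring)
  fix a b assume ab: "a \<in> carrier (hring A)" "b \<in> carrier l"
  \<comment> \<open>Powers of a pure tensor are formed factorwise, so the Frobenius acts on it by
    \<open>p\<close>-th powers in both factors.\<close>
  have "ext_pure l a b [^]\<^bsub>ext_ring l\<^esub> n = ext_pure l (a [^]\<^bsub>hring A\<^esub> n) (b [^]\<^bsub>l\<^esub> n)" for n :: nat
    using ab by (induction n) (simp_all add: tp.pure_one tp.pure_mult)
  then show "ext_pure l a b [^]\<^bsub>ext_ring l\<^esub> p = ext_pure l (\<phi> (\<phi> a)) (\<tau>' (\<tau> b))"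
    using ab by (simp add: \<phi>2 eq)
qed

lemma ext_map_id:
  assumes "char_p_ring p l" "z \<in> carrier (ext_ring l)"
  shows "ext_map l id id z = z"
  using tensor_product.tensor_map_id[OF ext_tensor[OF assms(1)] assms(2), of id id] by simp

section \<open>Comparison with the mixed group over the image of a Tits endomorphism\<close>

context
  fixes k :: "'k ring" and \<sigma> :: "'k \<Rightarrow> 'k"
  assumes field: "field k" and char: "char_p_ring p k" and \<sigma>: "is_tits_endomorphism p k \<sigma>"
begin

abbreviation (input) "K \<equiv> k\<lparr>carrier := \<sigma> ` carrier k\<rparr>"
abbreviation (input) "G \<equiv> twisted_type_group p A \<phi> k \<sigma>"
abbreviation (input) "M \<equiv> \<lparr>ring1 = k, ring2 = k, map12 = \<sigma>, map21 = \<sigma>\<rparr>"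
abbreviation (input) "N \<equiv> mixed_field p (\<sigma> ` carrier k) k"
abbreviation (input) "D \<equiv> mixed_type_group p A \<phi> (\<sigma> ` carrier k) k"
abbreviation (input) "H \<equiv> \<lparr>hopf1 = thopf G, hopf2 = thopf G, mmap12 = tendo G, mmap21 = tendo G\<rparr>"
abbreviation (input) "fr \<equiv> \<lambda>x. x [^]\<^bsub>k\<^esub> p"

lemmas K = image_subfield_char[OF p field char \<sigma>] image_subfield_hom[OF p field char \<sigma>]
  image_subfield_bij[OF p field char \<sigma>] image_subfield_inc[OF p field char \<sigma>]
  image_subfield_frobenius[OF p field char \<sigma>] image_subfield_power[OF p field char \<sigma>]

lemma \<sigma>_hom: "\<sigma> \<in> ring_hom k k" and \<sigma>2: "x \<in> carrier k \<Longrightarrow> \<sigma> (\<sigma> x) = x [^]\<^bsub>k\<^esub> p"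
  using \<sigma> by (simp_all add: is_tits_endomorphism_def)

lemma \<sigma>_closed: "x \<in> carrier k \<Longrightarrow> \<sigma> x \<in> carrier k"
  by (rule ring_hom_closed[OF \<sigma>_hom])

lemma k_twisted: "is_twisted_ring p \<lparr>base = k, endo = \<sigma>\<rparr>"
  using char \<sigma>_hom \<sigma>2 by (simp add: is_twisted_ring_def)

lemma twisted_type_group_simps: "thopf G = ext k" "tendo G = ext_map k \<phi> \<sigma>"
  by (simp_all add: twisted_type_group_def)

lemma is_twisted_group_twisted_type: "is_twisted_group p \<lparr>base = k, endo = \<sigma>\<rparr> G"
proof -
  have "is_twisted_algebra p (F_sqrt p) \<lparr>base = k, endo = \<sigma>\<rparr> (int_map k)"
    using F_sqrt_algebra[OF p k_twisted] by simp
  from is_twisted_group_base_change[OF p A_twisted_group this] show ?thesis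
    by (simp add: twisted_group_base_change_def twisted_type_group_def F_sqrt_def)
qed

lemma N_simps: "ring1 N = K" "ring2 N = k" "map12 N = id" "map21 N = fr"
  by (simp_all add: mixed_field_def)

lemma is_mixed_ring_N: "is_mixed_ring p N"
  using K char by (simp add: is_mixed_ring_def N_simps)

text \<open>Commutation with the maps from the second ring to the first is the identity expressing
  that \<open>\<sigma>\<close> squares to the Frobenius.\<close>

lemma mixed_ring_iso: "is_mixed_ring_iso p M N \<sigma> id"
  using K char k_twisted is_mixed_ring_N \<sigma>2
  by (simp add: is_mixed_ring_iso_def is_mixed_ring_diag mixed_hom_def N_simps ring_hom_def)

lemma D_simps: "hopf1 D = ext K" "hopf2 D = ext k" "mmap12 D = ext_map k \<phi> id" "mmap21 D = ext_map K \<phi> fr"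
  by (simp_all add: mixed_type_group_def Let_def)

lemma D12: "pre_hopf_hom K (ext K) k (ext k) id (ext_map k \<phi> id)"
  by (rule ext_map_hopf_hom[OF K(1) char K(4) \<phi>_pre])

lemma D21: "pre_hopf_hom k (ext k) K (ext K) fr (ext_map K \<phi> fr)"
  by (rule ext_map_hopf_hom[OF char K(1) K(5) \<phi>_pre])

lemma is_mixed_group_mixed_type: "is_mixed_group p N D"
proof -
  interpret D12: pre_hopf_hom K "ext K" k "ext k" id "ext_map k \<phi> id" by (rule D12)
  interpret D21: pre_hopf_hom k "ext k" K "ext K" fr "ext_map K \<phi> fr" by (rule D21)
  \<comment> \<open>The two composites are instances of \<open>ext_map_frobenius\<close> with
    \<open>K\<close> and \<open>k\<close> exchanged; \<open>K(6)\<close> identifies powers taken in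
    \<open>K\<close> with powers taken in \<open>k\<close>.\<close>
  have "is_mixed_ring p (group_mixed_ring D)"
    using ext_hopf(3)[OF K(1)] ext_hopf(3)[OF char] D12.\<iota>_hom D21.\<iota>_hom
      ext_map_frobenius[OF K(1) char K(4) K(5)] ext_map_frobenius[OF char K(1) K(5) K(4)]
    by (simp add: is_mixed_ring_def group_mixed_ring_def D_simps K(6))
  moreover have "(hunit (ext K), hunit (ext k)) \<in> mixed_hom N (group_mixed_ring D)"
    using D12.H.hunit D12.B.hunit D12.\<iota>_hunit D21.\<iota>_hunit
    by (simp add: mixed_hom_def group_mixed_ring_def D_simps N_simps)
  ultimately show ?thesis
    using is_mixed_ring_N ext_hopf[OF K(1)] ext_hopf[OF char] D12.\<iota> D21.\<iota>
    by (simp add: is_mixed_group_def is_mixed_algebra_def D_simps N_simps)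
qed

text \<open>Transport changes the scalars but not the rings, so the first component still has ring
  \<open>ext_ring k\<close>, whereas the target has \<open>ext_ring K\<close>. This is why a
  nontrivial map is needed there.\<close>

lemma mixed_group_iso: "mixed_group_isomorphic p N (mixed_group_transport M \<sigma> id H) D"
proof -
  let ?f = "ext_map K id \<sigma>"
  let ?T = "mixed_group_transport M \<sigma> id H"
  have T: "is_mixed_group p N ?T"
    by (rule is_mixed_group_transport[OF is_mixed_group_diag[OF p is_twisted_group_twisted_type] mixed_ring_iso])
  interpret ek: pre_hopf k "ext k" by (rule is_hopf_pre_hopf[OF ext_hopf(1)[OF char]])
  have id_pre: "pre_hopf_hom (Fp p) A (Fp p) A id id" by (rule A.pre_hopf_hom_id)
  interpret t1: hopf_transport_data k "ext k" K \<sigma>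
    using K by (intro hopf_transport_data.intro hopf_transport_data_axioms.intro ek.pre_hopf_axioms)
      (simp_all add: char_p_ring_def)
  interpret t2: hopf_transport_data k "ext k" k id
    by (intro hopf_transport_data.intro hopf_transport_data_axioms.intro ek.pre_hopf_axioms ek.k_cring)
      (simp_all add: ring_hom_def)
  have T_simps: "hopf1 ?T = t1.B" "hopf2 ?T = t2.B" "mmap12 ?T = ext_map k \<phi> \<sigma>" "mmap21 ?T = ext_map k \<phi> \<sigma>"
    by (simp_all add: mixed_group_transport_def twisted_type_group_simps)
  have f_pre: "pre_hopf_hom k (ext k) K (ext K) \<sigma> ?f"
    by (rule ext_map_hopf_hom[OF char K(1,2) id_pre])
  then interpret f: pre_hopf_hom k "ext k" K "ext K" \<sigma> ?f .
  \<comment> \<open>\<open>?f\<close> is semilinear over \<open>\<sigma>\<close> on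
    \<open>ext k\<close>. In the transported algebra \<open>d\<close> acts as its preimage under
    \<open>\<sigma>\<close>, which makes \<open>?f\<close> linear over \<open>K\<close>.\<close>
  have f1: "pre_hopf_hom K t1.B K (ext K) id ?f"
  proof (rule generating_hopf_hom.hopf_hom_from_generators[OF t1.transport_hom])
    show "pre_hopf_hom k (ext k) K (ext K) (\<lambda>c. id (\<sigma> c)) (\<lambda>a. ?f (id a))"
      using f_pre by simp
    show "?f \<in> ring_hom (hring t1.B) (hring (ext K))"
      using f.\<iota>_hom by (simp add: t1.B_simps)
    show "?f (hunit t1.B c) = hunit (ext K) (id c)" if "c \<in> carrier K" for c
      using that by (simp only: t1.B_simps f.\<iota>_hunit t1.inv_closed t1.f_inv id_apply)
  qed (simp add: ring_hom_def)
  \<comment> \<open>Transport along \<open>id\<close> is not literally trivial: the new unit map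
    contains \<open>inv_into (carrier k) id\<close>, which is the identity on the carrier
    only.\<close>
  have g1: "pre_hopf_hom k t2.B k (ext k) id id"
  proof (rule generating_hopf_hom.hopf_hom_from_generators[OF t2.transport_hom])
    show "pre_hopf_hom k (ext k) k (ext k) (\<lambda>c. id (id c)) (\<lambda>a. id (id a))"
      using ek.pre_hopf_hom_id by (simp add: id_def)
    show "id (hunit t2.B c) = hunit (ext k) (id c)" if "c \<in> carrier k" for c
      using that t2.f_inv[OF that] by (simp add: t2.B_simps)
  qed (simp_all add: ring_hom_def t2.B_simps)
  have inv: "inv_into (carrier k) \<sigma> \<in> ring_hom K k" by (rule t1.inv_hom)
  have id_hom: "id \<in> ring_hom l l" for l :: "'k ring" by (simp add: ring_hom_def)
  \<comment> \<open>The inverse is \<open>id \<otimes> \<sigma>\<^sup>-\<^sup>1\<close>; both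
    composites are again maps between extensions and equal \<open>id \<otimes> id\<close>.\<close>
  have bij: "bij_betw ?f (carrier (ext_ring k)) (carrier (ext_ring K))"
  proof (rule bij_betw_byWitness[where f' = "ext_map k id (inv_into (carrier k) \<sigma>)"])
    interpret g: pre_hopf_hom K "ext K" k "ext k" "inv_into (carrier k) \<sigma>" "ext_map k id (inv_into (carrier k) \<sigma>)"
      by (rule ext_map_hopf_hom[OF K(1) char inv id_pre])
    show "\<forall>z \<in> carrier (ext_ring k). ext_map k id (inv_into (carrier k) \<sigma>) (?f z) = z"
    proof
      fix z assume z: "z \<in> carrier (ext_ring k)"
      have "ext_map k id (inv_into (carrier k) \<sigma>) (?f z) = ext_map k id id z"
        by (rule ext_map_comp_map[OF char K(1) char K(2) inv id_hom id_pre id_pre id_pre _ _ z])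
          (simp_all only: t1.inv_f id_apply)
      then show "ext_map k id (inv_into (carrier k) \<sigma>) (?f z) = z"
        by (simp only: ext_map_id[OF char z])
    qed
    show "\<forall>z \<in> carrier (ext_ring K). ?f (ext_map k id (inv_into (carrier k) \<sigma>) z) = z"
    proof
      fix z assume z: "z \<in> carrier (ext_ring K)"
      have "?f (ext_map k id (inv_into (carrier k) \<sigma>) z) = ext_map K id id z"
        by (rule ext_map_comp_map[OF K(1) char K(1) inv K(2) id_hom id_pre id_pre id_pre _ _ z])
          (simp_all only: t1.f_inv id_apply)
      then show "?f (ext_map k id (inv_into (carrier k) \<sigma>) z) = z"
        by (simp only: ext_map_id[OF K(1) z])
    qed
    show "?f ` carrier (ext_ring k) \<subseteq> carrier (ext_ring K)"
      using f.\<iota>_closed by auto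
    show "ext_map k id (inv_into (carrier k) \<sigma>) ` carrier (ext_ring K) \<subseteq> carrier (ext_ring k)"
      using g.\<iota>_closed by auto
  qed
  \<comment> \<open>\<open>(\<phi> \<otimes> id) \<circ> (id \<otimes> \<sigma>) = \<phi> \<otimes>
    \<sigma>\<close>.\<close>
  have c12: "id (ext_map k \<phi> \<sigma> z) = ext_map k \<phi> id (?f z)" if "z \<in> carrier (ext_ring k)" for z
    using ext_map_comp_map[OF char K(1) char K(2) K(4) \<sigma>_hom id_pre \<phi>_pre \<phi>_pre _ _ that] by simp
  \<comment> \<open>\<open>(id \<otimes> \<sigma>) \<circ> (\<phi> \<otimes> \<sigma>) = \<phi>
    \<otimes> \<sigma>\<^sup>2\<close>, and the square of \<open>\<sigma>\<close> is
    \<open>fr\<close>.\<close>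
  have c21: "?f (ext_map k \<phi> \<sigma> z) = ext_map K \<phi> fr (id z)" if "z \<in> carrier (ext_ring k)" for z
    using ext_map_comp_map[OF char char K(1) \<sigma>_hom K(2) K(5) \<phi>_pre id_pre \<phi>_pre _ _ that] by (simp add: \<sigma>2)
  interpret f1: pre_hopf_hom K t1.B K "ext K" id ?f by (rule f1)
  interpret g1: pre_hopf_hom k t2.B k "ext k" id id by (rule g1)
  have "(?f, id) \<in> mixed_hom (group_mixed_ring ?T) (group_mixed_ring D)"
    using f1.\<iota>_hom g1.\<iota>_hom c12 c21
    by (simp add: mixed_hom_def group_mixed_ring_def T_simps D_simps t1.B_simps(1) t2.B_simps(1))
  moreover have "?f \<in> hopf_hom (ring1 N) (ring1 N) id (hopf1 ?T) (hopf1 D)"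
    "id \<in> hopf_hom (ring2 N) (ring2 N) id (hopf2 ?T) (hopf2 D)"
    unfolding T_simps D_simps N_simps by (rule f1.\<iota> g1.\<iota>)+
  moreover have "bij_betw ?f (carrier (hring (hopf1 ?T))) (carrier (hring (hopf1 D)))"
    "bij_betw id (carrier (hring (hopf2 ?T))) (carrier (hring (hopf2 D)))"
    unfolding T_simps D_simps t1.B_simps(1) t2.B_simps(1) using bij by simp_all
  ultimately show ?thesis
    using T is_mixed_group_mixed_type unfolding mixed_group_isomorphic_def by blast
qed

end

end


theorem mainTheorem4:
  fixes p :: nat
  assumes "prime p"
  shows
    "(\<forall>(R :: 'r ring) \<phi>. is_twisted_ring p \<lparr>base = R, endo = \<phi>\<rparr> \<longrightarrow>
      (let Z = \<lparr>base = R, endo = \<phi>\<rparr>;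
           j = (\<lambda>n. (n, n));
           B = twisted_base_change (F_sqrt p) Z (int_map R) (T_ring p) j;
           u = twisted_base_change_unit (F_sqrt p) Z (int_map R) (T_ring p) j
       in twisted_algebra_isomorphic p (T_ring p) B u
            \<lparr>base = RDirProd R R, endo = (\<lambda>(x, y). (\<phi> y, \<phi> x))\<rparr> (\<lambda>(m, n). (int_map R m, int_map R n)) \<and>
          corresponds_mixed_ring p B u \<lparr>ring1 = R, ring2 = R, map12 = \<phi>, map21 = \<phi>\<rparr>))
   \<and> (\<forall>(k :: 'c ring) \<sigma> (R :: 's ring) \<phi> s.
      is_twisted_algebra p \<lparr>base = k, endo = \<sigma>\<rparr> \<lparr>base = R, endo = \<phi>\<rparr> s \<longrightarrow>
      (let K = \<lparr>base = k, endo = \<sigma>\<rparr>;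
           Z = \<lparr>base = R, endo = \<phi>\<rparr>;
           L = \<lparr>base = RDirProd k k, endo = (\<lambda>(x, y). (\<sigma> y, \<sigma> x))\<rparr>;
           j = (\<lambda>x. (x, x))
       in corresponds_mixed_algebra p \<lparr>ring1 = k, ring2 = k, map12 = \<sigma>, map21 = \<sigma>\<rparr>
            (twisted_base_change K Z s L j) (twisted_base_change_unit K Z s L j)
            \<lparr>ring1 = R, ring2 = R, map12 = \<phi>, map21 = \<phi>\<rparr> s s))
   \<and> (\<forall>Xn (A :: (int, 'a) hopf) \<phi> (k :: 'k ring) \<sigma>.
      (Xn, p) \<in> {(B2, 2), (G2, 3), (F4, 2)} \<and>
      is_split_adjoint_group p Xn A \<and> is_special_isogeny p Xn A \<phi> \<and>
      field k \<and> char_p_ring p k \<and> is_tits_endomorphism p k \<sigma> \<longrightarrow>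
      (let K = \<lparr>base = k, endo = \<sigma>\<rparr>;
           G = twisted_type_group p A \<phi> k \<sigma>;
           L = \<lparr>base = RDirProd k k, endo = (\<lambda>(x, y). (\<sigma> y, \<sigma> x))\<rparr>;
           M = \<lparr>ring1 = k, ring2 = k, map12 = \<sigma>, map21 = \<sigma>\<rparr>;
           N = mixed_field p (\<sigma> ` carrier k) k
       in is_twisted_group p K G \<and>
          is_mixed_ring_iso p M N \<sigma> id \<and>
          (\<exists>H :: ('k, ('a, 'k) tensor, 'k, ('a, 'k) tensor) mixed_group.
            corresponds_mixed_group p M (twisted_group_base_change K G L (\<lambda>x. (x, x))) H \<and>
            mixed_group_isomorphic p N (mixed_group_transport M \<sigma> id H)
              (mixed_type_group p A \<phi> (\<sigma> ` carrier k) k))))"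
proof (intro conjI allI impI, goal_cases)
  case (1 R \<phi>)
  then show ?case unfolding Let_def by (intro conjI base_change_to_T_ring[OF assms])
next
  case (2 k \<sigma> R \<phi> s)
  then show ?case unfolding Let_def by (rule diagonal_base_change_corresponds[OF assms])
next
  case (3 Xn A \<phi> k \<sigma>)
  interpret isogeny_data p A \<phi>
    using assms 3 by (intro isogeny_data.intro)
      (simp_all add: is_split_adjoint_group_def connected_semisimple_group_def is_special_isogeny_def)
  have k: "field k" "char_p_ring p k" "is_tits_endomorphism p k \<sigma>"
    using 3 by simp_all
  note group = is_twisted_group_twisted_type[OF k]
  \<comment> \<open>Unification with this conjunction supplies the existential witness, whose Hopf
    algebras are both \<open>thopf\<close> and whose maps are both \<open>tendo\<close> of the
    twisted group.\<close>
  note H = conjI[OF diagonal_base_change_corresponds_group[OF assms group] mixed_group_iso[OF k]]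
  show ?case
    unfolding Let_def by (intro conjI[OF group] conjI[OF mixed_ring_iso[OF k]]) (rule exI, rule H)
qed

end
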